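(* Let $R$ be a commutative Noetherian ring, let $M,N$ be $R$-modules and assume $M$ admits a finite quasi-projective resolution $P$. Set $$l=\sup\{\operatorname{hsup} P-\operatorname{hinf} P,\ \operatorname{hsup}(P\otimes_RN)-\operatorname{hinf} P-1\},$$ $$m=\sup\{\operatorname{hsup} P-\operatorname{hinf} P,\ -\operatorname{hinf}(\operatorname{Hom}_R(P,N))-\operatorname{hinf} P-1\}.$$ Then for an integer $n\geq 1$ the following hold. (1) If $\operatorname{Tor}^R_i(M,N)=0$ for all $n\leq i \leq n+l$, then $\operatorname{Tor}^R_i(M,N)=0$ for all $i\geq n$. (2) If $\operatorname{Ext}^i_R(M,N)=0$ for all $n\leq i \leq n+m$, then $\operatorname{Ext}^i_R(M,N)=0$ for all $i\geq n$. (3) If $\operatorname{Tor}^R_i(M,N)=0$ for all $i\gg0$, then $\operatorname{Tor}^R_i(M,N)=0$ for all $i>\operatorname{hsup}(P\otimes_RN)-\operatorname{hsup} P$. (4) If $\operatorname{Ext}^i_R(M,N)=0$ for all $i\gg0$, then $\operatorname{Ext}^i_R(M,N)=0$ for all $i>-\operatorname{hinf}(\operatorname{Hom}_R(P,N))-\operatorname{hsup} P$.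
   Context: For a complex $X$ of $R$-modules (homologically indexed) put $\inf X=\inf\{i: X_i\neq0\}$, $\operatorname{hsup}X=\sup\{i: H_i(X)\neq0\}$ and $\operatorname{hinf}X=\inf\{i: H_i(X)\neq0\}$, with $\sup\emptyset=-\infty$ and $\inf\emptyset=\infty$. The complex $\operatorname{Hom}_R(P,N)$ is homologically indexed with $\operatorname{Hom}_R(P_i,N)$ in degree $-i$, so that $H^i(\operatorname{Hom}_R(P,N))=H_{-i}(\operatorname{Hom}_R(P,N))$. A quasi-projective resolution of an $R$-module $M$ is a bounded below complex $P$ of projective $R$-modules such that for all $i\ge\inf P$ there are integers $a_i\ge0$, not all zero, with $H_i(P)\cong M^{\oplus a_i}$; it is finite if $P$ is bounded. *)

theory Defs
  imports "HOL-Algebra.Algebra" "HOL-Library.Extended_Real" "HOL-Library.FSet"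
begin

section \<open>Modules\<close>

text \<open>
  The record type of modules extends that of rings, but the locale \<^locale>\<open>module\<close> ignores the
  ring multiplication and unit of the module; they are left unspecified here.
\<close>

definition mk_module :: "'b set \<Rightarrow> 'b \<Rightarrow> ('b \<Rightarrow> 'b \<Rightarrow> 'b) \<Rightarrow> ('a \<Rightarrow> 'b \<Rightarrow> 'b) \<Rightarrow> ('a, 'b) module" where
  "mk_module C z a s =
     \<lparr>carrier = C, monoid.mult = undefined, monoid.one = undefined,
      ring.zero = z, ring.add = a, module.smult = s\<rparr>"

lemma mk_module_simps [simp]:
  "carrier (mk_module C z a s) = C"
  "ring.zero (mk_module C z a s) = z"
  "ring.add (mk_module C z a s) = a"
  "module.smult (mk_module C z a s) = s"
  by (simp_all add: mk_module_def)

definition zero_module :: "('r, 'a) module \<Rightarrow> bool" where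
  "zero_module A \<longleftrightarrow> carrier A = {\<zero>\<^bsub>A\<^esub>}"

definition lin_maps :: "'r ring \<Rightarrow> ('r, 'a) module \<Rightarrow> ('r, 'b) module \<Rightarrow> ('a \<Rightarrow> 'b) set" where
  "lin_maps R A B =
     {f \<in> carrier A \<rightarrow> carrier B.
        (\<forall>x\<in>carrier A. \<forall>y\<in>carrier A. f (x \<oplus>\<^bsub>A\<^esub> y) = f x \<oplus>\<^bsub>B\<^esub> f y) \<and>
        (\<forall>r\<in>carrier R. \<forall>x\<in>carrier A. f (r \<odot>\<^bsub>A\<^esub> x) = r \<odot>\<^bsub>B\<^esub> f x)}"

definition module_iso :: "'r ring \<Rightarrow> ('r, 'a) module \<Rightarrow> ('r, 'b) module \<Rightarrow> bool" where
  "module_iso R A B \<longleftrightarrow> (\<exists>f\<in>lin_maps R A B. bij_betw f (carrier A) (carrier B))"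

definition quot_module :: "('r, 'a) module \<Rightarrow> 'a set \<Rightarrow> ('r, 'a set) module" where
  "quot_module A H =
     mk_module (a_rcosets\<^bsub>A\<^esub> H) H (set_add A) (\<lambda>r T. \<Union>x\<in>T. H +>\<^bsub>A\<^esub> (r \<odot>\<^bsub>A\<^esub> x))"

definition span_submodule :: "'r ring \<Rightarrow> ('r, 'a) module \<Rightarrow> 'a set \<Rightarrow> 'a set" where
  "span_submodule R A G = \<Inter>{H. submodule H R A \<and> G \<subseteq> H}"

definition direct_power :: "('r, 'a) module \<Rightarrow> nat \<Rightarrow> ('r, nat \<Rightarrow> 'a) module" where
  "direct_power A n =
     mk_module ({..<n} \<rightarrow>\<^sub>E carrier A) (\<lambda>j\<in>{..<n}. \<zero>\<^bsub>A\<^esub>)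
       (\<lambda>x y. \<lambda>j\<in>{..<n}. x j \<oplus>\<^bsub>A\<^esub> y j) (\<lambda>r x. \<lambda>j\<in>{..<n}. r \<odot>\<^bsub>A\<^esub> x j)"

definition hom_module :: "'r ring \<Rightarrow> ('r, 'a) module \<Rightarrow> ('r, 'b) module \<Rightarrow> ('r, 'a \<Rightarrow> 'b) module" where
  "hom_module R A B =
     mk_module (lin_maps R A B \<inter> extensional (carrier A)) (\<lambda>x\<in>carrier A. \<zero>\<^bsub>B\<^esub>)
       (\<lambda>f g. \<lambda>x\<in>carrier A. f x \<oplus>\<^bsub>B\<^esub> g x) (\<lambda>r f. \<lambda>x\<in>carrier A. r \<odot>\<^bsub>B\<^esub> f x)"

text \<open>The free module on \<open>S\<close>: finitely supported functions with support in \<open>S\<close>.\<close>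

definition free_module :: "'r ring \<Rightarrow> 's set \<Rightarrow> ('r, 's \<Rightarrow> 'r) module" where
  "free_module R S =
     mk_module {u. range u \<subseteq> carrier R \<and> finite {s. u s \<noteq> \<zero>\<^bsub>R\<^esub>} \<and> {s. u s \<noteq> \<zero>\<^bsub>R\<^esub>} \<subseteq> S}
       (\<lambda>s. \<zero>\<^bsub>R\<^esub>) (\<lambda>u v s. u s \<oplus>\<^bsub>R\<^esub> v s) (\<lambda>r u s. r \<otimes>\<^bsub>R\<^esub> u s)"

definition basis_vec :: "'r ring \<Rightarrow> 's \<Rightarrow> 's \<Rightarrow> 'r" where
  "basis_vec R s = (\<lambda>t. if t = s then \<one>\<^bsub>R\<^esub> else \<zero>\<^bsub>R\<^esub>)"

text \<open>The linear extension to a free module of a map \<open>g\<close> on the basis.\<close>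

definition lin_ext :: "'r ring \<Rightarrow> ('r, 'a) module \<Rightarrow> ('s \<Rightarrow> 'a) \<Rightarrow> ('s \<Rightarrow> 'r) \<Rightarrow> 'a" where
  "lin_ext R A g u = (\<Oplus>\<^bsub>A\<^esub>s\<in>{s. u s \<noteq> \<zero>\<^bsub>R\<^esub>}. u s \<odot>\<^bsub>A\<^esub> g s)"

text \<open>
  The lifting property of a projective module with elements in \<open>'p\<close> quantifies only over
  test modules with elements in \<open>'p \<Rightarrow> 'r\<close> and \<open>'p\<close>, a definition not being able to quantify over
  types. These test modules include the free module on the elements of \<open>Q\<close> and \<open>Q\<close> itself,
  which makes the lifting property hold over all types; see \<open>projective_lifting\<close> below.
\<close>

definition projective :: "'r ring \<Rightarrow> ('r, 'p) module \<Rightarrow> bool" where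
  "projective R Q \<longleftrightarrow> module R Q \<and>
     (\<forall>(A :: ('r, 'p \<Rightarrow> 'r) module) (B :: ('r, 'p) module) f g.
        module R A \<and> module R B \<and> f \<in> lin_maps R A B \<and> f ` carrier A = carrier B \<and>
        g \<in> lin_maps R Q B \<longrightarrow>
        (\<exists>h\<in>lin_maps R Q A. \<forall>x\<in>carrier Q. f (h x) = g x))"


section \<open>Tensor products\<close>

definition bilinear_relations ::
    "'r ring \<Rightarrow> ('r, 'a) module \<Rightarrow> ('r, 'b) module \<Rightarrow> ('a \<times> 'b \<Rightarrow> 'r) set" where
  "bilinear_relations R A B =
     (let F = free_module R (carrier A \<times> carrier B); e = (\<lambda>x y. basis_vec R (x, y)) in
       {e (x \<oplus>\<^bsub>A\<^esub> x') y \<ominus>\<^bsub>F\<^esub> (e x y \<oplus>\<^bsub>F\<^esub> e x' y) | x x' y.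
          x \<in> carrier A \<and> x' \<in> carrier A \<and> y \<in> carrier B} \<union>
       {e x (y \<oplus>\<^bsub>B\<^esub> y') \<ominus>\<^bsub>F\<^esub> (e x y \<oplus>\<^bsub>F\<^esub> e x y') | x y y'.
          x \<in> carrier A \<and> y \<in> carrier B \<and> y' \<in> carrier B} \<union>
       {e (r \<odot>\<^bsub>A\<^esub> x) y \<ominus>\<^bsub>F\<^esub> r \<odot>\<^bsub>F\<^esub> e x y | r x y.
          r \<in> carrier R \<and> x \<in> carrier A \<and> y \<in> carrier B} \<union>
       {e x (r \<odot>\<^bsub>B\<^esub> y) \<ominus>\<^bsub>F\<^esub> r \<odot>\<^bsub>F\<^esub> e x y | r x y.
          r \<in> carrier R \<and> x \<in> carrier A \<and> y \<in> carrier B})"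

definition tensor_relations ::
    "'r ring \<Rightarrow> ('r, 'a) module \<Rightarrow> ('r, 'b) module \<Rightarrow> ('a \<times> 'b \<Rightarrow> 'r) set" where
  "tensor_relations R A B =
     span_submodule R (free_module R (carrier A \<times> carrier B)) (bilinear_relations R A B)"

definition tensor ::
    "'r ring \<Rightarrow> ('r, 'a) module \<Rightarrow> ('r, 'b) module \<Rightarrow> ('r, ('a \<times> 'b \<Rightarrow> 'r) set) module" where
  "tensor R A B =
     quot_module (free_module R (carrier A \<times> carrier B)) (tensor_relations R A B)"

definition pure_tensor ::
    "'r ring \<Rightarrow> ('r, 'a) module \<Rightarrow> ('r, 'b) module \<Rightarrow> 'a \<Rightarrow> 'b \<Rightarrow> ('a \<times> 'b \<Rightarrow> 'r) set" where
  "pure_tensor R A B x y =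
     tensor_relations R A B +>\<^bsub>free_module R (carrier A \<times> carrier B)\<^esub> basis_vec R (x, y)"

text \<open>
  The map on a tensor product induced by a bilinear map \<open>g\<close> into \<open>C\<close>: the linear extension of
  \<open>g\<close> takes a single value on each coset.
\<close>

definition tensor_lift ::
    "'r ring \<Rightarrow> ('r, 'c) module \<Rightarrow> ('a \<Rightarrow> 'b \<Rightarrow> 'c) \<Rightarrow> ('a \<times> 'b \<Rightarrow> 'r) set \<Rightarrow> 'c" where
  "tensor_lift R C g T = the_elem (lin_ext R C (\<lambda>(x, y). g x y) ` T)"


section \<open>Complexes and homology\<close>

text \<open>Homological indexing: \<open>dif C i\<close> maps \<open>obj C i\<close> to \<open>obj C (i - 1)\<close>.\<close>

record ('r, 'x) cplx =
  obj :: "int \<Rightarrow> ('r, 'x) module"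
  dif :: "int \<Rightarrow> 'x \<Rightarrow> 'x"

definition chain_complex :: "'r ring \<Rightarrow> ('r, 'x) cplx \<Rightarrow> bool" where
  "chain_complex R C \<longleftrightarrow>
     (\<forall>i. module R (obj C i)) \<and>
     (\<forall>i. dif C i \<in> lin_maps R (obj C i) (obj C (i - 1))) \<and>
     (\<forall>i. \<forall>x\<in>carrier (obj C i). dif C (i - 1) (dif C i x) = \<zero>\<^bsub>obj C (i - 1 - 1)\<^esub>)"

definition cycles :: "('r, 'x) cplx \<Rightarrow> int \<Rightarrow> 'x set" where
  "cycles C i = a_kernel (obj C i) (obj C (i - 1)) (dif C i)"

definition boundaries :: "('r, 'x) cplx \<Rightarrow> int \<Rightarrow> 'x set" where
  "boundaries C i = dif C (i + 1) ` carrier (obj C (i + 1))"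

definition homology :: "('r, 'x) cplx \<Rightarrow> int \<Rightarrow> ('r, 'x set) module" where
  "homology C i = quot_module ((obj C i)\<lparr>carrier := cycles C i\<rparr>) (boundaries C i)"

definition bounded_below_cplx :: "('r, 'x) cplx \<Rightarrow> bool" where
  "bounded_below_cplx C \<longleftrightarrow> (\<exists>k. \<forall>i<k. zero_module (obj C i))"

definition bounded_above_cplx :: "('r, 'x) cplx \<Rightarrow> bool" where
  "bounded_above_cplx C \<longleftrightarrow> (\<exists>k. \<forall>i>k. zero_module (obj C i))"

definition bounded_cplx :: "('r, 'x) cplx \<Rightarrow> bool" where
  "bounded_cplx C \<longleftrightarrow> bounded_below_cplx C \<and> bounded_above_cplx C"

text \<open>
  The values lie in \<^typ>\<open>ereal\<close>, where \<^term>\<open>Sup {} = (-\<infinity> :: ereal)\<close> and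
  \<^term>\<open>Inf {} = (\<infinity> :: ereal)\<close>.
\<close>

definition cinf :: "('r, 'x) cplx \<Rightarrow> ereal" where
  "cinf C = Inf {ereal (of_int i) | i. \<not> zero_module (obj C i)}"

definition hsup :: "('r, 'x) cplx \<Rightarrow> ereal" where
  "hsup C = Sup {ereal (of_int i) | i. \<not> zero_module (homology C i)}"

definition hinf :: "('r, 'x) cplx \<Rightarrow> ereal" where
  "hinf C = Inf {ereal (of_int i) | i. \<not> zero_module (homology C i)}"

definition tensor_cplx ::
    "'r ring \<Rightarrow> ('r, 'x) cplx \<Rightarrow> ('r, 'b) module \<Rightarrow> ('r, ('x \<times> 'b \<Rightarrow> 'r) set) cplx" where
  "tensor_cplx R C B =
     \<lparr>obj = (\<lambda>i. tensor R (obj C i) B),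
      dif = (\<lambda>i. tensor_lift R (tensor R (obj C (i - 1)) B)
                   (\<lambda>x y. pure_tensor R (obj C (i - 1)) B (dif C i x) y))\<rparr>"

text \<open>
  \<open>Hom(C\<^sub>i, B)\<close> sits in degree \<open>-i\<close>, so the differential out of degree \<open>j\<close> is composition with
  the differential of \<open>C\<close> out of degree \<open>1 - j\<close>. The customary sign is omitted, since it affects
  neither kernels nor images.
\<close>

definition hom_cplx ::
    "'r ring \<Rightarrow> ('r, 'x) cplx \<Rightarrow> ('r, 'b) module \<Rightarrow> ('r, 'x \<Rightarrow> 'b) cplx" where
  "hom_cplx R C B =
     \<lparr>obj = (\<lambda>j. hom_module R (obj C (- j)) B),
      dif = (\<lambda>j f. \<lambda>x\<in>carrier (obj C (1 - j)). f (dif C (1 - j) x))\<rparr>"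


section \<open>Tor and Ext\<close>

text \<open>
  Tor and Ext are computed from the free resolution \<open>F\<close> of \<open>A\<close> in which \<open>F\<^sub>0\<close> is free on the
  elements of \<open>A\<close> and \<open>F\<^sub>n\<^sub>+\<^sub>1\<close> is free on the elements of the kernel of the map out of \<open>F\<^sub>n\<close>.
  All basis elements are put into one type: \<open>Gen a\<close> is the basis element of \<open>F\<^sub>0\<close> belonging to \<open>a\<close>,
  and \<open>Syz G\<close> the basis element of \<open>F\<^sub>n\<^sub>+\<^sub>1\<close> belonging to the kernel element \<open>u\<close> whose finite
  graph \<open>{(s, u s) | s. u s \<noteq> 0}\<close> is \<open>G\<close>.
\<close>

datatype ('r, 'a) gen = Gen 'a | Syz "(('r, 'a) gen \<times> 'r) fset"

primrec gen_elem :: "('r, 'a) gen \<Rightarrow> 'a" where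
  "gen_elem (Gen a) = a"
| "gen_elem (Syz G) = undefined"

definition syz :: "'r ring \<Rightarrow> (('r, 'a) gen \<Rightarrow> 'r) \<Rightarrow> ('r, 'a) gen" where
  "syz R u = Syz (Abs_fset {(s, u s) | s. u s \<noteq> \<zero>\<^bsub>R\<^esub>})"

definition syz_elem :: "'r ring \<Rightarrow> ('r, 'a) gen \<Rightarrow> ('r, 'a) gen \<Rightarrow> 'r" where
  "syz_elem R = inv_into (carrier (free_module R UNIV)) (syz R)"

definition res_aug :: "'r ring \<Rightarrow> ('r, 'a) module \<Rightarrow> (('r, 'a) gen \<Rightarrow> 'r) \<Rightarrow> 'a" where
  "res_aug R A = lin_ext R A gen_elem"

definition res_dif :: "'r ring \<Rightarrow> (('r, 'a) gen \<Rightarrow> 'r) \<Rightarrow> (('r, 'a) gen \<Rightarrow> 'r)" where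
  "res_dif R = lin_ext R (free_module R UNIV) (syz_elem R)"

primrec res_basis :: "'r ring \<Rightarrow> ('r, 'a) module \<Rightarrow> nat \<Rightarrow> ('r, 'a) gen set" where
  "res_basis R A 0 = Gen ` carrier A"
| "res_basis R A (Suc n) =
     syz R ` {u \<in> carrier (free_module R (res_basis R A n)).
                if n = 0 then res_aug R A u = \<zero>\<^bsub>A\<^esub> else res_dif R u = (\<lambda>s. \<zero>\<^bsub>R\<^esub>)}"

definition free_res :: "'r ring \<Rightarrow> ('r, 'a) module \<Rightarrow> ('r, ('r, 'a) gen \<Rightarrow> 'r) cplx" where
  "free_res R A =
     \<lparr>obj = (\<lambda>i. free_module R (if i < 0 then {} else res_basis R A (nat i))),
      dif = (\<lambda>i. if i \<le> 0 then (\<lambda>u s. \<zero>\<^bsub>R\<^esub>) else res_dif R)\<rparr>"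

definition Tor ::
    "'r ring \<Rightarrow> int \<Rightarrow> ('r, 'a) module \<Rightarrow> ('r, 'b) module \<Rightarrow>
     ('r, ((('r, 'a) gen \<Rightarrow> 'r) \<times> 'b \<Rightarrow> 'r) set set) module" where
  "Tor R i A B = homology (tensor_cplx R (free_res R A) B) i"

definition Ext ::
    "'r ring \<Rightarrow> int \<Rightarrow> ('r, 'a) module \<Rightarrow> ('r, 'b) module \<Rightarrow>
     ('r, ((('r, 'a) gen \<Rightarrow> 'r) \<Rightarrow> 'b) set) module" where
  "Ext R i A B = homology (hom_cplx R (free_res R A) B) (- i)"


section \<open>Quasi-projective resolutions\<close>

definition quasi_projective_resolution ::
    "'r ring \<Rightarrow> ('r, 'm) module \<Rightarrow> ('r, 'p) cplx \<Rightarrow> bool" where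
  "quasi_projective_resolution R M P \<longleftrightarrow>
     chain_complex R P \<and> bounded_below_cplx P \<and> (\<forall>i. projective R (obj P i)) \<and>
     (\<exists>a :: int \<Rightarrow> nat.
        (\<forall>i. cinf P \<le> ereal (of_int i) \<longrightarrow>
             module_iso R (homology P i) (direct_power M (a i))) \<and>
        (\<exists>i. cinf P \<le> ereal (of_int i) \<and> a i \<noteq> 0))"

definition finite_quasi_projective_resolution ::
    "'r ring \<Rightarrow> ('r, 'm) module \<Rightarrow> ('r, 'p) cplx \<Rightarrow> bool" where
  "finite_quasi_projective_resolution R M P \<longleftrightarrow>
     quasi_projective_resolution R M P \<and> bounded_cplx P"


section \<open>Properties of the constructions\<close>

subsection \<open>Free modules and projectivity\<close>

lemma free_module_simps:
  "carrier (free_module R S) = {u. range u \<subseteq> carrier R \<and> finite {s. u s \<noteq> \<zero>\<^bsub>R\<^esub>} \<and> {s. u s \<noteq> \<zero>\<^bsub>R\<^esub>} \<subseteq> S}"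
  "\<zero>\<^bsub>free_module R S\<^esub> = (\<lambda>s. \<zero>\<^bsub>R\<^esub>)"
  "u \<oplus>\<^bsub>free_module R S\<^esub> v = (\<lambda>s. u s \<oplus>\<^bsub>R\<^esub> v s)"
  "r \<odot>\<^bsub>free_module R S\<^esub> u = (\<lambda>s. r \<otimes>\<^bsub>R\<^esub> u s)"
  by (simp_all add: free_module_def)

lemma module_cring: "module R A \<Longrightarrow> cring R"
  by (simp add: module_def)

lemma module_free_module:
  assumes "cring R"
  shows "module R (free_module R S)"
proof -
  interpret R: cring R by fact
  have fin: "finite {s. u s \<oplus>\<^bsub>R\<^esub> v s \<noteq> \<zero>\<^bsub>R\<^esub>}"
    if "finite {s. u s \<noteq> \<zero>\<^bsub>R\<^esub>}" "finite {s. v s \<noteq> \<zero>\<^bsub>R\<^esub>}" for u v :: "'b \<Rightarrow> 'a"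
    by (rule finite_subset[of _ "{s. u s \<noteq> \<zero>\<^bsub>R\<^esub>} \<union> {s. v s \<noteq> \<zero>\<^bsub>R\<^esub>}"]) (use that in auto)
  have supp: "u s \<noteq> \<zero>\<^bsub>R\<^esub> \<or> v s \<noteq> \<zero>\<^bsub>R\<^esub>" if "u s \<oplus>\<^bsub>R\<^esub> v s \<noteq> \<zero>\<^bsub>R\<^esub>" for u v :: "'b \<Rightarrow> 'a" and s
    using that by auto
  have fin2: "finite {s. r \<otimes>\<^bsub>R\<^esub> u s \<noteq> \<zero>\<^bsub>R\<^esub>}"
    if "finite {s. u s \<noteq> \<zero>\<^bsub>R\<^esub>}" "r \<in> carrier R" for u :: "'b \<Rightarrow> 'a" and r
    by (rule finite_subset[of _ "{s. u s \<noteq> \<zero>\<^bsub>R\<^esub>}"]) (use that in auto)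
  show ?thesis
  proof (rule moduleI)
    show "abelian_group (free_module R S)"
    proof (rule abelian_groupI)
      fix u assume u: "u \<in> carrier (free_module R S)"
      show "\<exists>v\<in>carrier (free_module R S). v \<oplus>\<^bsub>free_module R S\<^esub> u = \<zero>\<^bsub>free_module R S\<^esub>"
      proof (rule bexI[of _ "\<lambda>s. \<ominus>\<^bsub>R\<^esub> u s"])
        show "(\<lambda>s. \<ominus>\<^bsub>R\<^esub> u s) \<in> carrier (free_module R S)"
        proof -
          have "{s. \<ominus>\<^bsub>R\<^esub> u s \<noteq> \<zero>\<^bsub>R\<^esub>} \<subseteq> {s. u s \<noteq> \<zero>\<^bsub>R\<^esub>}" by auto
          then show ?thesis using u by (auto simp: free_module_simps intro: finite_subset)
        qed
      qed (use u in \<open>auto simp: free_module_simps R.l_neg image_subset_iff\<close>)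
    qed (auto simp: free_module_simps image_subset_iff subset_iff fin R.a_ac fun_eq_iff dest!: supp)
  qed (use assms in \<open>auto simp: free_module_simps image_subset_iff fin2 R.l_distr R.r_distr R.m_assoc\<close>)
qed

lemma basis_vec_carrier:
  assumes "cring R" "s \<in> S" shows "basis_vec R s \<in> carrier (free_module R S)"
proof -
  interpret R: cring R by fact
  have "{t. basis_vec R s t \<noteq> \<zero>\<^bsub>R\<^esub>} \<subseteq> {s}" by (auto simp: basis_vec_def)
  then show ?thesis using assms(2) by (auto simp: free_module_simps basis_vec_def intro: finite_subset)
qed

lemma lin_ext_superset:
  assumes "module R A" "g \<in> S \<rightarrow> carrier A" "u \<in> carrier (free_module R S)"
    "finite T" "{s. u s \<noteq> \<zero>\<^bsub>R\<^esub>} \<subseteq> T" "T \<subseteq> S"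
  shows "lin_ext R A g u = (\<Oplus>\<^bsub>A\<^esub>s\<in>T. u s \<odot>\<^bsub>A\<^esub> g s)"
proof -
  interpret module R A by fact
  show ?thesis unfolding lin_ext_def
    by (rule M.add.finprod_mono_neutral_cong_left)
       (use assms in \<open>auto simp: free_module_simps image_subset_iff Pi_iff\<close>)
qed

lemma lin_ext_lin_maps:
  assumes "module R A" "g \<in> S \<rightarrow> carrier A"
  shows "lin_ext R A g \<in> lin_maps R (free_module R S) A"
proof -
  interpret module R A by fact
  interpret F: module R "free_module R S" by (rule module_free_module) unfold_locales
  have cl: "lin_ext R A g u \<in> carrier A" if "u \<in> carrier (free_module R S)" for u
    unfolding lin_ext_def using that assms
    by (auto intro!: M.finsum_closed simp: free_module_simps image_subset_iff Pi_iff subset_iff)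
  have add: "lin_ext R A g (u \<oplus>\<^bsub>free_module R S\<^esub> v) = lin_ext R A g u \<oplus>\<^bsub>A\<^esub> lin_ext R A g v"
    if u: "u \<in> carrier (free_module R S)" and v: "v \<in> carrier (free_module R S)" for u v
  proof -
    let ?T = "{s. u s \<noteq> \<zero>\<^bsub>R\<^esub>} \<union> {s. v s \<noteq> \<zero>\<^bsub>R\<^esub>}"
    have T: "finite ?T" "?T \<subseteq> S" using u v by (auto simp: free_module_simps)
    have car: "u s \<in> carrier R" "v s \<in> carrier R" for s using u v by (auto simp: free_module_simps)
    have g: "g s \<in> carrier A" if "s \<in> ?T" for s using that T assms by blast
    have sub: "{s. (u \<oplus>\<^bsub>free_module R S\<^esub> v) s \<noteq> \<zero>\<^bsub>R\<^esub>} \<subseteq> ?T"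
      by (auto simp: free_module_simps)
    have "lin_ext R A g (u \<oplus>\<^bsub>free_module R S\<^esub> v) = (\<Oplus>\<^bsub>A\<^esub>s\<in>?T. (u s \<oplus>\<^bsub>R\<^esub> v s) \<odot>\<^bsub>A\<^esub> g s)"
      using lin_ext_superset[OF assms F.M.a_closed[OF u v] T(1) sub T(2)]
      by (simp add: free_module_simps)
    also have "\<dots> = (\<Oplus>\<^bsub>A\<^esub>s\<in>?T. u s \<odot>\<^bsub>A\<^esub> g s \<oplus>\<^bsub>A\<^esub> v s \<odot>\<^bsub>A\<^esub> g s)"
      by (rule M.finsum_cong') (use car g smult_l_distr in auto)
    also have "\<dots> = (\<Oplus>\<^bsub>A\<^esub>s\<in>?T. u s \<odot>\<^bsub>A\<^esub> g s) \<oplus>\<^bsub>A\<^esub> (\<Oplus>\<^bsub>A\<^esub>s\<in>?T. v s \<odot>\<^bsub>A\<^esub> g s)"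
      by (rule M.finsum_addf) (use car g in auto)
    also have "\<dots> = lin_ext R A g u \<oplus>\<^bsub>A\<^esub> lin_ext R A g v"
      using lin_ext_superset[OF assms u T(1) _ T(2)] lin_ext_superset[OF assms v T(1) _ T(2)] by simp
    finally show ?thesis .
  qed
  have sm: "lin_ext R A g (r \<odot>\<^bsub>free_module R S\<^esub> u) = r \<odot>\<^bsub>A\<^esub> lin_ext R A g u"
    if r: "r \<in> carrier R" and u: "u \<in> carrier (free_module R S)" for r u
  proof -
    let ?T = "{s. u s \<noteq> \<zero>\<^bsub>R\<^esub>}"
    have T: "finite ?T" "?T \<subseteq> S" using u by (auto simp: free_module_simps)
    have car: "u s \<in> carrier R" for s using u by (auto simp: free_module_simps)
    have g: "g s \<in> carrier A" if "s \<in> ?T" for s using that T assms by blast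
    have sub: "{s. (r \<odot>\<^bsub>free_module R S\<^esub> u) s \<noteq> \<zero>\<^bsub>R\<^esub>} \<subseteq> ?T"
      using r by (auto simp: free_module_simps)
    have "lin_ext R A g (r \<odot>\<^bsub>free_module R S\<^esub> u) = (\<Oplus>\<^bsub>A\<^esub>s\<in>?T. (r \<otimes>\<^bsub>R\<^esub> u s) \<odot>\<^bsub>A\<^esub> g s)"
      using lin_ext_superset[OF assms F.smult_closed[OF r u] T(1) sub T(2)]
      by (simp add: free_module_simps)
    also have "\<dots> = (\<Oplus>\<^bsub>A\<^esub>s\<in>?T. r \<odot>\<^bsub>A\<^esub> (u s \<odot>\<^bsub>A\<^esub> g s))"
      by (rule M.finsum_cong') (use r car g smult_assoc1 in auto)
    also have "\<dots> = r \<odot>\<^bsub>A\<^esub> (\<Oplus>\<^bsub>A\<^esub>s\<in>?T. u s \<odot>\<^bsub>A\<^esub> g s)"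
      by (rule finsum_smult_ldistr[symmetric]) (use r car g T in auto)
    finally show ?thesis by (simp add: lin_ext_def)
  qed
  show ?thesis using cl add sm by (auto simp: lin_maps_def)
qed

lemma lin_ext_basis_vec:
  assumes "module R A" "g s \<in> carrier A"
  shows "lin_ext R A g (basis_vec R s) = g s"
proof -
  interpret module R A by fact
  have "lin_ext R A g (basis_vec R s) = (\<Oplus>\<^bsub>A\<^esub>t\<in>{s}. basis_vec R s t \<odot>\<^bsub>A\<^esub> g t)"
    by (rule lin_ext_superset[where S = "{s}"])
       (use assms basis_vec_carrier[of R s "{s}"] module_cring[OF assms(1)] in \<open>auto simp: basis_vec_def split: if_splits\<close>)
  also have "\<dots> = g s" using assms(2) by (simp add: basis_vec_def)
  finally show ?thesis .
qed

lemma lin_mapsD: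
  assumes "f \<in> lin_maps R A B"
  shows "x \<in> carrier A \<Longrightarrow> f x \<in> carrier B"
    and "x \<in> carrier A \<Longrightarrow> y \<in> carrier A \<Longrightarrow> f (x \<oplus>\<^bsub>A\<^esub> y) = f x \<oplus>\<^bsub>B\<^esub> f y"
    and "r \<in> carrier R \<Longrightarrow> x \<in> carrier A \<Longrightarrow> f (r \<odot>\<^bsub>A\<^esub> x) = r \<odot>\<^bsub>B\<^esub> f x"
  using assms by (auto simp: lin_maps_def)

lemma lin_maps_zero:
  assumes "module R A" "module R B" "f \<in> lin_maps R A B"
  shows "f \<zero>\<^bsub>A\<^esub> = \<zero>\<^bsub>B\<^esub>"
proof -
  interpret A: module R A by fact
  interpret B: module R B by fact
  have "f (\<zero>\<^bsub>R\<^esub> \<odot>\<^bsub>A\<^esub> \<zero>\<^bsub>A\<^esub>) = \<zero>\<^bsub>R\<^esub> \<odot>\<^bsub>B\<^esub> f \<zero>\<^bsub>A\<^esub>"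
    using lin_mapsD(3)[OF assms(3)] by blast
  then show ?thesis using lin_mapsD(1)[OF assms(3)] by simp
qed

lemma lin_maps_finsum:
  assumes "module R A" "module R B" "f \<in> lin_maps R A B" "g \<in> T \<rightarrow> carrier A" "finite T"
  shows "f (\<Oplus>\<^bsub>A\<^esub>t\<in>T. g t) = (\<Oplus>\<^bsub>B\<^esub>t\<in>T. f (g t))"
proof -
  interpret A: module R A by fact
  interpret B: module R B by fact
  show ?thesis using assms(5,4)
    by (induction T rule: finite_induct)
       (auto simp: lin_maps_zero[OF assms(1-3)] lin_mapsD[OF assms(3)] Pi_iff A.M.finsum_closed)
qed

lemma lin_maps_lin_ext:
  assumes "module R A" "module R B" "f \<in> lin_maps R A B" "g \<in> S \<rightarrow> carrier A"
    "u \<in> carrier (free_module R S)"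
  shows "f (lin_ext R A g u) = lin_ext R B (\<lambda>s. f (g s)) u"
proof -
  interpret A: module R A by fact
  interpret B: module R B by fact
  let ?T = "{s. u s \<noteq> \<zero>\<^bsub>R\<^esub>}"
  have T: "finite ?T" "?T \<subseteq> S" using assms(5) by (auto simp: free_module_simps)
  have car: "u s \<in> carrier R" for s using assms(5) by (auto simp: free_module_simps)
  have g: "g s \<in> carrier A" if "s \<in> ?T" for s using that T assms by blast
  have "f (lin_ext R A g u) = (\<Oplus>\<^bsub>B\<^esub>s\<in>?T. f (u s \<odot>\<^bsub>A\<^esub> g s))"
    unfolding lin_ext_def by (rule lin_maps_finsum[OF assms(1-3)]) (use car g T in auto)
  also have "\<dots> = (\<Oplus>\<^bsub>B\<^esub>s\<in>?T. u s \<odot>\<^bsub>B\<^esub> f (g s))"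
    by (rule B.M.finsum_cong') (use car g lin_mapsD[OF assms(3)] in auto)
  finally show ?thesis by (simp add: lin_ext_def)
qed

text \<open>A module with the lifting property of \<open>projective\<close> lifts against all surjections.\<close>

lemma projective_lifting:
  assumes "projective R Q" "module R A" "module R B"
    and f: "f \<in> lin_maps R A B" "f ` carrier A = carrier B" and g: "g \<in> lin_maps R Q B"
  shows "\<exists>h\<in>lin_maps R Q A. \<forall>x\<in>carrier Q. f (h x) = g x"
proof -
  have Q: "module R Q" using assms by (simp add: projective_def)
  interpret Q: module R Q by fact
  let ?F = "free_module R (carrier Q)"
  let ?p = "lin_ext R Q (\<lambda>x. x)"
  have F: "module R ?F" by (rule module_free_module) (rule module_cring[OF Q])
  have p: "?p \<in> lin_maps R ?F Q" by (rule lin_ext_lin_maps[OF Q]) auto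
  have "?p ` carrier ?F = carrier Q"
  proof
    show "?p ` carrier ?F \<subseteq> carrier Q" using lin_mapsD(1)[OF p] by auto
    show "carrier Q \<subseteq> ?p ` carrier ?F"
      using lin_ext_basis_vec[OF Q, of "\<lambda>x. x"] basis_vec_carrier[OF module_cring[OF Q]] by (metis image_eqI subsetI)
  qed
  moreover have "(\<lambda>x. x) \<in> lin_maps R Q Q" by (auto simp: lin_maps_def)
  ultimately obtain s where s: "s \<in> lin_maps R Q ?F" "\<And>x. x \<in> carrier Q \<Longrightarrow> ?p (s x) = x"
    using assms(1) p F Q unfolding projective_def by meson
  have "\<forall>x\<in>carrier Q. \<exists>a\<in>carrier A. f a = g x"
    using f(2) lin_mapsD(1)[OF g] by (metis imageE)
  then obtain k where k: "\<And>x. x \<in> carrier Q \<Longrightarrow> k x \<in> carrier A \<and> f (k x) = g x" by metis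
  let ?t = "lin_ext R A k"
  have t: "?t \<in> lin_maps R ?F A" by (rule lin_ext_lin_maps[OF assms(2)]) (use k in auto)
  have ft: "f (?t u) = g (?p u)" if u: "u \<in> carrier ?F" for u
  proof -
    have "f (?t u) = lin_ext R B (\<lambda>x. f (k x)) u"
      by (rule lin_maps_lin_ext[OF assms(2,3) f(1) _ u]) (use k in auto)
    also have "\<dots> = lin_ext R B g u"
      unfolding lin_ext_def
    proof -
      interpret B: module R B by fact
      show "(\<Oplus>\<^bsub>B\<^esub>s\<in>{s. u s \<noteq> \<zero>\<^bsub>R\<^esub>}. u s \<odot>\<^bsub>B\<^esub> f (k s)) = (\<Oplus>\<^bsub>B\<^esub>s\<in>{s. u s \<noteq> \<zero>\<^bsub>R\<^esub>}. u s \<odot>\<^bsub>B\<^esub> g s)"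
        by (rule B.M.finsum_cong')
           (use u k lin_mapsD(1)[OF g] in \<open>auto simp: free_module_simps image_subset_iff subset_iff intro!: B.smult_closed\<close>)
    qed
    also have "\<dots> = g (?p u)"
      by (rule lin_maps_lin_ext[OF Q assms(3) g _ u, symmetric]) auto
    finally show ?thesis .
  qed
  show ?thesis
  proof (rule bexI[of _ "\<lambda>x. ?t (s x)"])
    show "(\<lambda>x. ?t (s x)) \<in> lin_maps R Q A"
      using lin_mapsD[OF s(1)] lin_mapsD[OF t] by (auto simp: lin_maps_def)
  qed (use ft s lin_mapsD(1)[OF s(1)] in auto)
qed

lemma lin_maps_free_cong:
  assumes "module R A" "f \<in> lin_maps R (free_module R S) A" "u \<in> carrier (free_module R S)"
  shows "f u = lin_ext R A (\<lambda>s. f (basis_vec R s)) u"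
proof -
  interpret A: module R A by fact
  have F: "module R (free_module R S)" by (rule module_free_module) (rule module_cring[OF assms(1)])
  interpret F: module R "free_module R S" by fact
  have bv: "basis_vec R \<in> S \<rightarrow> carrier (free_module R S)"
    using basis_vec_carrier[OF module_cring[OF assms(1)]] by auto
  have eval: "(\<Oplus>\<^bsub>free_module R S\<^esub>s\<in>T. u s \<odot>\<^bsub>free_module R S\<^esub> basis_vec R s) = (\<lambda>s. if s \<in> T then u s else \<zero>\<^bsub>R\<^esub>)"
    if "finite T" "T \<subseteq> S" for T
    using that
  proof (induction T rule: finite_induct)
    case (insert t T)
    have car: "u s \<in> carrier R" for s using assms(3) by (auto simp: free_module_simps)
    have "(\<Oplus>\<^bsub>free_module R S\<^esub>s\<in>insert t T. u s \<odot>\<^bsub>free_module R S\<^esub> basis_vec R s)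
      = (u t \<odot>\<^bsub>free_module R S\<^esub> basis_vec R t) \<oplus>\<^bsub>free_module R S\<^esub> (\<lambda>s. if s \<in> T then u s else \<zero>\<^bsub>R\<^esub>)"
      using insert car bv by (subst F.M.finsum_insert) (auto intro!: F.smult_closed)
    then show ?case using insert(2) car by (auto simp: free_module_simps basis_vec_def fun_eq_iff)
  qed (simp add: free_module_simps)
  have "lin_ext R (free_module R S) (basis_vec R) u = u"
    unfolding lin_ext_def using assms(3) by (subst eval) (auto simp: free_module_simps fun_eq_iff)
  then show ?thesis using lin_maps_lin_ext[OF F assms(1,2) bv assms(3)] by simp
qed

lemma projective_free_module:
  fixes S :: "'s set"
  assumes "cring R" shows "projective R (free_module R S)"
  unfolding projective_def
proof (intro conjI allI impI, goal_cases)
  case 1 show ?case by (rule module_free_module[OF assms])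
next
  case (2 A B f g)
  then have A: "module R A" and B: "module R B" and f: "f \<in> lin_maps R A B" "f ` carrier A = carrier B"
    and g: "g \<in> lin_maps R (free_module R S) B" by auto
  have "\<forall>s\<in>S. \<exists>a\<in>carrier A. f a = g (basis_vec R s)"
    using f(2) lin_mapsD(1)[OF g] basis_vec_carrier[OF assms] by (metis imageE)
  then obtain k where k: "\<And>s. s \<in> S \<Longrightarrow> k s \<in> carrier A \<and> f (k s) = g (basis_vec R s)" by metis
  show ?case
  proof (rule bexI[of _ "lin_ext R A k"], rule ballI)
    fix u assume u: "u \<in> carrier (free_module R S)"
    interpret B: module R B by fact
    have gb: "g (basis_vec R s) \<in> carrier B" if "s \<in> S" for s
      using lin_mapsD(1)[OF g] basis_vec_carrier[OF assms that] by blast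
    have "f (lin_ext R A k u) = lin_ext R B (\<lambda>s. f (k s)) u"
      by (rule lin_maps_lin_ext[OF A B f(1) _ u]) (use k in auto)
    also have "\<dots> = lin_ext R B (\<lambda>s. g (basis_vec R s)) u"
      unfolding lin_ext_def
      by (rule B.M.finsum_cong')
         (use u k gb in
          \<open>auto simp: free_module_simps image_subset_iff subset_iff intro!: B.smult_closed\<close>)
    also have "\<dots> = g u" by (rule lin_maps_free_cong[OF B g u, symmetric])
    finally show "f (lin_ext R A k u) = g u" .
  qed (rule lin_ext_lin_maps[OF A], use k in auto)
qed


subsection \<open>The free resolution\<close>

lemma syz_elem_syz:
  assumes "u \<in> carrier (free_module R UNIV)"
  shows "syz_elem R (syz R u) = u"
proof -
  have fin: "finite {(s, v s) | s. v s \<noteq> \<zero>\<^bsub>R\<^esub>}" if "v \<in> carrier (free_module R UNIV)" for v :: "('a, 'b) gen \<Rightarrow> 'a"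
    using that by (auto simp: free_module_simps setcompr_eq_image)
  have "inj_on (syz R) (carrier (free_module R (UNIV :: ('a, 'b) gen set)))"
  proof (rule inj_onI, rule ext)
    fix u v :: "('a, 'b) gen \<Rightarrow> 'a" and s
    assume uv: "u \<in> carrier (free_module R UNIV)" "v \<in> carrier (free_module R UNIV)" "syz R u = syz R v"
    then have "{(s, u s) | s. u s \<noteq> \<zero>\<^bsub>R\<^esub>} = {(s, v s) | s. v s \<noteq> \<zero>\<^bsub>R\<^esub>}"
      using fin by (auto simp: syz_def Abs_fset_inject)
    then have "(s, r) \<in> {(s, u s) | s. u s \<noteq> \<zero>\<^bsub>R\<^esub>} \<longleftrightarrow> (s, r) \<in> {(s, v s) | s. v s \<noteq> \<zero>\<^bsub>R\<^esub>}" for r by simp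
    then show "u s = v s" by auto metis
  qed
  then show ?thesis using assms by (simp add: syz_elem_def)
qed

lemma free_module_mono: "S \<subseteq> T \<Longrightarrow> carrier (free_module R S) \<subseteq> carrier (free_module R T)"
  by (auto simp: free_module_simps)

lemma lin_ext_free_module_UNIV:
  assumes "cring R" "g \<in> S \<rightarrow> carrier (free_module R T)" "u \<in> carrier (free_module R S)"
  shows "lin_ext R (free_module R UNIV) g u = lin_ext R (free_module R T) g u"
proof -
  have "(\<lambda>x. x) \<in> lin_maps R (free_module R T) (free_module R UNIV)"
    using free_module_mono[of T UNIV R] by (auto simp: lin_maps_def free_module_simps)
  from lin_maps_lin_ext[OF module_free_module module_free_module this assms(2,3)] assms(1)
  show ?thesis by simp
qed

lemma lin_ext_zero:
  assumes "module R A" "u \<in> carrier (free_module R S)" "\<And>s. s \<in> S \<Longrightarrow> g s = \<zero>\<^bsub>A\<^esub>"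
  shows "lin_ext R A g u = \<zero>\<^bsub>A\<^esub>"
proof -
  interpret module R A by fact
  show ?thesis unfolding lin_ext_def
    by (rule M.add.finprod_one_eqI)
       (use assms(2,3) in \<open>auto simp: free_module_simps subset_iff image_subset_iff\<close>)
qed

lemma res_dif_lin_maps:
  assumes "module R A"
  shows "res_dif R \<in> lin_maps R (free_module R (res_basis R A (Suc n))) (free_module R (res_basis R A n))"
    (is "?l")
    and "res_dif R ` carrier (free_module R (res_basis R A (Suc n))) =
      {u \<in> carrier (free_module R (res_basis R A n)).
                if n = 0 then res_aug R A u = \<zero>\<^bsub>A\<^esub> else res_dif R u = (\<lambda>s. \<zero>\<^bsub>R\<^esub>)}" (is "?i = ?Z n")
    and "res_aug R A \<in> lin_maps R (free_module R (res_basis R A 0)) A"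
    and "res_aug R A ` carrier (free_module R (res_basis R A 0)) = carrier A"
proof -
  note cr = module_cring[OF assms]
  let ?F = "\<lambda>n. free_module R (res_basis R A n)"
  have M: "module R (free_module R S)" for S :: "('a,'b) gen set" by (rule module_free_module[OF cr])
  have Z: "?Z n \<subseteq> carrier (free_module R UNIV)" for n
    using free_module_mono[of "res_basis R A n" UNIV R] by auto
  have se: "syz_elem R \<in> res_basis R A (Suc n) \<rightarrow> ?Z n" for n
    unfolding res_basis.simps using syz_elem_syz Z by fastforce
  have seF: "syz_elem R \<in> res_basis R A (Suc n) \<rightarrow> carrier (?F n)" for n
    using se[of n] by blast
  have se0: "res_aug R A (syz_elem R s) = \<zero>\<^bsub>A\<^esub>" if "s \<in> res_basis R A (Suc 0)" for s
    using funcset_mem[OF se that] by simp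
  have seS: "res_dif R (syz_elem R s) = (\<lambda>s. \<zero>\<^bsub>R\<^esub>)" if "s \<in> res_basis R A (Suc (Suc k))" for s k
    using funcset_mem[OF se that] by simp
  have *: "res_dif R u = lin_ext R (?F n) (syz_elem R) u" if "u \<in> carrier (?F (Suc n))" for u n
    unfolding res_dif_def by (rule lin_ext_free_module_UNIV[OF cr seF that])
  have l: "lin_ext R (?F n) (syz_elem R) \<in> lin_maps R (?F (Suc n)) (?F n)" for n
    by (rule lin_ext_lin_maps[OF M seF])
  have L: "res_dif R \<in> lin_maps R (?F (Suc n)) (?F n)" for n
  proof -
    interpret F: module R "?F (Suc n)" by (rule M)
    have "res_dif R u \<in> carrier (?F n)" if "u \<in> carrier (?F (Suc n))" for u
      using lin_mapsD(1)[OF l that] *[OF that] by simp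
    moreover have "res_dif R (u \<oplus>\<^bsub>?F (Suc n)\<^esub> v) = res_dif R u \<oplus>\<^bsub>?F n\<^esub> res_dif R v"
      if "u \<in> carrier (?F (Suc n))" "v \<in> carrier (?F (Suc n))" for u v
      using lin_mapsD(2)[OF l that] *[OF that(1)] *[OF that(2)] *[OF F.M.a_closed[OF that]] by simp
    moreover have "res_dif R (r \<odot>\<^bsub>?F (Suc n)\<^esub> u) = r \<odot>\<^bsub>?F n\<^esub> res_dif R u"
      if "r \<in> carrier R" "u \<in> carrier (?F (Suc n))" for r u
      using lin_mapsD(3)[OF l that] *[OF that(2)] *[OF F.smult_closed[OF that]] by simp
    ultimately show ?thesis unfolding lin_maps_def by blast
  qed
  then show ?l .
  show a: "res_aug R A \<in> lin_maps R (?F 0) A"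
    unfolding res_aug_def by (rule lin_ext_lin_maps[OF assms]) auto
  show "res_aug R A ` carrier (?F 0) = carrier A"
  proof (intro equalityI subsetI)
    fix x assume x: "x \<in> carrier A"
    then have "res_aug R A (basis_vec R (Gen x)) = x"
      unfolding res_aug_def by (subst lin_ext_basis_vec[OF assms]) auto
    moreover have "basis_vec R (Gen x) \<in> carrier (?F 0)" by (rule basis_vec_carrier[OF cr]) (use x in auto)
    ultimately show "x \<in> res_aug R A ` carrier (?F 0)" by force
  qed (use lin_mapsD(1)[OF a] in auto)
  show "?i = ?Z n"
  proof (intro equalityI subsetI)
    fix v assume "v \<in> ?Z n"
    then have "v \<in> carrier (free_module R UNIV)" using Z[of n] by blast
    then have "res_dif R (basis_vec R (syz R v)) = v"
      unfolding res_dif_def by (subst lin_ext_basis_vec[OF M]) (simp_all add: syz_elem_syz)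
    moreover have "basis_vec R (syz R v) \<in> carrier (?F (Suc n))"
      by (rule basis_vec_carrier[OF cr]) (use \<open>v \<in> ?Z n\<close> in simp)
    ultimately show "v \<in> ?i" by (metis image_eqI)
  next
    fix v assume "v \<in> ?i"
    then obtain u where u: "u \<in> carrier (?F (Suc n))" "v = res_dif R u" by auto
    have v: "v \<in> carrier (?F n)" using lin_mapsD(1)[OF L] u by auto
    show "v \<in> ?Z n"
    proof (cases n)
      case 0
      have "res_aug R A (lin_ext R (?F 0) (syz_elem R) u) = lin_ext R A (\<lambda>s. res_aug R A (syz_elem R s)) u"
        by (rule lin_maps_lin_ext[OF M assms a seF u(1)[unfolded 0]])
      also have "\<dots> = \<zero>\<^bsub>A\<^esub>" by (rule lin_ext_zero[OF assms u(1)]) (use se0 0 in blast)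
      finally show ?thesis using v u 0 *[of u 0] by (simp del: res_basis.simps)
    next
      case (Suc k)
      have "res_dif R (lin_ext R (?F n) (syz_elem R) u) = lin_ext R (?F k) (\<lambda>s. res_dif R (syz_elem R s)) u"
        by (rule lin_maps_lin_ext[OF M M L[of k, folded Suc] seF u(1)])
      also have "\<dots> = \<zero>\<^bsub>?F k\<^esub>" by (rule lin_ext_zero[OF M u(1)]) (use seS Suc in \<open>simp add: free_module_simps del: res_basis.simps\<close>)
      finally show ?thesis using v u Suc *[of u n] by (simp add: free_module_simps del: res_basis.simps)
    qed
  qed
qed

lemma a_kernel_alt: "a_kernel A B h = {x \<in> carrier A. h x = \<zero>\<^bsub>B\<^esub>}"
  by (simp add: a_kernel_def kernel_def)

theorem free_res_is_resolution:
  assumes "module R A"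
  shows "chain_complex R (free_res R A)"
    and "projective R (obj (free_res R A) i)"
    and "i < 0 \<Longrightarrow> zero_module (obj (free_res R A) i)"
    and "i > 0 \<Longrightarrow> boundaries (free_res R A) i = cycles (free_res R A) i"
    and "res_aug R A \<in> lin_maps R (obj (free_res R A) 0) A"
    and "res_aug R A ` carrier (obj (free_res R A) 0) = carrier A"
    and "boundaries (free_res R A) 0 = a_kernel (obj (free_res R A) 0) A (res_aug R A)"
proof -
  note cr = module_cring[OF assms]
  interpret R: cring R by (rule cr)
  let ?X = "free_res R A"
  let ?F = "\<lambda>n. free_module R (res_basis R A n)"
  show "projective R (obj ?X i)" by (simp add: free_res_def projective_free_module[OF cr])
  show "zero_module (obj ?X i)" if "i < 0"
    using that by (auto simp: free_res_def zero_module_def free_module_simps)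
  have B: "boundaries ?X (int n) = {u \<in> carrier (?F n).
                if n = 0 then res_aug R A u = \<zero>\<^bsub>A\<^esub> else res_dif R u = (\<lambda>s. \<zero>\<^bsub>R\<^esub>)}" for n
    using res_dif_lin_maps(2)[OF assms, of n]
    by (simp add: boundaries_def free_res_def nat_add_distrib del: res_basis.simps)
  show "boundaries ?X 0 = a_kernel (obj ?X 0) A (res_aug R A)"
    using B[of 0] by (simp add: a_kernel_alt free_res_def)
  show bc: "boundaries ?X i = cycles ?X i" if "i > 0" for i
    using B[of "nat i"] that by (simp add: a_kernel_alt cycles_def free_res_def free_module_simps)
  show "res_aug R A \<in> lin_maps R (obj ?X 0) A" "res_aug R A ` carrier (obj ?X 0) = carrier A"
    using res_dif_lin_maps(3,4)[OF assms] by (simp_all add: free_res_def)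
  have d: "dif ?X i \<in> lin_maps R (obj ?X i) (obj ?X (i - 1))" for i
  proof (cases "i \<le> 0")
    case True
    then show ?thesis by (auto simp: free_res_def lin_maps_def free_module_simps)
  next
    case False
    then have "i = int (Suc (nat (i - 1)))" by simp
    then obtain n where "i = int (Suc n)" by blast
    then show ?thesis using res_dif_lin_maps(1)[OF assms, of n] by (simp add: free_res_def nat_add_distrib del: res_basis.simps)
  qed
  show "chain_complex R ?X"
    unfolding chain_complex_def
  proof (intro conjI allI ballI)
    show "module R (obj ?X i)" for i by (simp add: free_res_def module_free_module[OF cr])
    show "dif ?X i \<in> lin_maps R (obj ?X i) (obj ?X (i - 1))" for i by (rule d)
    fix i x assume x: "x \<in> carrier (obj ?X i)"
    show "dif ?X (i - 1) (dif ?X i x) = \<zero>\<^bsub>obj ?X (i - 1 - 1)\<^esub>"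
    proof (cases "i > 1")
      case True
      have "dif ?X i x \<in> boundaries ?X (i - 1)" using x by (auto simp: boundaries_def)
      then show ?thesis using bc[of "i - 1"] True by (auto simp: cycles_def a_kernel_alt)
    qed (simp add: free_res_def free_module_simps)
  qed
qed


subsection \<open>Quotients, tensor products, homomorphism modules, homology\<close>

lemma quot_module_simps:
  "carrier (quot_module A H) = a_rcosets\<^bsub>A\<^esub> H"
  "\<zero>\<^bsub>quot_module A H\<^esub> = H"
  "S \<oplus>\<^bsub>quot_module A H\<^esub> T = S <+>\<^bsub>A\<^esub> T"
  "r \<odot>\<^bsub>quot_module A H\<^esub> T = (\<Union>x\<in>T. H +>\<^bsub>A\<^esub> (r \<odot>\<^bsub>A\<^esub> x))"
  by (simp_all add: quot_module_def)

lemma (in module) submodule_abelian_subgroup: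
  assumes "submodule H R M" shows "abelian_subgroup H M"
proof (rule abelian_subgroupI3)
  show "additive_subgroup H M"
    using assms by (simp add: additive_subgroup_def submodule_def)
  show "abelian_group M" ..
qed

lemma quot_module_rules:
  assumes "module R A" "submodule H R A"
  shows "x \<in> carrier A \<Longrightarrow> y \<in> carrier A \<Longrightarrow>
      (H +>\<^bsub>A\<^esub> x) \<oplus>\<^bsub>quot_module A H\<^esub> (H +>\<^bsub>A\<^esub> y) = H +>\<^bsub>A\<^esub> (x \<oplus>\<^bsub>A\<^esub> y)"
    and "r \<in> carrier R \<Longrightarrow> x \<in> carrier A \<Longrightarrow>
      r \<odot>\<^bsub>quot_module A H\<^esub> (H +>\<^bsub>A\<^esub> x) = H +>\<^bsub>A\<^esub> (r \<odot>\<^bsub>A\<^esub> x)"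
    and "x \<in> carrier A \<Longrightarrow> H +>\<^bsub>A\<^esub> x \<in> carrier (quot_module A H)"
    and "T \<in> carrier (quot_module A H) \<Longrightarrow> \<exists>x\<in>carrier A. T = H +>\<^bsub>A\<^esub> x"
    and "x \<in> carrier A \<Longrightarrow> y \<in> carrier A \<Longrightarrow> H +>\<^bsub>A\<^esub> x = H +>\<^bsub>A\<^esub> y \<longleftrightarrow> x \<ominus>\<^bsub>A\<^esub> y \<in> H"
proof -
  interpret module R A by fact
  interpret H: abelian_subgroup H A by (rule submodule_abelian_subgroup) fact
  show a: "x \<in> carrier A \<Longrightarrow> y \<in> carrier A \<Longrightarrow>
      (H +>\<^bsub>A\<^esub> x) \<oplus>\<^bsub>quot_module A H\<^esub> (H +>\<^bsub>A\<^esub> y) = H +>\<^bsub>A\<^esub> (x \<oplus>\<^bsub>A\<^esub> y)" for x y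
    by (simp add: quot_module_simps H.a_rcos_sum)
  show "x \<in> carrier A \<Longrightarrow> H +>\<^bsub>A\<^esub> x \<in> carrier (quot_module A H)"
    by (simp add: quot_module_simps M.a_rcosetsI H.a_subset)
  show "T \<in> carrier (quot_module A H) \<Longrightarrow> \<exists>x\<in>carrier A. T = H +>\<^bsub>A\<^esub> x"
    by (auto simp: quot_module_simps A_RCOSETS_def')
  show eq: "H +>\<^bsub>A\<^esub> x = H +>\<^bsub>A\<^esub> y \<longleftrightarrow> x \<ominus>\<^bsub>A\<^esub> y \<in> H" if "x \<in> carrier A" "y \<in> carrier A" for x y
  proof -
    have "H +>\<^bsub>A\<^esub> x = H +>\<^bsub>A\<^esub> y \<longleftrightarrow> x \<in> H +>\<^bsub>A\<^esub> y"
      using that(1) that(2) H.a_rcos_self[of x] H.a_repr_independence'[of x y] by metis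
    then show ?thesis using H.a_rcos_module[of y x] that by (simp add: a_minus_def)
  qed
  show "r \<odot>\<^bsub>quot_module A H\<^esub> (H +>\<^bsub>A\<^esub> x) = H +>\<^bsub>A\<^esub> (r \<odot>\<^bsub>A\<^esub> x)"
    if r: "r \<in> carrier R" and x: "x \<in> carrier A"
  proof -
    have "H +>\<^bsub>A\<^esub> (r \<odot>\<^bsub>A\<^esub> z) = H +>\<^bsub>A\<^esub> (r \<odot>\<^bsub>A\<^esub> x)" if z: "z \<in> H +>\<^bsub>A\<^esub> x" for z
    proof -
      obtain h where h: "h \<in> H" "z = h \<oplus>\<^bsub>A\<^esub> x" using z by (auto simp: a_r_coset_def')
      have hc: "h \<in> carrier A" using h by simp
      have "r \<odot>\<^bsub>A\<^esub> z \<ominus>\<^bsub>A\<^esub> r \<odot>\<^bsub>A\<^esub> x = r \<odot>\<^bsub>A\<^esub> h"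
        using h hc r x by (simp add: smult_r_distr a_minus_def M.a_assoc M.r_neg)
      also have "\<dots> \<in> H" using h r assms(2) submodule.smult_closed by fastforce
      finally show ?thesis using h hc r x by (subst eq) auto
    qed
    moreover have "x \<in> H +>\<^bsub>A\<^esub> x" by (rule H.a_rcos_self) fact
    ultimately show ?thesis unfolding quot_module_simps by (intro UN_constant_eq ballI)
  qed
qed

lemma module_quot_module:
  assumes "module R A" "submodule H R A"
  shows "module R (quot_module A H)"
proof -
  interpret module R A by fact
  interpret H: abelian_subgroup H A by (rule submodule_abelian_subgroup) fact
  note q = quot_module_rules[OF assms]
  have z: "\<zero>\<^bsub>quot_module A H\<^esub> = H +>\<^bsub>A\<^esub> \<zero>\<^bsub>A\<^esub>"
    by (simp add: quot_module_simps M.a_coset_add_zero[OF H.a_subset])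
  show ?thesis
  proof (rule moduleI)
    show "cring R" ..
    show "abelian_group (quot_module A H)"
    proof (rule abelian_groupI)
      fix S assume "S \<in> carrier (quot_module A H)"
      then obtain x where x: "x \<in> carrier A" "S = H +>\<^bsub>A\<^esub> x" using q(4) by blast
      then show "\<exists>T\<in>carrier (quot_module A H). T \<oplus>\<^bsub>quot_module A H\<^esub> S = \<zero>\<^bsub>quot_module A H\<^esub>"
        by (intro bexI[of _ "H +>\<^bsub>A\<^esub> (\<ominus>\<^bsub>A\<^esub> x)"]) (auto simp: q(1,3) z M.l_neg)
      show "\<zero>\<^bsub>quot_module A H\<^esub> \<oplus>\<^bsub>quot_module A H\<^esub> S = S"
        using x by (simp add: z q(1))
    next
      show "\<zero>\<^bsub>quot_module A H\<^esub> \<in> carrier (quot_module A H)" by (simp add: z q(3))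
    qed (auto dest!: q(4) simp: q(1,3) M.a_ac)
  qed (auto dest!: q(4) simp: q(1-3) smult_l_distr smult_r_distr smult_assoc1)
qed

lemma span_submodule_props:
  assumes "module R A" "G \<subseteq> carrier A"
  shows "submodule (span_submodule R A G) R A" "G \<subseteq> span_submodule R A G"
    "submodule H R A \<Longrightarrow> G \<subseteq> H \<Longrightarrow> span_submodule R A G \<subseteq> H"
proof -
  interpret module R A by fact
  show "G \<subseteq> span_submodule R A G"  "submodule H R A \<Longrightarrow> G \<subseteq> H \<Longrightarrow> span_submodule R A G \<subseteq> H"
    by (auto simp: span_submodule_def)
  note c = carrier_is_submodule
  have z: "\<zero>\<^bsub>A\<^esub> \<in> H" if "submodule H R A" for H
    using submodule_abelian_subgroup[OF that] by (simp add: abelian_subgroup_def additive_subgroup.zero_closed)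
  note add = submoduleE(5) and sm = submoduleE(4) and ai = submoduleE(3)
  show "submodule (span_submodule R A G) R A"
    by (rule submoduleI) (use c assms(2) in \<open>auto simp: span_submodule_def z intro: add sm ai\<close>)
qed

definition bilinear_map :: "'r ring \<Rightarrow> ('r,'a) module \<Rightarrow> ('r,'b) module \<Rightarrow> ('r,'c) module \<Rightarrow> ('a \<Rightarrow> 'b \<Rightarrow> 'c) \<Rightarrow> bool" where
  "bilinear_map R A B C g \<longleftrightarrow> (\<forall>x\<in>carrier A. (\<lambda>y. g x y) \<in> lin_maps R B C) \<and> (\<forall>y\<in>carrier B. (\<lambda>x. g x y) \<in> lin_maps R A C)"

lemma lin_maps_const_zero:
  assumes "module R B" shows "(\<lambda>_. \<zero>\<^bsub>B\<^esub>) \<in> lin_maps R A B"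
proof -
  interpret module R B by fact
  show ?thesis by (auto simp: lin_maps_def)
qed

lemma lin_maps_comp:
  "f \<in> lin_maps R A B \<Longrightarrow> g \<in> lin_maps R B C \<Longrightarrow> (\<lambda>x. g (f x)) \<in> lin_maps R A C"
  by (auto simp: lin_maps_def Pi_iff)

lemma tensor_submodule:
  assumes "module R A" "module R B"
  shows "submodule (tensor_relations R A B) R (free_module R (carrier A \<times> carrier B))" (is ?s)
    "bilinear_relations R A B \<subseteq> tensor_relations R A B"
    "bilinear_relations R A B \<subseteq> carrier (free_module R (carrier A \<times> carrier B))"
proof -
  interpret A: module R A by fact
  interpret B: module R B by fact
  interpret F: module R "free_module R (carrier A \<times> carrier B)" by (rule module_free_module) (rule module_cring[OF assms(1)])
  have e: "basis_vec R (x, y) \<in> carrier (free_module R (carrier A \<times> carrier B))" if "x \<in> carrier A" "y \<in> carrier B" for x y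
    by (rule basis_vec_carrier) (use that module_cring[OF assms(1)] in auto)
  show s: "bilinear_relations R A B \<subseteq> carrier (free_module R (carrier A \<times> carrier B))"
    unfolding bilinear_relations_def Let_def
    by (safe; intro F.M.minus_closed F.M.a_closed F.smult_closed e; simp)
  show ?s "bilinear_relations R A B \<subseteq> tensor_relations R A B"
    unfolding tensor_relations_def by (rule span_submodule_props[OF F.module_axioms s])+
qed

lemma module_tensor:
  assumes "module R A" "module R B" shows "module R (tensor R A B)"
  unfolding tensor_def
  by (rule module_quot_module[OF module_free_module tensor_submodule(1)]) (use assms module_cring in auto)

lemma lin_maps_minus:
  assumes "module R A" "module R B" "f \<in> lin_maps R A B" "x \<in> carrier A" "y \<in> carrier A"
  shows "f (x \<ominus>\<^bsub>A\<^esub> y) = f x \<ominus>\<^bsub>B\<^esub> f y"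
proof -
  interpret A: module R A by fact
  interpret B: module R B by fact
  have "f (x \<ominus>\<^bsub>A\<^esub> y) \<oplus>\<^bsub>B\<^esub> f y = f x"
    using lin_mapsD(2)[OF assms(3), of "x \<ominus>\<^bsub>A\<^esub> y" y] assms(4,5)
    by (simp add: A.M.minus_closed a_minus_def A.M.a_assoc A.M.l_neg)
  then show ?thesis
    using lin_mapsD(1)[OF assms(3)] assms(4,5)
    by (metis A.M.minus_closed B.M.add.inv_solve_right' B.M.minus_eq)
qed

lemma submodule_kernel:
  assumes "module R A" "module R B" "f \<in> lin_maps R A B"
  shows "submodule {x \<in> carrier A. f x = \<zero>\<^bsub>B\<^esub>} R A"
proof -
  interpret A: module R A by fact
  interpret B: module R B by fact
  note z = lin_maps_zero[OF assms]
  have "f (\<ominus>\<^bsub>A\<^esub> x) = \<ominus>\<^bsub>B\<^esub> f x" if "x \<in> carrier A" for x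
    using lin_maps_minus[OF assms, of "\<zero>\<^bsub>A\<^esub>" x] that lin_mapsD(1)[OF assms(3) that] by (simp add: z a_minus_def)
  then show ?thesis
    by (intro A.submoduleI) (use lin_mapsD[OF assms(3)] z in auto)
qed

lemma tensor_lift:
  assumes A: "module R A" and B: "module R B" and C: "module R C" and g: "bilinear_map R A B C g"
  shows "tensor_lift R C g \<in> lin_maps R (tensor R A B) C"
    and "x \<in> carrier A \<Longrightarrow> y \<in> carrier B \<Longrightarrow> tensor_lift R C g (pure_tensor R A B x y) = g x y"
proof -
  let ?F = "free_module R (carrier A \<times> carrier B)" and ?H = "tensor_relations R A B"
  let ?g = "\<lambda>(x, y). g x y"
  interpret A: module R A by fact
  interpret B: module R B by fact
  interpret C: module R C by fact
  note cr = module_cring[OF A]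
  have F: "module R ?F" by (rule module_free_module[OF cr])
  interpret F: module R ?F by (rule F)
  have gc: "?g \<in> carrier A \<times> carrier B \<rightarrow> carrier C"
    using g lin_mapsD(1) unfolding bilinear_map_def by fastforce
  have l: "lin_ext R C ?g \<in> lin_maps R ?F C" by (rule lin_ext_lin_maps[OF C gc])
  have e: "basis_vec R (x, y) \<in> carrier ?F" if "x \<in> carrier A" "y \<in> carrier B" for x y
    by (rule basis_vec_carrier) (use that cr in auto)
  have gx: "g x y \<in> carrier C" if "x \<in> carrier A" "y \<in> carrier B" for x y
    using funcset_mem[OF gc, of "(x, y)"] that by simp
  have le: "lin_ext R C ?g (basis_vec R (x, y)) = g x y" if "x \<in> carrier A" "y \<in> carrier B" for x y
    by (subst lin_ext_basis_vec[OF C]) (use gx[OF that] in auto)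
  have b1: "g x (y \<oplus>\<^bsub>B\<^esub> y') = g x y \<oplus>\<^bsub>C\<^esub> g x y'" if "x \<in> carrier A" "y \<in> carrier B" "y' \<in> carrier B" for x y y'
    using g that by (auto simp: bilinear_map_def lin_maps_def)
  have b2: "g (x \<oplus>\<^bsub>A\<^esub> x') y = g x y \<oplus>\<^bsub>C\<^esub> g x' y" if "x \<in> carrier A" "x' \<in> carrier A" "y \<in> carrier B" for x y x'
    using g that by (auto simp: bilinear_map_def lin_maps_def)
  have b3: "g x (r \<odot>\<^bsub>B\<^esub> y) = r \<odot>\<^bsub>C\<^esub> g x y" if "x \<in> carrier A" "y \<in> carrier B" "r \<in> carrier R" for x y r
    using g that by (auto simp: bilinear_map_def lin_maps_def)
  have b4: "g (r \<odot>\<^bsub>A\<^esub> x) y = r \<odot>\<^bsub>C\<^esub> g x y" if "x \<in> carrier A" "y \<in> carrier B" "r \<in> carrier R" for x y r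
    using g that by (auto simp: bilinear_map_def lin_maps_def)
  have cc: "c \<ominus>\<^bsub>C\<^esub> c = \<zero>\<^bsub>C\<^esub>" if "c \<in> carrier C" for c
    using that by (simp add: a_minus_def C.M.r_neg)
  have "bilinear_relations R A B \<subseteq> {u \<in> carrier ?F. lin_ext R C ?g u = \<zero>\<^bsub>C\<^esub>}"
  proof -
    have "lin_ext R C ?g u = \<zero>\<^bsub>C\<^esub>" if "u \<in> bilinear_relations R A B" for u
      using that unfolding bilinear_relations_def Let_def
      by (auto simp: lin_maps_minus[OF F C l] lin_mapsD[OF l] e le b1 b2 b3 b4 gx cc
          simp del: F.M.minus_eq C.M.minus_eq)
    then show ?thesis using tensor_submodule(3)[OF A B] by blast
  qed
  then have K: "?H \<subseteq> {u \<in> carrier ?F. lin_ext R C ?g u = \<zero>\<^bsub>C\<^esub>}"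
    unfolding tensor_relations_def
    by (intro span_submodule_props(3)[OF F tensor_submodule(3)[OF A B]] submodule_kernel[OF F C l])
  have val: "tensor_lift R C g (?H +>\<^bsub>?F\<^esub> u) = lin_ext R C ?g u" if u: "u \<in> carrier ?F" for u
  proof -
    have "lin_ext R C ?g ` (?H +>\<^bsub>?F\<^esub> u) = {lin_ext R C ?g u}"
    proof -
      have "lin_ext R C ?g v = lin_ext R C ?g u" if "v \<in> ?H +>\<^bsub>?F\<^esub> u" for v
        using that K u lin_mapsD(1)[OF l u] by (auto simp: a_r_coset_def' lin_mapsD(2)[OF l] subset_iff)
      moreover have "u \<in> ?H +>\<^bsub>?F\<^esub> u"
        by (rule abelian_subgroup.a_rcos_self[OF F.submodule_abelian_subgroup[OF tensor_submodule(1)[OF A B]] u])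
      ultimately show ?thesis by blast
    qed
    then show ?thesis by (simp add: tensor_lift_def)
  qed
  note q = quot_module_rules[OF F tensor_submodule(1)[OF A B]]
  show "tensor_lift R C g \<in> lin_maps R (tensor R A B) C"
    unfolding lin_maps_def tensor_def
    by (auto dest!: q(4) simp: q(1,2) val lin_mapsD[OF l])
  show "x \<in> carrier A \<Longrightarrow> y \<in> carrier B \<Longrightarrow> tensor_lift R C g (pure_tensor R A B x y) = g x y"
    by (simp add: pure_tensor_def val e le)
qed

lemma lin_maps_tensor_eqI:
  assumes A: "module R A" and B: "module R B" and C: "module R C"
    and f: "f \<in> lin_maps R (tensor R A B) C" "f' \<in> lin_maps R (tensor R A B) C"
    and eq: "\<And>x y. x \<in> carrier A \<Longrightarrow> y \<in> carrier B \<Longrightarrow> f (pure_tensor R A B x y) = f' (pure_tensor R A B x y)"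
    and t: "t \<in> carrier (tensor R A B)"
  shows "f t = f' t"
proof -
  let ?F = "free_module R (carrier A \<times> carrier B)" and ?H = "tensor_relations R A B"
  note cr = module_cring[OF A]
  have F: "module R ?F" by (rule module_free_module[OF cr])
  note q = quot_module_rules[OF F tensor_submodule(1)[OF A B], folded tensor_def]
  interpret C: module R C by fact
  obtain u where u: "u \<in> carrier ?F" "t = ?H +>\<^bsub>?F\<^esub> u" using q(4)[OF t] by blast
  have l: "(\<lambda>u. h (?H +>\<^bsub>?F\<^esub> u)) \<in> lin_maps R ?F C" if "h \<in> lin_maps R (tensor R A B) C" for h
    unfolding lin_maps_def
    using lin_mapsD[OF that] by (auto simp: q(1)[symmetric] q(2)[symmetric] q(3))
  have "(\<lambda>u. h (?H +>\<^bsub>?F\<^esub> u)) u = lin_ext R C (\<lambda>s. h (?H +>\<^bsub>?F\<^esub> basis_vec R s)) u" if "h \<in> lin_maps R (tensor R A B) C" for h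
    by (rule lin_maps_free_cong[OF C l[OF that] u(1)])
  moreover have "lin_ext R C (\<lambda>s. f (?H +>\<^bsub>?F\<^esub> basis_vec R s)) u = lin_ext R C (\<lambda>s. f' (?H +>\<^bsub>?F\<^esub> basis_vec R s)) u"
    unfolding lin_ext_def
  proof (rule C.M.finsum_cong')
    show "(\<lambda>s. u s \<odot>\<^bsub>C\<^esub> f' (?H +>\<^bsub>?F\<^esub> basis_vec R s)) \<in> {s. u s \<noteq> \<zero>\<^bsub>R\<^esub>} \<rightarrow> carrier C"
      using u(1) lin_mapsD(1)[OF f(2) q(3)[OF basis_vec_carrier[OF cr]]]
      by (intro funcsetI C.smult_closed) (auto simp: free_module_simps)
  next
    fix s assume "s \<in> {s. u s \<noteq> \<zero>\<^bsub>R\<^esub>}"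
    then have "s \<in> carrier A \<times> carrier B" using u(1) by (auto simp: free_module_simps)
    then show "u s \<odot>\<^bsub>C\<^esub> f (?H +>\<^bsub>?F\<^esub> basis_vec R s) = u s \<odot>\<^bsub>C\<^esub> f' (?H +>\<^bsub>?F\<^esub> basis_vec R s)"
      using eq unfolding pure_tensor_def by auto
  qed simp
  ultimately show ?thesis using f u by simp
qed

lemma pure_tensor_bilinear:
  assumes A: "module R A" and B: "module R B"
  shows "bilinear_map R A B (tensor R A B) (pure_tensor R A B)"
proof -
  let ?F = "free_module R (carrier A \<times> carrier B)" and ?H = "tensor_relations R A B"
  interpret A: module R A by fact
  interpret B: module R B by fact
  note cr = module_cring[OF A]
  have F: "module R ?F" by (rule module_free_module[OF cr])
  interpret F: module R ?F by (rule F)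
  note q = quot_module_rules[OF F tensor_submodule(1)[OF A B], folded tensor_def]
  have e: "basis_vec R (x, y) \<in> carrier ?F" if "x \<in> carrier A" "y \<in> carrier B" for x y
    by (rule basis_vec_carrier) (use that cr in auto)
  have rel: "u \<in> ?H" if "u \<in> bilinear_relations R A B" for u
    using tensor_submodule(2)[OF A B] that by blast
  have 1: "pure_tensor R A B x y \<in> carrier (tensor R A B)" if "x \<in> carrier A" "y \<in> carrier B" for x y
    unfolding pure_tensor_def using q(3)[OF e[OF that]] .
  have 2: "pure_tensor R A B (x \<oplus>\<^bsub>A\<^esub> x') y = pure_tensor R A B x y \<oplus>\<^bsub>tensor R A B\<^esub> pure_tensor R A B x' y"
    if "x \<in> carrier A" "x' \<in> carrier A" "y \<in> carrier B" for x x' y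
    unfolding pure_tensor_def using that e
    by (simp add: q(1) q(5)) (rule rel, unfold bilinear_relations_def Let_def, blast)
  have 3: "pure_tensor R A B x (y \<oplus>\<^bsub>B\<^esub> y') = pure_tensor R A B x y \<oplus>\<^bsub>tensor R A B\<^esub> pure_tensor R A B x y'"
    if "x \<in> carrier A" "y' \<in> carrier B" "y \<in> carrier B" for x y' y
    unfolding pure_tensor_def using that e
    by (simp add: q(1) q(5)) (rule rel, unfold bilinear_relations_def Let_def, blast)
  have 4: "pure_tensor R A B (r \<odot>\<^bsub>A\<^esub> x) y = r \<odot>\<^bsub>tensor R A B\<^esub> pure_tensor R A B x y"
    if "x \<in> carrier A" "y \<in> carrier B" "r \<in> carrier R" for x r y
    unfolding pure_tensor_def using that e
    by (simp add: q(2) q(5)) (rule rel, unfold bilinear_relations_def Let_def, blast)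
  have 5: "pure_tensor R A B x (r \<odot>\<^bsub>B\<^esub> y) = r \<odot>\<^bsub>tensor R A B\<^esub> pure_tensor R A B x y"
    if "x \<in> carrier A" "y \<in> carrier B" "r \<in> carrier R" for x r y
    unfolding pure_tensor_def using that e
    by (simp add: q(2) q(5)) (rule rel, unfold bilinear_relations_def Let_def, blast)
  show ?thesis using 1 2 3 4 5 by (auto simp: bilinear_map_def lin_maps_def)
qed

lemma tensor_map:
  assumes A: "module R A" and A': "module R A'" and B: "module R B" and f: "f \<in> lin_maps R A A'"
  shows "tensor_lift R (tensor R A' B) (\<lambda>x y. pure_tensor R A' B (f x) y) \<in> lin_maps R (tensor R A B) (tensor R A' B)"
   and "x \<in> carrier A \<Longrightarrow> y \<in> carrier B \<Longrightarrow>
      tensor_lift R (tensor R A' B) (\<lambda>x y. pure_tensor R A' B (f x) y) (pure_tensor R A B x y) = pure_tensor R A' B (f x) y"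
proof -
  have "bilinear_map R A B (tensor R A' B) (\<lambda>x y. pure_tensor R A' B (f x) y)"
    using pure_tensor_bilinear[OF A' B] lin_mapsD[OF f] unfolding bilinear_map_def by (fastforce simp: lin_maps_def)
  note t = tensor_lift[OF A B module_tensor[OF A' B] this]
  show "tensor_lift R (tensor R A' B) (\<lambda>x y. pure_tensor R A' B (f x) y) \<in> lin_maps R (tensor R A B) (tensor R A' B)"
    by (rule t)
  show "x \<in> carrier A \<Longrightarrow> y \<in> carrier B \<Longrightarrow>
      tensor_lift R (tensor R A' B) (\<lambda>x y. pure_tensor R A' B (f x) y) (pure_tensor R A B x y) = pure_tensor R A' B (f x) y"
    by (rule t)
qed

theorem chain_complex_tensor:
  assumes X: "chain_complex R C" and B: "module R B"
  shows "chain_complex R (tensor_cplx R C B)"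
proof -
  have m: "module R (obj C i)" for i using X by (simp add: chain_complex_def)
  have d: "dif C i \<in> lin_maps R (obj C i) (obj C (i - 1))" for i using X by (simp add: chain_complex_def)
  have dd: "dif C (i - 1) (dif C i x) = \<zero>\<^bsub>obj C (i - 1 - 1)\<^esub>" if "x \<in> carrier (obj C i)" for i x
    using X that by (simp add: chain_complex_def)
  let ?T = "tensor_cplx R C B"
  have M: "module R (obj ?T i)" for i by (simp add: tensor_cplx_def module_tensor[OF m B])
  have D: "dif ?T i \<in> lin_maps R (obj ?T i) (obj ?T (i - 1))" for i
    using tensor_map(1)[OF m m B d] by (simp add: tensor_cplx_def)
  have P: "dif ?T i (pure_tensor R (obj C i) B x y) = pure_tensor R (obj C (i - 1)) B (dif C i x) y"
    if "x \<in> carrier (obj C i)" "y \<in> carrier B" for i x y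
    using tensor_map(2)[OF m m B d that] by (simp add: tensor_cplx_def)
  have "dif ?T (i - 1) (dif ?T i t) = \<zero>\<^bsub>obj ?T (i - 1 - 1)\<^esub>" if t: "t \<in> carrier (obj ?T i)" for i t
  proof -
    have "(\<lambda>t. dif ?T (i - 1) (dif ?T i t)) t = (\<lambda>_. \<zero>\<^bsub>obj ?T (i - 1 - 1)\<^esub>) t"
    proof (rule lin_maps_tensor_eqI[OF m[of i] B M,
          where f = "\<lambda>t. dif ?T (i - 1) (dif ?T i t)" and f' = "\<lambda>_. \<zero>\<^bsub>obj ?T (i - 1 - 1)\<^esub>"])
      show "(\<lambda>t. dif ?T (i - 1) (dif ?T i t)) \<in> lin_maps R (tensor R (obj C i) B) (obj ?T (i - 1 - 1))"
        using lin_maps_comp[OF D[of i] D[of "i - 1"]] by (simp add: tensor_cplx_def)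
      show "(\<lambda>_. \<zero>\<^bsub>obj ?T (i - 1 - 1)\<^esub>) \<in> lin_maps R (tensor R (obj C i) B) (obj ?T (i - 1 - 1))"
        by (rule lin_maps_const_zero[OF M])
      fix x y assume xy: "x \<in> carrier (obj C i)" "y \<in> carrier B"
      have "dif ?T (i - 1) (dif ?T i (pure_tensor R (obj C i) B x y)) = pure_tensor R (obj C (i - 1 - 1)) B \<zero>\<^bsub>obj C (i - 1 - 1)\<^esub> y"
        using xy P[OF xy] P[OF lin_mapsD(1)[OF d xy(1)] xy(2)] dd by simp
      also have "\<dots> = \<zero>\<^bsub>obj ?T (i - 1 - 1)\<^esub>"
        using lin_maps_zero[OF m module_tensor[OF m B], of "\<lambda>x. pure_tensor R (obj C (i - 1 - 1)) B x y"]
          pure_tensor_bilinear[OF m B] xy by (auto simp: bilinear_map_def tensor_cplx_def)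
      finally show "dif ?T (i - 1) (dif ?T i (pure_tensor R (obj C i) B x y)) = \<zero>\<^bsub>obj ?T (i - 1 - 1)\<^esub>" .
    qed (use t in \<open>simp add: tensor_cplx_def\<close>)
    then show ?thesis by simp
  qed
  then show ?thesis using M D by (simp add: chain_complex_def)
qed

lemma hom_module_simps:
  "f \<in> carrier (hom_module R A B) \<longleftrightarrow> f \<in> lin_maps R A B \<and> f \<in> extensional (carrier A)"
  "\<zero>\<^bsub>hom_module R A B\<^esub> = (\<lambda>x\<in>carrier A. \<zero>\<^bsub>B\<^esub>)"
  "f \<oplus>\<^bsub>hom_module R A B\<^esub> g = (\<lambda>x\<in>carrier A. f x \<oplus>\<^bsub>B\<^esub> g x)"
  "r \<odot>\<^bsub>hom_module R A B\<^esub> f = (\<lambda>x\<in>carrier A. r \<odot>\<^bsub>B\<^esub> f x)"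
  by (simp_all add: hom_module_def)

lemma module_hom_module:
  assumes A: "module R A" and B: "module R B"
  shows "module R (hom_module R A B)"
proof -
  interpret A: module R A by fact
  interpret B: module R B by fact
  let ?H = "hom_module R A B"
  have val: "f x \<in> carrier B" if "f \<in> carrier ?H" "x \<in> carrier A" for f x
    using lin_mapsD(1)[of f R A B x] that by (simp add: hom_module_simps)
  have lin: "f (x \<oplus>\<^bsub>A\<^esub> y) = f x \<oplus>\<^bsub>B\<^esub> f y" if "f \<in> carrier ?H" "x \<in> carrier A" "y \<in> carrier A" for f x y
    using that by (auto simp: hom_module_simps lin_maps_def)
  have sca: "f (s \<odot>\<^bsub>A\<^esub> x) = s \<odot>\<^bsub>B\<^esub> f x" if "f \<in> carrier ?H" "s \<in> carrier R" "x \<in> carrier A" for f s x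
    using that by (auto simp: hom_module_simps lin_maps_def)
  have memI: "(\<lambda>x\<in>carrier A. h x) \<in> carrier ?H"
    if "\<And>x. x \<in> carrier A \<Longrightarrow> h x \<in> carrier B"
      "\<And>x y. x \<in> carrier A \<Longrightarrow> y \<in> carrier A \<Longrightarrow> h (x \<oplus>\<^bsub>A\<^esub> y) = h x \<oplus>\<^bsub>B\<^esub> h y"
      "\<And>s x. s \<in> carrier R \<Longrightarrow> x \<in> carrier A \<Longrightarrow> h (s \<odot>\<^bsub>A\<^esub> x) = s \<odot>\<^bsub>B\<^esub> h x" for h
    using that by (simp add: hom_module_simps lin_maps_def)
  have add: "f \<oplus>\<^bsub>?H\<^esub> g \<in> carrier ?H" if f: "f \<in> carrier ?H" and g: "g \<in> carrier ?H" for f g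
    unfolding hom_module_simps(3)
    by (rule memI) (simp_all add: lin[OF f] lin[OF g] sca[OF f] sca[OF g] val[OF f] val[OF g] B.M.a_ac B.smult_r_distr)
  have zero: "\<zero>\<^bsub>?H\<^esub> \<in> carrier ?H"
    unfolding hom_module_simps(2) by (rule memI) simp_all
  have smult: "r \<odot>\<^bsub>?H\<^esub> f \<in> carrier ?H" if r: "r \<in> carrier R" and f: "f \<in> carrier ?H" for f r
  proof -
    have comm: "r \<odot>\<^bsub>B\<^esub> (s \<odot>\<^bsub>B\<^esub> y) = s \<odot>\<^bsub>B\<^esub> (r \<odot>\<^bsub>B\<^esub> y)" if "s \<in> carrier R" "y \<in> carrier B" for s y
      using B.smult_assoc1[OF r that] B.smult_assoc1[OF that(1) r that(2)] A.R.m_comm[OF r that(1)] by metis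
    show ?thesis
      unfolding hom_module_simps(4)
      by (rule memI) (simp_all add: lin[OF f] sca[OF f] val[OF f] r B.smult_r_distr comm[OF _ val[OF f]])
  qed
  have eqI: "f = g" if "f \<in> carrier ?H" "g \<in> carrier ?H" "\<And>x. x \<in> carrier A \<Longrightarrow> f x = g x" for f g
    by (rule extensionalityI[of _ "carrier A"]) (use that in \<open>auto simp: hom_module_simps\<close>)
  have ap: "x \<in> carrier A \<Longrightarrow> \<zero>\<^bsub>?H\<^esub> x = \<zero>\<^bsub>B\<^esub>" "x \<in> carrier A \<Longrightarrow> (f \<oplus>\<^bsub>?H\<^esub> g) x = f x \<oplus>\<^bsub>B\<^esub> g x"
    "x \<in> carrier A \<Longrightarrow> (r \<odot>\<^bsub>?H\<^esub> f) x = r \<odot>\<^bsub>B\<^esub> f x" for f g r x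
    by (simp_all add: hom_module_simps)
  show ?thesis
  proof (rule moduleI)
    show "cring R" by (rule module_cring[OF A])
    show "abelian_group ?H"
    proof (rule abelian_groupI)
      fix f assume f: "f \<in> carrier ?H"
      show "\<exists>g\<in>carrier ?H. g \<oplus>\<^bsub>?H\<^esub> f = \<zero>\<^bsub>?H\<^esub>"
      proof (rule bexI[of _ "(\<ominus>\<^bsub>R\<^esub> \<one>\<^bsub>R\<^esub>) \<odot>\<^bsub>?H\<^esub> f"])
        show n: "(\<ominus>\<^bsub>R\<^esub> \<one>\<^bsub>R\<^esub>) \<odot>\<^bsub>?H\<^esub> f \<in> carrier ?H" by (rule smult[OF _ f]) simp
        show "(\<ominus>\<^bsub>R\<^esub> \<one>\<^bsub>R\<^esub>) \<odot>\<^bsub>?H\<^esub> f \<oplus>\<^bsub>?H\<^esub> f = \<zero>\<^bsub>?H\<^esub>"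
          by (rule eqI[OF add[OF n f] zero]) (simp add: ap B.smult_l_minus B.M.l_neg val[OF f])
      qed
      show "\<zero>\<^bsub>?H\<^esub> \<oplus>\<^bsub>?H\<^esub> f = f" by (rule eqI[OF add[OF zero f] f]) (simp add: ap val[OF f])
      fix g assume g: "g \<in> carrier ?H"
      show "f \<oplus>\<^bsub>?H\<^esub> g \<in> carrier ?H" by (rule add[OF f g])
      show "f \<oplus>\<^bsub>?H\<^esub> g = g \<oplus>\<^bsub>?H\<^esub> f"
        by (rule eqI[OF add[OF f g] add[OF g f]]) (simp add: ap val[OF f] val[OF g] B.M.a_comm)
      fix h assume h: "h \<in> carrier ?H"
      show "f \<oplus>\<^bsub>?H\<^esub> g \<oplus>\<^bsub>?H\<^esub> h = f \<oplus>\<^bsub>?H\<^esub> (g \<oplus>\<^bsub>?H\<^esub> h)"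
        by (rule eqI[OF add[OF add[OF f g] h] add[OF f add[OF g h]]])
           (simp add: ap val[OF f] val[OF g] val[OF h] B.M.a_assoc)
    qed (rule zero)
  next
    fix a f assume af: "a \<in> carrier R" "f \<in> carrier ?H"
    show "a \<odot>\<^bsub>?H\<^esub> f \<in> carrier ?H" by (rule smult[OF af])
    fix b assume b: "b \<in> carrier R"
    show "(a \<oplus>\<^bsub>R\<^esub> b) \<odot>\<^bsub>?H\<^esub> f = a \<odot>\<^bsub>?H\<^esub> f \<oplus>\<^bsub>?H\<^esub> b \<odot>\<^bsub>?H\<^esub> f"
      by (rule eqI[OF smult[OF _ af(2)] add[OF smult[OF af] smult[OF b af(2)]]])
         (simp_all add: af b ap val[OF af(2)] B.smult_l_distr)
    show "(a \<otimes>\<^bsub>R\<^esub> b) \<odot>\<^bsub>?H\<^esub> f = a \<odot>\<^bsub>?H\<^esub> (b \<odot>\<^bsub>?H\<^esub> f)"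
      by (rule eqI[OF smult[OF _ af(2)] smult[OF af(1) smult[OF b af(2)]]])
         (simp_all add: af b ap val[OF af(2)] B.smult_assoc1)
  next
    fix a f g assume af: "a \<in> carrier R" "f \<in> carrier ?H" and g: "g \<in> carrier ?H"
    show "a \<odot>\<^bsub>?H\<^esub> (f \<oplus>\<^bsub>?H\<^esub> g) = a \<odot>\<^bsub>?H\<^esub> f \<oplus>\<^bsub>?H\<^esub> a \<odot>\<^bsub>?H\<^esub> g"
      by (rule eqI[OF smult[OF af(1) add[OF af(2) g]] add[OF smult[OF af] smult[OF af(1) g]]])
         (simp add: af ap val[OF af(2)] val[OF g] B.smult_r_distr)
  next
    fix f assume f: "f \<in> carrier ?H"
    show "\<one>\<^bsub>R\<^esub> \<odot>\<^bsub>?H\<^esub> f = f" by (rule eqI[OF smult[OF _ f] f]) (simp_all add: ap val[OF f])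
  qed
qed

theorem chain_complex_hom:
  assumes X: "chain_complex R C" and B: "module R B"
  shows "chain_complex R (hom_cplx R C B)"
proof -
  have m: "module R (obj C i)" for i using X by (simp add: chain_complex_def)
  have d: "dif C i \<in> lin_maps R (obj C i) (obj C (i - 1))" for i using X by (simp add: chain_complex_def)
  have dd: "dif C (i - 1) (dif C i x) = \<zero>\<^bsub>obj C (i - 1 - 1)\<^esub>" if "x \<in> carrier (obj C i)" for i x
    using X that by (simp add: chain_complex_def)
  interpret B: module R B by fact
  have D: "dif (hom_cplx R C B) j \<in> lin_maps R (obj (hom_cplx R C B) j) (obj (hom_cplx R C B) (j - 1))" for j
  proof -
    interpret module R "obj C (1 - j)" by (rule m)
    show ?thesis
    using lin_mapsD[OF d[of "1 - j"]]
    by (auto simp: hom_cplx_def hom_module_def lin_maps_def fun_eq_iff restrict_def extensional_def)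
  qed
  have "dif (hom_cplx R C B) (j - 1) (dif (hom_cplx R C B) j f) = \<zero>\<^bsub>obj (hom_cplx R C B) (j - 1 - 1)\<^esub>"
    if f: "f \<in> carrier (obj (hom_cplx R C B) j)" for j f
  proof -
    have "f \<zero>\<^bsub>obj C (- j)\<^esub> = \<zero>\<^bsub>B\<^esub>" using f lin_maps_zero[OF m B, of f "- j"] by (simp add: hom_cplx_def hom_module_def)
    then show ?thesis
      using dd[of _ "2 - j"] lin_mapsD(1)[OF d[of "2 - j"]]
      by (auto simp: hom_cplx_def hom_module_def fun_eq_iff)
  qed
  then show ?thesis using D by (auto simp: chain_complex_def hom_cplx_def module_hom_module[OF m B])
qed

theorem module_homology:
  assumes "chain_complex R C"
  shows "module R (homology C i)"
proof -
  have m: "module R (obj C j)" for j using assms by (simp add: chain_complex_def)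
  have d: "dif C j \<in> lin_maps R (obj C j) (obj C (j - 1))" for j using assms by (simp add: chain_complex_def)
  have Z: "cycles C i = {x \<in> carrier (obj C i). dif C i x = \<zero>\<^bsub>obj C (i - 1)\<^esub>}"
    by (simp add: cycles_def a_kernel_alt)
  let ?K = "(obj C i)\<lparr>carrier := cycles C i\<rparr>"
  have K: "module R ?K"
    by (rule submodule.submodule_is_module[OF _ m]) (unfold Z, rule submodule_kernel[OF m m d])
  interpret K: module R ?K by (rule K)
  interpret O: module R "obj C (i + 1)" by (rule m)
  have d': "dif C (i + 1) \<in> lin_maps R (obj C (i + 1)) (obj C i)" using d[of "i + 1"] by simp
  have sub: "boundaries C i \<subseteq> carrier ?K"
    using assms lin_mapsD(1)[OF d'] unfolding chain_complex_def boundaries_def Z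
    by (auto dest: spec[of _ "i + 1"])
  have smult: "r \<odot>\<^bsub>?K\<^esub> x \<in> boundaries C i" if "r \<in> carrier R" "x \<in> boundaries C i" for r x
    using that lin_mapsD(3)[OF d', symmetric] by (auto simp: boundaries_def)
  have "submodule (boundaries C i) R ?K"
  proof (rule K.submoduleI[OF sub])
    show "\<zero>\<^bsub>?K\<^esub> \<in> boundaries C i"
      using lin_maps_zero[OF m m d'] by (auto simp: boundaries_def intro!: image_eqI[of _ _ "\<zero>\<^bsub>obj C (i + 1)\<^esub>"])
    show "x \<oplus>\<^bsub>?K\<^esub> y \<in> boundaries C i" if "x \<in> boundaries C i" "y \<in> boundaries C i" for x y
      using that lin_mapsD(2)[OF d', symmetric] by (auto simp: boundaries_def)
    show "\<ominus>\<^bsub>?K\<^esub> x \<in> boundaries C i" if x: "x \<in> boundaries C i" for x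
    proof -
      have "x \<in> carrier ?K" using sub x by blast
      then have "\<ominus>\<^bsub>?K\<^esub> x = (\<ominus>\<^bsub>R\<^esub> \<one>\<^bsub>R\<^esub>) \<odot>\<^bsub>?K\<^esub> x"
        using K.smult_l_minus[of "\<one>\<^bsub>R\<^esub>" x] K.smult_one[of x] by (simp del: K.smult_one)
      then show ?thesis using smult[OF _ x] by simp
    qed
  qed (rule smult)
  then show ?thesis unfolding homology_def by (rule module_quot_module[OF K])
qed

end

(*
  Let F be the free resolution of M. If t is the largest degree in which P has homology, one copy of
  M in H_t(P) is killed by the cone of an attaching map F[t] -> P, obtained by lifting a coordinate
  inclusion M -> M^a = H_t(P) through the projective modules of F. Finitely many such cones lead to
  an acyclic bounded below complex of projectives, which is contractible and so stays exact under
  - (x) N and Hom(-, N). The cones are degreewise split, so every step gives a long exact sequence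
  relating Tor_*(M, N) to the homology before and after it, and the vanishing statements propagate
  along this tower. This replaces the spectral sequence Tor_p(H_q(P), N) => H_{p+q}(P (x) N).
*)
theory Submission
  imports Defs
begin

section \<open>Modules and exactness\<close>

text \<open>Every cone has a larger carrier than the complex before it, while an induction along the
  tower must speak of complexes over one fixed HOL type. Direct sums are therefore formed inside a
  type \<open>'u\<close> along an injective pairing, and sequences provide a pairing whose values
  lie in the type of its second argument; \<open>P\<close> enters that type as a cone over the zero
  complex.

  The numbers l and m come from the following step. Let b and t be the lowest and highest degrees in
  which P has homology. If H_{p+b}(P \<otimes> N) = 0 and Tor vanishes in the t - b + 1 degrees just
  below p, then Tor_p(M, N) = 0. The window accounts for hsup P - hinf P. The other condition holds
  for p > hsup(P \<otimes> N) - b; the step is applied only to p > n + l, and n \<ge> 1 makes up for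
  the -1. Parts (3) and (4) use the top degree t instead and descend from large degrees; Ext is
  treated in the same way with cohomological degrees.

  The case M = 0 stands apart, because then the exponents a_i are not determined by the homology of
  P.\<close>

lemma lin_mapsI:
  assumes "\<And>x. x \<in> carrier A \<Longrightarrow> f x \<in> carrier B"
    and "\<And>x y. x \<in> carrier A \<Longrightarrow> y \<in> carrier A \<Longrightarrow> f (x \<oplus>\<^bsub>A\<^esub> y) = f x \<oplus>\<^bsub>B\<^esub> f y"
    and "\<And>r x. r \<in> carrier R \<Longrightarrow> x \<in> carrier A \<Longrightarrow> f (r \<odot>\<^bsub>A\<^esub> x) = r \<odot>\<^bsub>B\<^esub> f x"
  shows "f \<in> lin_maps R A B"
  using assms by (auto simp: lin_maps_def)

lemma lin_maps_id: "(\<lambda>x. x) \<in> lin_maps R A A"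
  by (simp add: lin_mapsI)

lemma module_minus_closed:
  assumes "module R A" "x \<in> carrier A" "y \<in> carrier A"
  shows "x \<ominus>\<^bsub>A\<^esub> y \<in> carrier A"
proof -
  interpret module R A by fact
  show ?thesis using assms by simp
qed

lemma module_add_minus_cancel:
  assumes "module R A" "x \<in> carrier A" "y \<in> carrier A"
  shows "y \<oplus>\<^bsub>A\<^esub> (x \<ominus>\<^bsub>A\<^esub> y) = x"
proof -
  interpret module R A by fact
  have "y \<oplus>\<^bsub>A\<^esub> (x \<ominus>\<^bsub>A\<^esub> y) = x \<oplus>\<^bsub>A\<^esub> (y \<oplus>\<^bsub>A\<^esub> \<ominus>\<^bsub>A\<^esub> y)"
    using assms by (simp add: M.minus_eq M.a_ac)
  then show ?thesis using assms by (simp add: M.r_neg)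
qed

lemma module_minus_eq_zero_iff:
  assumes "module R A" "x \<in> carrier A" "y \<in> carrier A"
  shows "x \<ominus>\<^bsub>A\<^esub> y = \<zero>\<^bsub>A\<^esub> \<longleftrightarrow> x = y"
proof -
  interpret module R A by fact
  show ?thesis
    using assms module_add_minus_cancel[OF assms] by (auto simp: M.minus_eq M.r_neg)
qed

lemma lin_maps_add:
  assumes "module R B" "f \<in> lin_maps R A B" "g \<in> lin_maps R A B"
  shows "(\<lambda>x. f x \<oplus>\<^bsub>B\<^esub> g x) \<in> lin_maps R A B"
proof -
  interpret B: module R B by fact
  show ?thesis
    using lin_mapsD[OF assms(2)] lin_mapsD[OF assms(3)]
    by (intro lin_mapsI) (simp_all add: B.M.a_ac B.smult_r_distr)
qed

lemma lin_maps_uminus: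
  assumes "module R B" "f \<in> lin_maps R A B"
  shows "(\<lambda>x. \<ominus>\<^bsub>B\<^esub> f x) \<in> lin_maps R A B"
proof -
  interpret B: module R B by fact
  show ?thesis
    using lin_mapsD[OF assms(2)]
    by (intro lin_mapsI) (simp_all add: B.M.minus_add B.smult_r_minus)
qed

lemma lin_maps_diff:
  assumes "module R B" "f \<in> lin_maps R A B" "g \<in> lin_maps R A B"
  shows "(\<lambda>x. f x \<ominus>\<^bsub>B\<^esub> g x) \<in> lin_maps R A B"
  using lin_maps_add[OF assms(1,2) lin_maps_uminus[OF assms(1,3)]] by (simp add: a_minus_def)

lemma lin_maps_image_submodule:
  assumes "module R A" "module R B" "f \<in> lin_maps R A B"
  shows "submodule (f ` carrier A) R B"
proof -
  interpret A: module R A by fact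
  interpret B: module R B by fact
  have "\<ominus>\<^bsub>B\<^esub> f x = f (\<ominus>\<^bsub>A\<^esub> x)" if "x \<in> carrier A" for x
    using lin_maps_minus[OF assms, of "\<zero>\<^bsub>A\<^esub>" x] that lin_mapsD(1)[OF assms(3) that] lin_maps_zero[OF assms]
    by (simp add: a_minus_def)
  then show ?thesis
  proof (intro B.submoduleI)
    show "\<zero>\<^bsub>B\<^esub> \<in> f ` carrier A" using lin_maps_zero[OF assms] A.M.zero_closed by (metis image_eqI)
  qed (auto simp: lin_mapsD(1)[OF assms(3)] lin_mapsD(2,3)[OF assms(3), symmetric])
qed

text \<open>In a chain complex the opposite inclusion always holds
  (\<open>boundaries_subset_cycles\<close>). This form keeps the cosets of \<open>homology\<close>
  out of the diagram chases; \<open>zero_homology_iff\<close> translates back.\<close>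

definition exact_at :: "('r, 'x) cplx \<Rightarrow> int \<Rightarrow> bool" where
  "exact_at C n \<longleftrightarrow> cycles C n \<subseteq> boundaries C n"

lemma mem_cycles_iff: "x \<in> cycles C n \<longleftrightarrow> x \<in> carrier (obj C n) \<and> dif C n x = \<zero>\<^bsub>obj C (n - 1)\<^esub>"
  by (auto simp: cycles_def a_kernel_alt)

lemma mem_boundaries_iff: "x \<in> boundaries C n \<longleftrightarrow> (\<exists>y\<in>carrier (obj C (n + 1)). x = dif C (n + 1) y)"
  by (auto simp: boundaries_def)

lemma exact_atE:
  assumes "exact_at C n" "x \<in> cycles C n"
  obtains y where "y \<in> carrier (obj C (n + 1))" "x = dif C (n + 1) y"
  using assms unfolding exact_at_def boundaries_def by blast

lemma chain_complexD:
  assumes "chain_complex R C"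
  shows "module R (obj C n)"
    and "dif C n \<in> lin_maps R (obj C n) (obj C (n - 1))"
    and "dif C (n + 1) \<in> lin_maps R (obj C (n + 1)) (obj C n)"
    and "x \<in> carrier (obj C n) \<Longrightarrow> dif C (n - 1) (dif C n x) = \<zero>\<^bsub>obj C (n - 1 - 1)\<^esub>"
    and "y \<in> carrier (obj C (n + 1)) \<Longrightarrow> dif C n (dif C (n + 1) y) = \<zero>\<^bsub>obj C (n - 1)\<^esub>"
proof -
  have *: "dif C n \<in> lin_maps R (obj C n) (obj C (n - 1))"
    "x \<in> carrier (obj C n) \<Longrightarrow> dif C (n - 1) (dif C n x) = \<zero>\<^bsub>obj C (n - 1 - 1)\<^esub>" for n x
    using assms by (auto simp: chain_complex_def)
  show "module R (obj C n)" using assms by (simp add: chain_complex_def)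
  show "dif C n \<in> lin_maps R (obj C n) (obj C (n - 1))" 
    "x \<in> carrier (obj C n) \<Longrightarrow> dif C (n - 1) (dif C n x) = \<zero>\<^bsub>obj C (n - 1 - 1)\<^esub>" by (fact *)+
  show "dif C (n + 1) \<in> lin_maps R (obj C (n + 1)) (obj C n)" using *(1)[of "n + 1"] by simp
  show "y \<in> carrier (obj C (n + 1)) \<Longrightarrow> dif C n (dif C (n + 1) y) = \<zero>\<^bsub>obj C (n - 1)\<^esub>"
    using *(2)[of y "n + 1"] by simp
qed

lemma boundaries_subset_cycles:
  assumes "chain_complex R C" shows "boundaries C n \<subseteq> cycles C n"
  using chain_complexD(5)[OF assms] lin_mapsD(1)[OF chain_complexD(3)[OF assms]]
  by (auto simp: mem_boundaries_iff mem_cycles_iff)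

lemma submodule_boundaries:
  assumes "chain_complex R C" shows "submodule (boundaries C n) R (obj C n)"
  unfolding boundaries_def by (rule lin_maps_image_submodule) (rule chain_complexD[OF assms])+

lemma submodule_cycles:
  assumes "chain_complex R C" shows "submodule (cycles C n) R (obj C n)"
  unfolding cycles_def a_kernel_alt by (rule submodule_kernel) (rule chain_complexD[OF assms])+

lemma module_cycles:
  assumes "chain_complex R C" shows "module R ((obj C n)\<lparr>carrier := cycles C n\<rparr>)"
  by (rule submodule.submodule_is_module[OF submodule_cycles[OF assms] chain_complexD(1)[OF assms]])

lemma submodule_boundaries_cycles:
  assumes "chain_complex R C" shows "submodule (boundaries C n) R ((obj C n)\<lparr>carrier := cycles C n\<rparr>)"
proof -
  let ?Z = "(obj C n)\<lparr>carrier := cycles C n\<rparr>"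
  have "dif C (n + 1) \<in> lin_maps R (obj C (n + 1)) ?Z"
    using lin_mapsD[OF chain_complexD(3)[OF assms]] boundaries_subset_cycles[OF assms, of n]
    by (intro lin_mapsI) (auto simp: boundaries_def)
  from lin_maps_image_submodule[OF chain_complexD(1)[OF assms] module_cycles[OF assms] this]
  show ?thesis by (simp add: boundaries_def)
qed

lemma zero_module_quot_iff:
  assumes "module R A" "submodule H R A"
  shows "zero_module (quot_module A H) \<longleftrightarrow> carrier A \<subseteq> H"
proof -
  interpret module R A by fact
  interpret H: abelian_subgroup H A by (rule submodule_abelian_subgroup) fact
  note q = quot_module_rules[OF assms]
  have z: "\<zero>\<^bsub>quot_module A H\<^esub> = H +>\<^bsub>A\<^esub> \<zero>\<^bsub>A\<^esub>"
    by (simp add: quot_module_simps M.a_coset_add_zero[OF H.a_subset])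
  have eq: "H +>\<^bsub>A\<^esub> x = H +>\<^bsub>A\<^esub> \<zero>\<^bsub>A\<^esub> \<longleftrightarrow> x \<in> H" if "x \<in> carrier A" for x
    using that q(5)[of x "\<zero>\<^bsub>A\<^esub>"] module_add_minus_cancel[OF assms(1) that M.zero_closed] by simp
  have "zero_module (quot_module A H) \<longleftrightarrow> (\<forall>T\<in>carrier (quot_module A H). T = H +>\<^bsub>A\<^esub> \<zero>\<^bsub>A\<^esub>)"
    using q(3)[of "\<zero>\<^bsub>A\<^esub>"] unfolding zero_module_def z by auto
  also have "\<dots> \<longleftrightarrow> (\<forall>x\<in>carrier A. H +>\<^bsub>A\<^esub> x = H +>\<^bsub>A\<^esub> \<zero>\<^bsub>A\<^esub>)"
    using q(3,4) by blast
  also have "\<dots> \<longleftrightarrow> carrier A \<subseteq> H" using eq by auto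
  finally show ?thesis .
qed

lemma zero_homology_iff:
  assumes "chain_complex R C"
  shows "zero_module (homology C n) \<longleftrightarrow> exact_at C n"
  using zero_module_quot_iff[OF module_cycles[OF assms] submodule_boundaries_cycles[OF assms]]
  by (simp add: homology_def exact_at_def)

lemma exact_at_zero:
  assumes "chain_complex R C" "zero_module (obj C n)"
  shows "exact_at C n"
proof -
  have "\<zero>\<^bsub>obj C n\<^esub> \<in> boundaries C n"
    using submodule_boundaries[OF assms(1), of n] 
    by (metis additive_subgroup.zero_closed additive_subgroup.intro submodule_def)
  then show ?thesis using assms(2) by (auto simp: exact_at_def mem_cycles_iff zero_module_def)
qed

section \<open>Short exact sequences of complexes\<close>

locale complex_ses =
  fixes R :: "'r ring" and A :: "('r, 'a) cplx" and B :: "('r, 'b) cplx" and C :: "('r, 'c) cplx"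
    and \<alpha> :: "int \<Rightarrow> 'a \<Rightarrow> 'b" and \<beta> :: "int \<Rightarrow> 'b \<Rightarrow> 'c"
  assumes cA: "chain_complex R A" and cB: "chain_complex R B" and cC: "chain_complex R C"
    and \<alpha>: "\<alpha> n \<in> lin_maps R (obj A n) (obj B n)" and \<beta>: "\<beta> n \<in> lin_maps R (obj B n) (obj C n)"
    and \<alpha>_dif: "x \<in> carrier (obj A n) \<Longrightarrow> dif B n (\<alpha> n x) = \<alpha> (n - 1) (dif A n x)"
    and \<beta>_dif: "y \<in> carrier (obj B n) \<Longrightarrow> dif C n (\<beta> n y) = \<beta> (n - 1) (dif B n y)"
    and inj: "x \<in> carrier (obj A n) \<Longrightarrow> \<alpha> n x = \<zero>\<^bsub>obj B n\<^esub> \<Longrightarrow> x = \<zero>\<^bsub>obj A n\<^esub>"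
    and surj: "z \<in> carrier (obj C n) \<Longrightarrow> \<exists>y\<in>carrier (obj B n). \<beta> n y = z"
    and ker: "y \<in> carrier (obj B n) \<Longrightarrow> \<beta> n y = \<zero>\<^bsub>obj C n\<^esub> \<Longrightarrow> \<exists>x\<in>carrier (obj A n). \<alpha> n x = y"
    and comp: "x \<in> carrier (obj A n) \<Longrightarrow> \<beta> n (\<alpha> n x) = \<zero>\<^bsub>obj C n\<^esub>"
begin

lemmas mA = chain_complexD(1)[OF cA] and mB = chain_complexD(1)[OF cB] and mC = chain_complexD(1)[OF cC]
lemmas dA = chain_complexD(2)[OF cA] and dB = chain_complexD(2)[OF cB]
lemmas dA' = chain_complexD(3)[OF cA] and dB' = chain_complexD(3)[OF cB]
lemmas ddB = chain_complexD(4)[OF cB] and ddB' = chain_complexD(5)[OF cB]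

lemma \<alpha>_dif': "x \<in> carrier (obj A (n + 1)) \<Longrightarrow> dif B (n + 1) (\<alpha> (n + 1) x) = \<alpha> n (dif A (n + 1) x)"
  using \<alpha>_dif[of x "n + 1"] by simp

lemma \<beta>_dif': "y \<in> carrier (obj B (n + 1)) \<Longrightarrow> dif C (n + 1) (\<beta> (n + 1) y) = \<beta> n (dif B (n + 1) y)"
  using \<beta>_dif[of y "n + 1"] by simp

lemma inj_on: "x \<in> carrier (obj A n) \<Longrightarrow> x' \<in> carrier (obj A n) \<Longrightarrow> \<alpha> n x = \<alpha> n x' \<Longrightarrow> x = x'"
  using inj[of "x \<ominus>\<^bsub>obj A n\<^esub> x'" n] lin_maps_minus[OF mA mB \<alpha>, of x n x'] lin_mapsD(1)[OF \<alpha>]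
    module_minus_closed[OF mA, of x n x'] module_minus_eq_zero_iff[OF mA, of x n x'] module_minus_eq_zero_iff[OF mB]
  by metis

lemma lift_equal:
  assumes "y \<in> carrier (obj B n)" "y' \<in> carrier (obj B n)" "\<beta> n y = \<beta> n y'"
  obtains x where "x \<in> carrier (obj A n)" "y = y' \<oplus>\<^bsub>obj B n\<^esub> \<alpha> n x"
proof -
  have "\<beta> n (y \<ominus>\<^bsub>obj B n\<^esub> y') = \<zero>\<^bsub>obj C n\<^esub>"
    using assms lin_maps_minus[OF mB mC \<beta>] lin_mapsD(1)[OF \<beta>] module_minus_eq_zero_iff[OF mC] by metis
  then obtain x where "x \<in> carrier (obj A n)" "\<alpha> n x = y \<ominus>\<^bsub>obj B n\<^esub> y'"
    using ker module_minus_closed[OF mB assms(1,2)] by blast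
  then show ?thesis using that module_add_minus_cancel[OF mB assms(1,2)] by simp
qed

text \<open>The segment H_n(A) -> H_n(B) -> H_n(C) of the long exact sequence. Only vanishing
  matters here, so each segment is chased on elements and no connecting map is constructed.\<close>

lemma exact_middle:
  assumes "exact_at A n" "exact_at C n" shows "exact_at B n"
  unfolding exact_at_def
proof
  interpret B: module R "obj B k" for k by (rule mB)
  interpret A: module R "obj A k" for k by (rule mA)
  fix y assume "y \<in> cycles B n"
  then have y: "y \<in> carrier (obj B n)" "dif B n y = \<zero>\<^bsub>obj B (n - 1)\<^esub>" by (auto simp: mem_cycles_iff)
  have "\<beta> n y \<in> cycles C n"
    using y \<beta>_dif[OF y(1)] lin_maps_zero[OF mB mC \<beta>] lin_mapsD(1)[OF \<beta>] by (simp add: mem_cycles_iff)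
  then obtain z where z: "z \<in> carrier (obj C (n + 1))" "\<beta> n y = dif C (n + 1) z"
    by (rule exact_atE[OF assms(2)])
  obtain w where w: "w \<in> carrier (obj B (n + 1))" "\<beta> (n + 1) w = z" using surj z(1) by blast
  have dw: "dif B (n + 1) w \<in> carrier (obj B n)" using lin_mapsD(1)[OF dB'] w by blast
  obtain x where x: "x \<in> carrier (obj A n)" "y = dif B (n + 1) w \<oplus>\<^bsub>obj B n\<^esub> \<alpha> n x"
    using lift_equal[OF y(1) dw] z w \<beta>_dif' by metis
  have "\<alpha> (n - 1) (dif A n x) = dif B n (\<alpha> n x)" using \<alpha>_dif x by simp
  also have "\<dots> = dif B n y"
    using x(2) lin_mapsD(2)[OF dB dw lin_mapsD(1)[OF \<alpha> x(1)]] ddB'[OF w(1)]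
      lin_mapsD(1)[OF dB lin_mapsD(1)[OF \<alpha> x(1)]] by simp
  finally have "dif A n x = \<zero>\<^bsub>obj A (n - 1)\<^esub>" using inj lin_mapsD(1)[OF dA x(1)] y by simp
  then have "x \<in> cycles A n" using x by (simp add: mem_cycles_iff)
  then obtain x' where x': "x' \<in> carrier (obj A (n + 1))" "x = dif A (n + 1) x'"
    by (rule exact_atE[OF assms(1)])
  have "y = dif B (n + 1) (w \<oplus>\<^bsub>obj B (n + 1)\<^esub> \<alpha> (n + 1) x')"
    using x(2) x' \<alpha>_dif' lin_mapsD(2)[OF dB' w(1) lin_mapsD(1)[OF \<alpha> x'(1)]] by simp
  then show "y \<in> boundaries B n"
    using w lin_mapsD(1)[OF \<alpha> x'(1)] by (auto simp: mem_boundaries_iff)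
qed

text \<open>The segment H_n(B) -> H_n(C) -> H_{n-1}(A): the \<open>x\<close> found below represents
  the image of the class of \<open>z\<close> under the connecting map.\<close>

lemma exact_right:
  assumes "exact_at B n" "exact_at A (n - 1)" shows "exact_at C n"
  unfolding exact_at_def
proof
  fix z assume "z \<in> cycles C n"
  then have z: "z \<in> carrier (obj C n)" "dif C n z = \<zero>\<^bsub>obj C (n - 1)\<^esub>" by (auto simp: mem_cycles_iff)
  obtain y where y: "y \<in> carrier (obj B n)" "\<beta> n y = z" using surj z(1) by blast
  have dy: "dif B n y \<in> carrier (obj B (n - 1))" using lin_mapsD(1)[OF dB] y by blast
  obtain x where x: "x \<in> carrier (obj A (n - 1))" "\<alpha> (n - 1) x = dif B n y"
    using ker[OF dy] \<beta>_dif y z by metis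
  have "\<alpha> (n - 1 - 1) (dif A (n - 1) x) = \<zero>\<^bsub>obj B (n - 1 - 1)\<^esub>"
    using \<alpha>_dif[OF x(1)] x(2) ddB[OF y(1)] by simp
  then have "x \<in> cycles A (n - 1)" using x inj lin_mapsD(1)[OF dA x(1)] by (simp add: mem_cycles_iff)
  then obtain x' where x': "x' \<in> carrier (obj A n)" "x = dif A n x'"
    by (rule exact_atE[OF assms(2), unfolded diff_add_cancel])
  have ax: "\<alpha> n x' \<in> carrier (obj B n)" using lin_mapsD(1)[OF \<alpha>] x' by blast
  let ?w = "y \<ominus>\<^bsub>obj B n\<^esub> \<alpha> n x'"
  have "dif B n ?w = \<zero>\<^bsub>obj B (n - 1)\<^esub>"
    using lin_maps_minus[OF mB mB dB y(1) ax] \<alpha>_dif[OF x'(1)] x x' module_minus_eq_zero_iff[OF mB dy dy] by simp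
  then have "?w \<in> cycles B n" using module_minus_closed[OF mB y(1) ax] by (simp add: mem_cycles_iff)
  then obtain w where w: "w \<in> carrier (obj B (n + 1))" "?w = dif B (n + 1) w"
    by (rule exact_atE[OF assms(1)])
  interpret C: module R "obj C k" for k by (rule mC)
  have "\<beta> n ?w = z" using lin_maps_minus[OF mB mC \<beta> y(1) ax] comp[OF x'(1)] y z by (simp add: a_minus_def)
  then have "z = dif C (n + 1) (\<beta> (n + 1) w)" using w \<beta>_dif' by simp
  then show "z \<in> boundaries C n" using lin_mapsD(1)[OF \<beta> w(1)] by (auto simp: mem_boundaries_iff)
qed

text \<open>The segment H_{n+1}(C) -> H_n(A) -> H_n(B): if a cycle of \<open>A\<close> bounds
  \<open>y\<close> in \<open>B\<close>, then \<open>y\<close> projects to a cycle of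
  \<open>C\<close>, and changing \<open>y\<close> by a boundary brings it into the image of
  \<open>A\<close>.\<close>

lemma exact_left:
  assumes "exact_at C (n + 1)" "exact_at B n" shows "exact_at A n"
  unfolding exact_at_def
proof
  fix x assume "x \<in> cycles A n"
  then have x: "x \<in> carrier (obj A n)" "dif A n x = \<zero>\<^bsub>obj A (n - 1)\<^esub>" by (auto simp: mem_cycles_iff)
  have "\<alpha> n x \<in> cycles B n"
    using x \<alpha>_dif[OF x(1)] lin_maps_zero[OF mA mB \<alpha>] lin_mapsD(1)[OF \<alpha>] by (simp add: mem_cycles_iff)
  then obtain y where y: "y \<in> carrier (obj B (n + 1))" "\<alpha> n x = dif B (n + 1) y"
    by (rule exact_atE[OF assms(2), unfolded diff_add_cancel])
  have "dif C (n + 1) (\<beta> (n + 1) y) = \<zero>\<^bsub>obj C n\<^esub>" using \<beta>_dif'[OF y(1)] comp[OF x(1)] y by simp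
  then have "\<beta> (n + 1) y \<in> cycles C (n + 1)" using lin_mapsD(1)[OF \<beta> y(1)] by (simp add: mem_cycles_iff)
  then obtain z where z: "z \<in> carrier (obj C (n + 1 + 1))" "\<beta> (n + 1) y = dif C (n + 1 + 1) z"
    using assms(1) unfolding exact_at_def mem_boundaries_iff[abs_def] subset_iff by blast
  obtain w where w: "w \<in> carrier (obj B (n + 1 + 1))" "\<beta> (n + 1 + 1) w = z" using surj z(1) by blast
  have dw: "dif B (n + 1 + 1) w \<in> carrier (obj B (n + 1))" using lin_mapsD(1)[OF dB'] w by blast
  obtain x' where x': "x' \<in> carrier (obj A (n + 1))" "y = dif B (n + 1 + 1) w \<oplus>\<^bsub>obj B (n + 1)\<^esub> \<alpha> (n + 1) x'"
    using lift_equal[OF y(1) dw] z w \<beta>_dif'[OF w(1)] by metis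
  have ax: "\<alpha> (n + 1) x' \<in> carrier (obj B (n + 1))" using lin_mapsD(1)[OF \<alpha>] x' by blast
  interpret B: module R "obj B k" for k by (rule mB)
  have "dif B (n + 1) (dif B (n + 1 + 1) w) = \<zero>\<^bsub>obj B n\<^esub>" using ddB'[OF w(1)] by simp
  then have "\<alpha> n x = \<alpha> n (dif A (n + 1) x')"
    using y(2) x'(2) lin_mapsD(2)[OF dB' dw ax] \<alpha>_dif'[OF x'(1)] lin_mapsD(1)[OF \<alpha> lin_mapsD(1)[OF dA' x'(1)]] by simp
  then have "x = dif A (n + 1) x'" using inj_on x lin_mapsD(1)[OF dA' x'(1)] by blast
  then show "x \<in> boundaries A n" using x' by (auto simp: mem_boundaries_iff)
qed

end

section \<open>Lifting and contractions\<close>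

text \<open>Corestricted to its image, a differential is a surjection, against which projective
  modules lift. Both the contraction of an acyclic complex and the attaching map are built degree by
  degree from this.\<close>

lemma lift_boundaries:
  assumes Y: "chain_complex R Y" and Q: "projective R Q" and g: "g \<in> lin_maps R Q (obj Y n)"
    and bd: "\<And>x. x \<in> carrier Q \<Longrightarrow> g x \<in> boundaries Y n"
  obtains h where "h \<in> lin_maps R Q (obj Y (n + 1))"
    and "\<And>x. x \<in> carrier Q \<Longrightarrow> dif Y (n + 1) (h x) = g x"
proof -
  let ?B = "(obj Y n)\<lparr>carrier := boundaries Y n\<rparr>"
  note c = chain_complexD[OF Y]
  have B: "module R ?B" by (rule submodule.submodule_is_module[OF submodule_boundaries[OF Y] c(1)])
  have d: "dif Y (n + 1) \<in> lin_maps R (obj Y (n + 1)) ?B"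
    using lin_mapsD[OF c(3)] by (intro lin_mapsI) (auto simp: boundaries_def)
  have "g \<in> lin_maps R Q ?B" using lin_mapsD[OF g] bd by (intro lin_mapsI) auto
  from projective_lifting[OF Q c(1) B d _ this] that show ?thesis
    by (auto simp: boundaries_def)
qed

text \<open>Once s is known in degree n - 1, the element x - s(d x) is a cycle, hence a boundary,
  and projectivity makes the choice of a preimage linear in x. The identity ds + sd = id, unlike
  exactness itself, is preserved by every additive functor.\<close>

lemma acyclic_contraction:
  assumes Y: "chain_complex R Y" and proj: "\<And>n. projective R (obj Y n)"
    and bdd: "bounded_below_cplx Y" and ex: "\<And>n. exact_at Y n"
  obtains s where "\<And>n. s n \<in> lin_maps R (obj Y n) (obj Y (n + 1))"
    and "\<And>n x. x \<in> carrier (obj Y n) \<Longrightarrow>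
      dif Y (n + 1) (s n x) \<oplus>\<^bsub>obj Y n\<^esub> s (n - 1) (dif Y n x) = x"
proof -
  note c = chain_complexD[OF Y]
  interpret Y: module R "obj Y n" for n by (rule c)
  obtain k where k: "\<And>n. n < k \<Longrightarrow> carrier (obj Y n) = {\<zero>\<^bsub>obj Y n\<^esub>}"
    using bdd by (auto simp: bounded_below_cplx_def zero_module_def)
  \<comment> \<open>The recursion starts one degree below the bound \<open>k\<close>: the module
    there is zero, so the zero map qualifies.\<close>
  define \<kappa> where "\<kappa> m = k - 1 + int m" for m
  have \<kappa>Suc: "\<kappa> (Suc m) = \<kappa> m + 1" for m by (simp add: \<kappa>_def)
  \<comment> \<open>\<open>P\<close> is the invariant that allows the next step, namely that
    \<open>h\<close> inverts the differential on cycles; \<open>Q\<close> is the homotopy identity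
    linking consecutive maps.\<close>
  define P where "P m h \<longleftrightarrow> h \<in> lin_maps R (obj Y (\<kappa> m)) (obj Y (\<kappa> m + 1)) \<and>
    (\<forall>z\<in>cycles Y (\<kappa> m). dif Y (\<kappa> m + 1) (h z) = z)" for m h
  define Q where "Q m h h' \<longleftrightarrow> (\<forall>x\<in>carrier (obj Y (\<kappa> m + 1)).
    dif Y (\<kappa> m + 1 + 1) (h' x) \<oplus>\<^bsub>obj Y (\<kappa> m + 1)\<^esub> h (dif Y (\<kappa> m + 1) x) = x)" for m h h'
  have "\<exists>s. \<forall>m. P m (s m) \<and> Q m (s m) (s (Suc m))"
  proof (rule dependent_nat_choice)
    have "P 0 (\<lambda>_. \<zero>\<^bsub>obj Y (\<kappa> 0 + 1)\<^esub>)"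
      using k[of "k - 1"] lin_maps_zero[OF c(1) c(1) c(3), of "k - 1"]
      by (auto simp: P_def \<kappa>_def lin_maps_const_zero c(1) mem_cycles_iff)
    then show "\<exists>h. P 0 h" by blast
    fix h m assume "P m h"
    then have h: "h \<in> lin_maps R (obj Y (\<kappa> m)) (obj Y (\<kappa> m + 1))"
      and hz: "\<And>z. z \<in> cycles Y (\<kappa> m) \<Longrightarrow> dif Y (\<kappa> m + 1) (h z) = z" by (auto simp: P_def)
    let ?g = "\<lambda>x. x \<ominus>\<^bsub>obj Y (\<kappa> m + 1)\<^esub> h (dif Y (\<kappa> m + 1) x)"
    have hd: "(\<lambda>x. h (dif Y (\<kappa> m + 1) x)) \<in> lin_maps R (obj Y (\<kappa> m + 1)) (obj Y (\<kappa> m + 1))"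
      by (rule lin_maps_comp[OF c(3) h])
    have g: "?g \<in> lin_maps R (obj Y (\<kappa> m + 1)) (obj Y (\<kappa> m + 1))"
      by (rule lin_maps_diff[OF c(1) _ hd]) (simp add: lin_mapsI)
    have "?g x \<in> cycles Y (\<kappa> m + 1)" if x: "x \<in> carrier (obj Y (\<kappa> m + 1))" for x
    proof -
      have dx: "dif Y (\<kappa> m + 1) x \<in> cycles Y (\<kappa> m)"
        using c(5)[OF x] lin_mapsD(1)[OF c(3) x] by (simp add: mem_cycles_iff)
      have "dif Y (\<kappa> m + 1) (?g x) = dif Y (\<kappa> m + 1) x \<ominus>\<^bsub>obj Y (\<kappa> m)\<^esub> dif Y (\<kappa> m + 1) x"
        using lin_maps_minus[OF c(1) c(1) c(3) x lin_mapsD(1)[OF hd x]] hz[OF dx] by simp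
      then show ?thesis
        using module_minus_eq_zero_iff[OF c(1)] lin_mapsD(1)[OF c(3) x] lin_mapsD(1)[OF g x]
        by (simp add: mem_cycles_iff)
    qed
    then obtain h' where h': "h' \<in> lin_maps R (obj Y (\<kappa> m + 1)) (obj Y (\<kappa> m + 1 + 1))"
      "\<And>x. x \<in> carrier (obj Y (\<kappa> m + 1)) \<Longrightarrow> dif Y (\<kappa> m + 1 + 1) (h' x) = ?g x"
      using lift_boundaries[OF Y proj g] ex unfolding exact_at_def by blast
    have "P (Suc m) h'"
      unfolding P_def \<kappa>Suc
    proof (intro conjI ballI)
      fix z assume "z \<in> cycles Y (\<kappa> m + 1)"
      then have z: "z \<in> carrier (obj Y (\<kappa> m + 1))" "dif Y (\<kappa> m + 1) z = \<zero>\<^bsub>obj Y (\<kappa> m)\<^esub>"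
        by (auto simp: mem_cycles_iff)
      then show "dif Y (\<kappa> m + 1 + 1) (h' z) = z"
        using h'(2) lin_maps_zero[OF c(1) c(1) h] module_add_minus_cancel[OF c(1) z(1) Y.M.zero_closed]
          module_minus_closed[OF c(1) z(1) Y.M.zero_closed]
        by (simp add: Y.M.minus_eq)
    qed (rule h')
    moreover have "Q m h h'"
      unfolding Q_def
    proof
      fix x assume x: "x \<in> carrier (obj Y (\<kappa> m + 1))"
      show "dif Y (\<kappa> m + 1 + 1) (h' x) \<oplus>\<^bsub>obj Y (\<kappa> m + 1)\<^esub> h (dif Y (\<kappa> m + 1) x) = x"
        using h'(2)[OF x] module_add_minus_cancel[OF c(1) x lin_mapsD(1)[OF hd x]]
          Y.M.a_comm[OF lin_mapsD(1)[OF hd x] lin_mapsD(1)[OF g x]] by simp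
    qed
    ultimately show "\<exists>h'. P (Suc m) h' \<and> Q m h h'" by blast
  qed
  then obtain s where s: "\<And>m. P m (s m)" "\<And>m. Q m (s m) (s (Suc m))" by blast
  define t where "t n = (if n < k - 1 then (\<lambda>_. \<zero>\<^bsub>obj Y (n + 1)\<^esub>) else s (nat (n - k + 1)))" for n
  have tl: "t n \<in> lin_maps R (obj Y n) (obj Y (n + 1))" for n
  proof (cases "n < k - 1")
    case True
    then show ?thesis by (simp add: t_def lin_maps_const_zero c(1))
  next
    case False
    then have "\<kappa> (nat (n - k + 1)) = n" by (simp add: \<kappa>_def)
    then show ?thesis using s(1)[of "nat (n - k + 1)"] False by (simp add: t_def P_def)
  qed
  have "dif Y (n + 1) (t n x) \<oplus>\<^bsub>obj Y n\<^esub> t (n - 1) (dif Y n x) = x" if x: "x \<in> carrier (obj Y n)" for n x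
  proof (cases "n < k")
    case True
    have "t (n - 1) (dif Y n x) \<in> carrier (obj Y n)"
      using lin_mapsD(1)[OF tl lin_mapsD(1)[OF c(2) x]] by simp
    then have "dif Y (n + 1) (t n x) \<oplus>\<^bsub>obj Y n\<^esub> t (n - 1) (dif Y n x) \<in> carrier (obj Y n)"
      using lin_mapsD(1)[OF c(3) lin_mapsD(1)[OF tl x]] by simp
    then show ?thesis using x k[OF True] by simp
  next
    case False
    define m where "m = nat (n - k)"
    have m: "\<kappa> m + 1 = n" "t (n - 1) = s m" "t n = s (Suc m)"
      using False by (auto simp: m_def \<kappa>_def t_def nat_add_distrib)
    show ?thesis using s(2)[of m] x by (simp add: Q_def m)
  qed
  with tl that show ?thesis by blast
qed

section \<open>Degreewise split extensions of complexes\<close>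

text \<open>\<open>sec\<close> and \<open>ret\<close> split each degree separately and need not
  commute with the differentials, so homology is not split. This still suffices for additive
  functors to keep 0 -> Y -> W -> V -> 0 exact.\<close>

locale split_ext =
  fixes R :: "'r ring" and V :: "('r, 'x) cplx" and Y :: "('r, 'y) cplx" and W :: "('r, 'w) cplx"
    and inc :: "int \<Rightarrow> 'y \<Rightarrow> 'w" and prj :: "int \<Rightarrow> 'w \<Rightarrow> 'x"
    and sec :: "int \<Rightarrow> 'x \<Rightarrow> 'w" and ret :: "int \<Rightarrow> 'w \<Rightarrow> 'y"
  assumes cV: "chain_complex R V" and cY: "chain_complex R Y" and cW: "chain_complex R W"
    and inc: "inc n \<in> lin_maps R (obj Y n) (obj W n)" and prj: "prj n \<in> lin_maps R (obj W n) (obj V n)"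
    and sec: "sec n \<in> lin_maps R (obj V n) (obj W n)" and ret: "ret n \<in> lin_maps R (obj W n) (obj Y n)"
    and ret_inc: "y \<in> carrier (obj Y n) \<Longrightarrow> ret n (inc n y) = y"
    and prj_sec: "x \<in> carrier (obj V n) \<Longrightarrow> prj n (sec n x) = x"
    and prj_inc: "y \<in> carrier (obj Y n) \<Longrightarrow> prj n (inc n y) = \<zero>\<^bsub>obj V n\<^esub>"
    and decomp: "w \<in> carrier (obj W n) \<Longrightarrow> inc n (ret n w) \<oplus>\<^bsub>obj W n\<^esub> sec n (prj n w) = w"
    and inc_dif: "y \<in> carrier (obj Y n) \<Longrightarrow> dif W n (inc n y) = inc (n - 1) (dif Y n y)"
    and prj_dif: "w \<in> carrier (obj W n) \<Longrightarrow> dif V n (prj n w) = prj (n - 1) (dif W n w)"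
begin

text \<open>A map out of W_n is determined by its composites with \<open>inc\<close> and
  \<open>sec\<close>; these are lifted separately and the lifts are added after \<open>ret\<close>
  and \<open>prj\<close>.\<close>

lemma projective_middle:
  assumes "projective R (obj V n)" "projective R (obj Y n)"
  shows "projective R (obj W n)"
  unfolding projective_def
proof (intro conjI allI impI, goal_cases)
  case 1 show ?case by (rule chain_complexD[OF cW])
next
  case (2 A B f g)
  then have A: "module R A" and B: "module R B" and f: "f \<in> lin_maps R A B" "f ` carrier A = carrier B"
    and g: "g \<in> lin_maps R (obj W n) B" by auto
  obtain h where h: "h \<in> lin_maps R (obj V n) A" "\<And>x. x \<in> carrier (obj V n) \<Longrightarrow> f (h x) = g (sec n x)"
    using projective_lifting[OF assms(1) A B f lin_maps_comp[OF sec g]] by blast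
  obtain k where k: "k \<in> lin_maps R (obj Y n) A" "\<And>y. y \<in> carrier (obj Y n) \<Longrightarrow> f (k y) = g (inc n y)"
    using projective_lifting[OF assms(2) A B f lin_maps_comp[OF inc g]] by blast
  show ?case
  proof (rule bexI[of _ "\<lambda>w. k (ret n w) \<oplus>\<^bsub>A\<^esub> h (prj n w)"], rule ballI)
    fix w assume w: "w \<in> carrier (obj W n)"
    note rw = lin_mapsD(1)[OF ret w] and pw = lin_mapsD(1)[OF prj w]
    have "f (k (ret n w) \<oplus>\<^bsub>A\<^esub> h (prj n w)) = g (inc n (ret n w)) \<oplus>\<^bsub>B\<^esub> g (sec n (prj n w))"
      using lin_mapsD(2)[OF f(1) lin_mapsD(1)[OF k(1) rw] lin_mapsD(1)[OF h(1) pw]] k(2)[OF rw] h(2)[OF pw] by simp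
    also have "\<dots> = g w"
      using lin_mapsD(2)[OF g lin_mapsD(1)[OF inc rw] lin_mapsD(1)[OF sec pw]] decomp[OF w] by simp
    finally show "f (k (ret n w) \<oplus>\<^bsub>A\<^esub> h (prj n w)) = g w" .
  qed (rule lin_maps_add[OF A lin_maps_comp[OF ret k(1)] lin_maps_comp[OF prj h(1)]])
qed

lemma bounded_below_middle:
  assumes "bounded_below_cplx V" "bounded_below_cplx Y"
  shows "bounded_below_cplx W"
proof -
  obtain k l where k: "\<And>n. n < k \<Longrightarrow> zero_module (obj V n)" and l: "\<And>n. n < l \<Longrightarrow> zero_module (obj Y n)"
    using assms unfolding bounded_below_cplx_def by blast
  have "zero_module (obj W n)" if n: "n < min k l" for n
  proof -
    interpret W: module R "obj W n" by (rule chain_complexD[OF cW])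
    have "w = \<zero>\<^bsub>obj W n\<^esub>" if w: "w \<in> carrier (obj W n)" for w
    proof -
      have "ret n w = \<zero>\<^bsub>obj Y n\<^esub>" "prj n w = \<zero>\<^bsub>obj V n\<^esub>"
        using k l n lin_mapsD(1)[OF ret w] lin_mapsD(1)[OF prj w] by (auto simp: zero_module_def)
      then show ?thesis
        using decomp[OF w] lin_maps_zero[OF chain_complexD(1)[OF cY] chain_complexD(1)[OF cW] inc]
          lin_maps_zero[OF chain_complexD(1)[OF cV] chain_complexD(1)[OF cW] sec] by simp
    qed
    then show ?thesis by (auto simp: zero_module_def)
  qed
  then show ?thesis unfolding bounded_below_cplx_def by blast
qed

end

section \<open>Mapping cones\<close>

text \<open>An injective coding of pairs in a type \<open>'u\<close> that remains to be chosen. With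
  \<open>'u\<close> equal to \<open>'y\<close>, cones can be iterated without leaving the type,
  which the product type would not allow.\<close>

locale pairing =
  fixes e :: "'x \<Rightarrow> 'y \<Rightarrow> 'u" and p1 :: "'u \<Rightarrow> 'x" and p2 :: "'u \<Rightarrow> 'y"
  assumes p1_e [simp]: "p1 (e x y) = x" and p2_e [simp]: "p2 (e x y) = y"
begin

lemma e_eq_iff [simp]: "e x y = e x' y' \<longleftrightarrow> x = x' \<and> y = y'"
  using p1_e p2_e by metis

definition sum_module :: "('r, 'x) module \<Rightarrow> ('r, 'y) module \<Rightarrow> ('r, 'u) module" where
  "sum_module A B =
     mk_module {e x y | x y. x \<in> carrier A \<and> y \<in> carrier B} (e \<zero>\<^bsub>A\<^esub> \<zero>\<^bsub>B\<^esub>)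
       (\<lambda>u v. e (p1 u \<oplus>\<^bsub>A\<^esub> p1 v) (p2 u \<oplus>\<^bsub>B\<^esub> p2 v)) (\<lambda>r u. e (r \<odot>\<^bsub>A\<^esub> p1 u) (r \<odot>\<^bsub>B\<^esub> p2 u))"

lemma sum_module_simps:
  "u \<in> carrier (sum_module A B) \<longleftrightarrow> (\<exists>x y. u = e x y \<and> x \<in> carrier A \<and> y \<in> carrier B)"
  "\<zero>\<^bsub>sum_module A B\<^esub> = e \<zero>\<^bsub>A\<^esub> \<zero>\<^bsub>B\<^esub>"
  "e x y \<oplus>\<^bsub>sum_module A B\<^esub> e x' y' = e (x \<oplus>\<^bsub>A\<^esub> x') (y \<oplus>\<^bsub>B\<^esub> y')"
  "r \<odot>\<^bsub>sum_module A B\<^esub> e x y = e (r \<odot>\<^bsub>A\<^esub> x) (r \<odot>\<^bsub>B\<^esub> y)"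
  by (auto simp: sum_module_def)

lemma module_sum_module:
  assumes "module R A" "module R B"
  shows "module R (sum_module A B)"
proof -
  interpret A: module R A by fact
  interpret B: module R B by fact
  show ?thesis
  proof (rule moduleI)
    show "cring R" by (rule module_cring[OF assms(1)])
    show "abelian_group (sum_module A B)"
    proof (rule abelian_groupI)
      fix u assume "u \<in> carrier (sum_module A B)"
      then obtain x y where "u = e x y" "x \<in> carrier A" "y \<in> carrier B" by (auto simp: sum_module_simps)
      then show "\<exists>v\<in>carrier (sum_module A B). v \<oplus>\<^bsub>sum_module A B\<^esub> u = \<zero>\<^bsub>sum_module A B\<^esub>"
        by (intro bexI[of _ "e (\<ominus>\<^bsub>A\<^esub> x) (\<ominus>\<^bsub>B\<^esub> y)"]) (auto simp: sum_module_simps A.M.l_neg B.M.l_neg)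
    qed (auto simp: sum_module_simps A.M.a_ac B.M.a_ac)
  qed (auto simp: sum_module_simps A.smult_l_distr B.smult_l_distr A.smult_r_distr B.smult_r_distr
      A.smult_assoc1 B.smult_assoc1)
qed

end

text \<open>
  The sign of the mapping cone is absorbed into \<open>f\<close>, which anticommutes with the differentials.
\<close>

locale mapping_cone = pairing e p1 p2
  for e :: "'x \<Rightarrow> 'y \<Rightarrow> 'u" and p1 :: "'u \<Rightarrow> 'x" and p2 :: "'u \<Rightarrow> 'y" +
  fixes R :: "'r ring" and V :: "('r, 'x) cplx" and Y :: "('r, 'y) cplx" and f :: "int \<Rightarrow> 'x \<Rightarrow> 'y"
  assumes cV: "chain_complex R V" and cY: "chain_complex R Y"
    and f: "f n \<in> lin_maps R (obj V n) (obj Y (n - 1))"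
    and anti: "x \<in> carrier (obj V n) \<Longrightarrow>
      f (n - 1) (dif V n x) \<oplus>\<^bsub>obj Y (n - 1 - 1)\<^esub> dif Y (n - 1) (f n x) = \<zero>\<^bsub>obj Y (n - 1 - 1)\<^esub>"
begin

definition cone :: "('r, 'u) cplx" where
  "cone = \<lparr>obj = (\<lambda>n. sum_module (obj V n) (obj Y n)),
           dif = (\<lambda>n u. e (dif V n (p1 u)) (f n (p1 u) \<oplus>\<^bsub>obj Y (n - 1)\<^esub> dif Y n (p2 u)))\<rparr>"

lemma cone_simps:
  "obj cone n = sum_module (obj V n) (obj Y n)"
  "dif cone n (e x y) = e (dif V n x) (f n x \<oplus>\<^bsub>obj Y (n - 1)\<^esub> dif Y n y)"
  by (simp_all add: cone_def)

sublocale V: module R "obj V n" for n by (rule chain_complexD[OF cV])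
sublocale Y: module R "obj Y n" for n by (rule chain_complexD[OF cY])

lemma dif_cone: "dif cone n \<in> lin_maps R (obj cone n) (obj cone (n - 1))"
  using lin_mapsD[OF f[of n]] lin_mapsD[OF chain_complexD(2)[OF cV, of n]] lin_mapsD[OF chain_complexD(2)[OF cY, of n]]
  by (intro lin_mapsI) (auto simp: sum_module_simps cone_simps Y.M.a_ac Y.smult_r_distr)

lemma chain_complex_cone: "chain_complex R cone"
  unfolding chain_complex_def
proof (intro conjI allI ballI)
  show "module R (obj cone n)" for n
    unfolding cone_simps by (rule module_sum_module[OF V.module_axioms Y.module_axioms])
  show "dif cone n \<in> lin_maps R (obj cone n) (obj cone (n - 1))" for n by (rule dif_cone)
  fix n u assume "u \<in> carrier (obj cone n)"
  then obtain x y where u: "u = e x y" and x: "x \<in> carrier (obj V n)" and y: "y \<in> carrier (obj Y n)"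
    by (auto simp: sum_module_simps cone_simps)
  have fx: "f n x \<in> carrier (obj Y (n - 1))" and dy: "dif Y n y \<in> carrier (obj Y (n - 1))"
    and fdx: "f (n - 1) (dif V n x) \<in> carrier (obj Y (n - 1 - 1))"
    and dfx: "dif Y (n - 1) (f n x) \<in> carrier (obj Y (n - 1 - 1))"
    using x y lin_mapsD(1)[OF f] lin_mapsD(1)[OF chain_complexD(2)[OF cV]] lin_mapsD(1)[OF chain_complexD(2)[OF cY]] by blast+
  then show "dif cone (n - 1) (dif cone n u) = \<zero>\<^bsub>obj cone (n - 1 - 1)\<^esub>"
    using chain_complexD(4)[OF cV x] chain_complexD(4)[OF cY y] anti[OF x]
      lin_mapsD(2)[OF chain_complexD(2)[OF cY] fx dy]
    by (simp add: u cone_simps sum_module_simps)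
qed

text \<open>The inclusion of \<open>Y\<close> and the projection to \<open>V\<close> are chain maps;
  the section of the projection fails to be one by exactly \<open>f\<close>.\<close>

sublocale split_ext R V Y cone "\<lambda>n. e \<zero>\<^bsub>obj V n\<^esub>" "\<lambda>_. p1" "\<lambda>n x. e x \<zero>\<^bsub>obj Y n\<^esub>" "\<lambda>_. p2"
proof
  note zV = lin_maps_zero[OF chain_complexD(1)[OF cV] chain_complexD(1)[OF cV] chain_complexD(2)[OF cV]]
  note zf = lin_maps_zero[OF chain_complexD(1)[OF cV] chain_complexD(1)[OF cY] f]
  show "dif cone n (e \<zero>\<^bsub>obj V n\<^esub> y) = e \<zero>\<^bsub>obj V (n - 1)\<^esub> (dif Y n y)" if "y \<in> carrier (obj Y n)" for y n
    using that lin_mapsD(1)[OF chain_complexD(2)[OF cY]] by (simp add: cone_simps zV zf)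
qed (auto intro!: cV cY chain_complex_cone lin_mapsI simp: cone_simps sum_module_simps)

lemma mem_cycles_cone_iff:
  "e x y \<in> cycles cone n \<longleftrightarrow> x \<in> cycles V n \<and> y \<in> carrier (obj Y n) \<and>
     f n x \<oplus>\<^bsub>obj Y (n - 1)\<^esub> dif Y n y = \<zero>\<^bsub>obj Y (n - 1)\<^esub>"
  by (auto simp: mem_cycles_iff cone_simps sum_module_simps)

lemma mem_boundaries_cone_iff:
  "e x y \<in> boundaries cone n \<longleftrightarrow>
     (\<exists>x'\<in>carrier (obj V (n + 1)). \<exists>y'\<in>carrier (obj Y (n + 1)).
        x = dif V (n + 1) x' \<and> y = f (n + 1) x' \<oplus>\<^bsub>obj Y n\<^esub> dif Y (n + 1) y')"
proof -
  have "(\<exists>u\<in>carrier (obj cone (n + 1)). Q u) \<longleftrightarrow>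
    (\<exists>x'\<in>carrier (obj V (n + 1)). \<exists>y'\<in>carrier (obj Y (n + 1)). Q (e x' y'))" for Q
    by (simp add: cone_simps(1) sum_module_simps(1) Bex_def) blast
  then show ?thesis by (simp add: mem_boundaries_iff cone_simps(2))
qed

end

section \<open>Tensoring and dualizing complexes\<close>

text \<open>The map f \<otimes> id_N. The differentials of \<open>tensor_cplx\<close> have this
  form, so identities between linear maps pass to the tensored complexes by functoriality.\<close>

definition tensor_fun ::
    "'r ring \<Rightarrow> ('r, 'c) module \<Rightarrow> ('r, 'b) module \<Rightarrow> ('a \<Rightarrow> 'c) \<Rightarrow> ('a \<times> 'b \<Rightarrow> 'r) set \<Rightarrow> ('c \<times> 'b \<Rightarrow> 'r) set" where
  "tensor_fun R A' N f = tensor_lift R (tensor R A' N) (\<lambda>x y. pure_tensor R A' N (f x) y)"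

lemma pure_tensor_add:
  assumes "module R A" "module R N" "x \<in> carrier A" "x' \<in> carrier A" "y \<in> carrier N"
  shows "pure_tensor R A N (x \<oplus>\<^bsub>A\<^esub> x') y = pure_tensor R A N x y \<oplus>\<^bsub>tensor R A N\<^esub> pure_tensor R A N x' y"
  using pure_tensor_bilinear[OF assms(1,2)] lin_mapsD(2)[of "\<lambda>x. pure_tensor R A N x y" R A "tensor R A N" x x'] assms(3-)
  by (auto simp: bilinear_map_def)

lemma pure_tensor_zero:
  assumes "module R A" "module R N" "y \<in> carrier N"
  shows "pure_tensor R A N \<zero>\<^bsub>A\<^esub> y = \<zero>\<^bsub>tensor R A N\<^esub>"
  using pure_tensor_bilinear[OF assms(1,2)] assms(3)
    lin_maps_zero[OF assms(1) module_tensor[OF assms(1,2)], of "\<lambda>x. pure_tensor R A N x y"]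
  by (auto simp: bilinear_map_def)

context
  fixes R :: "'r ring" and N :: "('r, 'n) module" and A :: "('r, 'a) module" and A' :: "('r, 'b) module"
  assumes N: "module R N" and A: "module R A" and A': "module R A'"
begin

lemma tensor_fun_lin_maps: "f \<in> lin_maps R A A' \<Longrightarrow> tensor_fun R A' N f \<in> lin_maps R (tensor R A N) (tensor R A' N)"
  and tensor_fun_pure: "f \<in> lin_maps R A A' \<Longrightarrow> x \<in> carrier A \<Longrightarrow> y \<in> carrier N \<Longrightarrow>
      tensor_fun R A' N f (pure_tensor R A N x y) = pure_tensor R A' N (f x) y"
  unfolding tensor_fun_def using tensor_map[OF A A' N] by blast+

text \<open>Here and in \<open>tensor_fun_comp\<close> a separate \<open>h\<close> agrees with the
  sum or composite on the carrier only: that is where the homotopy and splitting identities are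
  available.\<close>

lemma tensor_fun_add:
  assumes f: "f \<in> lin_maps R A A'" and g: "g \<in> lin_maps R A A'" and h: "h \<in> lin_maps R A A'"
    and eq: "\<And>x. x \<in> carrier A \<Longrightarrow> h x = f x \<oplus>\<^bsub>A'\<^esub> g x" and t: "t \<in> carrier (tensor R A N)"
  shows "tensor_fun R A' N h t = tensor_fun R A' N f t \<oplus>\<^bsub>tensor R A' N\<^esub> tensor_fun R A' N g t"
  by (rule lin_maps_tensor_eqI[OF A N module_tensor[OF A' N] tensor_fun_lin_maps[OF h]
        lin_maps_add[OF module_tensor[OF A' N] tensor_fun_lin_maps[OF f] tensor_fun_lin_maps[OF g]] _ t])
     (simp add: tensor_fun_pure[OF f] tensor_fun_pure[OF g] tensor_fun_pure[OF h] eq pure_tensor_add[OF A' N]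
        lin_mapsD(1)[OF f] lin_mapsD(1)[OF g])

lemma tensor_fun_zero:
  assumes f: "f \<in> lin_maps R A A'" and eq: "\<And>x. x \<in> carrier A \<Longrightarrow> f x = \<zero>\<^bsub>A'\<^esub>"
    and t: "t \<in> carrier (tensor R A N)"
  shows "tensor_fun R A' N f t = \<zero>\<^bsub>tensor R A' N\<^esub>"
  by (rule lin_maps_tensor_eqI[OF A N module_tensor[OF A' N] tensor_fun_lin_maps[OF f]
        lin_maps_const_zero[OF module_tensor[OF A' N]] _ t])
     (simp add: tensor_fun_pure[OF f] eq pure_tensor_zero[OF A' N])

end

lemma tensor_fun_id:
  assumes N: "module R N" and A: "module R A" and f: "f \<in> lin_maps R A A"
    and eq: "\<And>x. x \<in> carrier A \<Longrightarrow> f x = x" and t: "t \<in> carrier (tensor R A N)"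
  shows "tensor_fun R A N f t = t"
  by (rule lin_maps_tensor_eqI[OF A N module_tensor[OF A N] tensor_fun_lin_maps[OF N A A f] lin_mapsI _ t])
     (simp_all add: tensor_fun_pure[OF N A A f] eq)

lemma tensor_fun_comp:
  assumes N: "module R N" and A: "module R A" and A': "module R A'" and A'': "module R A''"
    and f: "f \<in> lin_maps R A A'" and g: "g \<in> lin_maps R A' A''" and h: "h \<in> lin_maps R A A''"
    and eq: "\<And>x. x \<in> carrier A \<Longrightarrow> g (f x) = h x" and t: "t \<in> carrier (tensor R A N)"
  shows "tensor_fun R A'' N g (tensor_fun R A' N f t) = tensor_fun R A'' N h t"
  by (rule lin_maps_tensor_eqI[OF A N module_tensor[OF A'' N]
        lin_maps_comp[OF tensor_fun_lin_maps[OF N A A' f] tensor_fun_lin_maps[OF N A' A'' g]]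
        tensor_fun_lin_maps[OF N A A'' h] _ t])
     (simp add: tensor_fun_pure[OF N A A' f] tensor_fun_pure[OF N A' A'' g] tensor_fun_pure[OF N A A'' h]
        eq lin_mapsD(1)[OF f])

lemma tensor_cplx_simps:
  "obj (tensor_cplx R C N) n = tensor R (obj C n) N"
  "dif (tensor_cplx R C N) n = tensor_fun R (obj C (n - 1)) N (dif C n)"
  by (simp_all add: tensor_cplx_def tensor_fun_def)

lemma hom_cplx_simps:
  "obj (hom_cplx R C N) n = hom_module R (obj C (- n)) N"
  "dif (hom_cplx R C N) n f = (\<lambda>x\<in>carrier (obj C (1 - n)). f (dif C (1 - n) x))"
  by (simp_all add: hom_cplx_def)

text \<open>Tensoring ds + sd = id with N exhibits each cycle t as the boundary of (s \<otimes>
  id)(t). For arbitrary N exactness of Y alone would not carry over.\<close>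

lemma tensor_cplx_exact:
  assumes N: "module R N" and Y: "chain_complex R Y" and proj: "\<And>n. projective R (obj Y n)"
    and bdd: "bounded_below_cplx Y" and ex: "\<And>n. exact_at Y n"
  shows "exact_at (tensor_cplx R Y N) n"
  unfolding exact_at_def
proof
  note c = chain_complexD[OF Y] and tf = tensor_fun_lin_maps[OF N chain_complexD(1)[OF Y] chain_complexD(1)[OF Y]]
  obtain s where s: "\<And>n. s n \<in> lin_maps R (obj Y n) (obj Y (n + 1))"
    "\<And>n x. x \<in> carrier (obj Y n) \<Longrightarrow> dif Y (n + 1) (s n x) \<oplus>\<^bsub>obj Y n\<^esub> s (n - 1) (dif Y n x) = x"
    using acyclic_contraction[OF Y proj bdd ex] by blast
  have s': "s (n - 1) \<in> lin_maps R (obj Y (n - 1)) (obj Y n)" for n using s(1)[of "n - 1"] by simp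
  fix t assume "t \<in> cycles (tensor_cplx R Y N) n"
  then have t: "t \<in> carrier (tensor R (obj Y n) N)"
    "tensor_fun R (obj Y (n - 1)) N (dif Y n) t = \<zero>\<^bsub>tensor R (obj Y (n - 1)) N\<^esub>"
    by (auto simp: mem_cycles_iff tensor_cplx_simps)
  let ?T = "tensor R (obj Y n) N"
  interpret T: module R ?T by (rule module_tensor[OF c(1) N])
  let ?u = "tensor_fun R (obj Y (n + 1)) N (s n) t"
  have u: "?u \<in> carrier (tensor R (obj Y (n + 1)) N)" by (rule lin_mapsD(1)[OF tf[OF s(1)] t(1)])
  have id: "(\<lambda>x. x) \<in> lin_maps R (obj Y n) (obj Y n)" by (rule lin_maps_id)
  have "t = tensor_fun R (obj Y n) N (\<lambda>x. x) t"
    by (simp add: tensor_fun_id[OF N c(1) id _ t(1)])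
  also have "\<dots> = tensor_fun R (obj Y n) N (\<lambda>x. dif Y (n + 1) (s n x)) t \<oplus>\<^bsub>?T\<^esub>
      tensor_fun R (obj Y n) N (\<lambda>x. s (n - 1) (dif Y n x)) t"
    by (rule tensor_fun_add[OF N c(1) c(1) lin_maps_comp[OF s(1) c(3)] lin_maps_comp[OF c(2) s'] id _ t(1)])
       (simp add: s(2))
  also have "tensor_fun R (obj Y n) N (\<lambda>x. dif Y (n + 1) (s n x)) t = tensor_fun R (obj Y n) N (dif Y (n + 1)) ?u"
    by (rule tensor_fun_comp[OF N c(1) c(1) c(1) s(1) c(3) lin_maps_comp[OF s(1) c(3)] _ t(1), symmetric]) simp
  also have "tensor_fun R (obj Y n) N (\<lambda>x. s (n - 1) (dif Y n x)) t =
      tensor_fun R (obj Y n) N (s (n - 1)) (tensor_fun R (obj Y (n - 1)) N (dif Y n) t)"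
    by (rule tensor_fun_comp[OF N c(1) c(1) c(1) c(2) s' lin_maps_comp[OF c(2) s'] _ t(1), symmetric]) simp
  also have "\<dots> = \<zero>\<^bsub>?T\<^esub>"
    using t(2) lin_maps_zero[OF module_tensor[OF c(1) N] module_tensor[OF c(1) N] tf[OF s'[of n]]] by simp
  finally have "t = tensor_fun R (obj Y n) N (dif Y (n + 1)) ?u"
    using lin_mapsD(1)[OF tf[OF c(3)] u] by simp
  then show "t \<in> boundaries (tensor_cplx R Y N) n"
    using u by (auto simp: mem_boundaries_iff tensor_cplx_simps)
qed

lemma hom_cplx_exact:
  assumes N: "module R N" and Y: "chain_complex R Y" and proj: "\<And>n. projective R (obj Y n)"
    and bdd: "bounded_below_cplx Y" and ex: "\<And>n. exact_at Y n"
  shows "exact_at (hom_cplx R Y N) n"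
  unfolding exact_at_def
proof
  note c = chain_complexD[OF Y]
  interpret N: module R N by (rule N)
  obtain s where s: "\<And>n. s n \<in> lin_maps R (obj Y n) (obj Y (n + 1))"
    "\<And>n x. x \<in> carrier (obj Y n) \<Longrightarrow> dif Y (n + 1) (s n x) \<oplus>\<^bsub>obj Y n\<^esub> s (n - 1) (dif Y n x) = x"
    using acyclic_contraction[OF Y proj bdd ex] by blast
  have s': "s (- n - 1) \<in> lin_maps R (obj Y (- n - 1)) (obj Y (- n))" using s(1)[of "- n - 1"] by simp
  have c3: "dif Y (1 - n) \<in> lin_maps R (obj Y (1 - n)) (obj Y (- n))" using c(3)[of "- n"] by (simp add: add.commute)
  have c2: "dif Y (- n) \<in> lin_maps R (obj Y (- n)) (obj Y (- n - 1))" using c(2)[of "- n"] by simp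
  fix f assume "f \<in> cycles (hom_cplx R Y N) n"
  then have f: "f \<in> lin_maps R (obj Y (- n)) N" "f \<in> extensional (carrier (obj Y (- n)))"
    and fe: "(\<lambda>x\<in>carrier (obj Y (1 - n)). f (dif Y (1 - n) x)) = (\<lambda>x\<in>carrier (obj Y (1 - n)). \<zero>\<^bsub>N\<^esub>)"
    by (auto simp: mem_cycles_iff hom_cplx_simps hom_module_simps)
  have fd: "f (dif Y (1 - n) x) = \<zero>\<^bsub>N\<^esub>" if "x \<in> carrier (obj Y (1 - n))" for x
    using fun_cong[OF fe, of x] that by simp
  \<comment> \<open>Since f d = 0 for a cycle f, one has f = f(ds + sd) = (f s)d. Restricting to the
    carrier makes \<open>g\<close> extensional, as elements of \<open>hom_module\<close> have to
    be.\<close>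
  define g where "g = (\<lambda>x\<in>carrier (obj Y (- n - 1)). f (s (- n - 1) x))"
  have g: "g \<in> carrier (obj (hom_cplx R Y N) (n + 1))"
  proof -
    interpret Y: module R "obj Y (- n - 1)" by (rule c)
    have e: "- (n + 1) = - n - 1" by simp
    show ?thesis
      unfolding hom_cplx_simps hom_module_simps g_def e
      using lin_mapsD[OF lin_maps_comp[OF s' f(1)]] by (auto intro!: lin_mapsI)
  qed
  have "f x = g (dif Y (- n) x)" if x: "x \<in> carrier (obj Y (- n))" for x
  proof -
    note dx = lin_mapsD(1)[OF c2 x]
    have sx: "s (- n) x \<in> carrier (obj Y (1 - n))" using lin_mapsD(1)[OF s(1) x] by (simp add: add.commute)
    have "x = dif Y (1 - n) (s (- n) x) \<oplus>\<^bsub>obj Y (- n)\<^esub> s (- n - 1) (dif Y (- n) x)"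
      using s(2)[OF x] by (simp add: add.commute)
    then have "f x = f (dif Y (1 - n) (s (- n) x)) \<oplus>\<^bsub>N\<^esub> f (s (- n - 1) (dif Y (- n) x))"
      using lin_mapsD(2)[OF f(1) lin_mapsD(1)[OF c3 sx] lin_mapsD(1)[OF s' dx]] by simp
    then show ?thesis
      using fd[OF sx] dx lin_mapsD(1)[OF f(1) lin_mapsD(1)[OF s' dx]] by (simp add: g_def)
  qed
  then have "f = (\<lambda>x\<in>carrier (obj Y (- n)). g (dif Y (- n) x))"
    using f(2) by (auto simp: extensional_def fun_eq_iff)
  then have "f = dif (hom_cplx R Y N) (n + 1) g" by (simp add: hom_cplx_simps)
  then show "f \<in> boundaries (hom_cplx R Y N) n" using g unfolding mem_boundaries_iff by blast
qed

lemma hom_module_pullback: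
  assumes N: "module R N" and A: "module R A" and f: "f \<in> lin_maps R A B"
  shows "(\<lambda>h. \<lambda>x\<in>carrier A. h (f x)) \<in> lin_maps R (hom_module R B N) (hom_module R A N)"
proof (rule lin_mapsI)
  interpret A: module R A by (rule A)
  fix h assume h: "h \<in> carrier (hom_module R B N)"
  then have hl: "h \<in> lin_maps R B N" by (simp add: hom_module_simps)
  show "(\<lambda>x\<in>carrier A. h (f x)) \<in> carrier (hom_module R A N)"
    using lin_mapsD[OF lin_maps_comp[OF f hl]] by (auto simp: hom_module_simps intro!: lin_mapsI)
  show "(\<lambda>x\<in>carrier A. (h \<oplus>\<^bsub>hom_module R B N\<^esub> k) (f x)) =
      (\<lambda>x\<in>carrier A. h (f x)) \<oplus>\<^bsub>hom_module R A N\<^esub> (\<lambda>x\<in>carrier A. k (f x))" for k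
    using lin_mapsD(1)[OF f] by (auto simp: hom_module_simps fun_eq_iff)
  show "(\<lambda>x\<in>carrier A. (r \<odot>\<^bsub>hom_module R B N\<^esub> h) (f x)) = r \<odot>\<^bsub>hom_module R A N\<^esub> (\<lambda>x\<in>carrier A. h (f x))" for r
    using lin_mapsD(1)[OF f] by (auto simp: hom_module_simps fun_eq_iff)
qed

section \<open>Split extensions after tensoring and dualizing\<close>

context split_ext begin

lemmas mV = chain_complexD(1)[OF cV] and mY = chain_complexD(1)[OF cY] and mW = chain_complexD(1)[OF cW]

text \<open>As N is arbitrary, exactness has to come from the splitting: \<open>ret\<close> gives
  injectivity, \<open>sec\<close> surjectivity, and the tensored identity inc ret + sec prj = id
  identifies the kernel.\<close>

lemma tensor_ses:
  assumes N: "module R N"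
  shows "complex_ses R (tensor_cplx R Y N) (tensor_cplx R W N) (tensor_cplx R V N)
    (\<lambda>n. tensor_fun R (obj W n) N (inc n)) (\<lambda>n. tensor_fun R (obj V n) N (prj n))"
proof
  note tV = module_tensor[OF mV N] and tY = module_tensor[OF mY N] and tW = module_tensor[OF mW N]
  note inc' = tensor_fun_lin_maps[OF N mY mW inc] and prj' = tensor_fun_lin_maps[OF N mW mV prj]
    and sec' = tensor_fun_lin_maps[OF N mV mW sec] and ret' = tensor_fun_lin_maps[OF N mW mY ret]
  have ri: "tensor_fun R (obj Y n) N (ret n) (tensor_fun R (obj W n) N (inc n) t) = t"
    if "t \<in> carrier (tensor R (obj Y n) N)" for t n
  proof -
    have id: "(\<lambda>x. x) \<in> lin_maps R (obj Y n) (obj Y n)" by (rule lin_maps_id)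
    show ?thesis
      using tensor_fun_comp[OF N mY mW mY inc ret id _ that] tensor_fun_id[OF N mY id _ that] ret_inc by simp
  qed
  have ps: "tensor_fun R (obj V n) N (prj n) (tensor_fun R (obj W n) N (sec n) t) = t"
    if "t \<in> carrier (tensor R (obj V n) N)" for t n
  proof -
    have id: "(\<lambda>x. x) \<in> lin_maps R (obj V n) (obj V n)" by (rule lin_maps_id)
    show ?thesis
      using tensor_fun_comp[OF N mV mW mV sec prj id _ that] tensor_fun_id[OF N mV id _ that] prj_sec by simp
  qed
  have dec: "tensor_fun R (obj W n) N (inc n) (tensor_fun R (obj Y n) N (ret n) t) \<oplus>\<^bsub>tensor R (obj W n) N\<^esub>
      tensor_fun R (obj W n) N (sec n) (tensor_fun R (obj V n) N (prj n) t) = t"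
    if t: "t \<in> carrier (tensor R (obj W n) N)" for t n
  proof -
    have id: "(\<lambda>x. x) \<in> lin_maps R (obj W n) (obj W n)" by (rule lin_maps_id)
    note ir = lin_maps_comp[OF ret inc, of n] and sp = lin_maps_comp[OF prj sec, of n]
    show ?thesis
      using tensor_fun_comp[OF N mW mY mW ret inc ir _ t] tensor_fun_comp[OF N mW mV mW prj sec sp _ t]
        tensor_fun_add[OF N mW mW ir sp id _ t] tensor_fun_id[OF N mW id _ t] decomp by simp
  qed
  fix n
  show "chain_complex R (tensor_cplx R Y N)" "chain_complex R (tensor_cplx R W N)" "chain_complex R (tensor_cplx R V N)"
    by (simp_all add: chain_complex_tensor[OF _ N] cV cY cW)
  show "tensor_fun R (obj W n) N (inc n) \<in> lin_maps R (obj (tensor_cplx R Y N) n) (obj (tensor_cplx R W N) n)"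
    "tensor_fun R (obj V n) N (prj n) \<in> lin_maps R (obj (tensor_cplx R W N) n) (obj (tensor_cplx R V N) n)"
    unfolding tensor_cplx_simps by (fact inc' prj')+
  fix t
  { assume "t \<in> carrier (obj (tensor_cplx R Y N) n)"
    then have t: "t \<in> carrier (tensor R (obj Y n) N)" by (simp add: tensor_cplx_simps)
    note di = lin_maps_comp[OF inc chain_complexD(2)[OF cW], of n]
    show "dif (tensor_cplx R W N) n (tensor_fun R (obj W n) N (inc n) t) =
        tensor_fun R (obj W (n - 1)) N (inc (n - 1)) (dif (tensor_cplx R Y N) n t)"
      using tensor_fun_comp[OF N mY mW mW inc chain_complexD(2)[OF cW] di _ t]
        tensor_fun_comp[OF N mY mY mW chain_complexD(2)[OF cY] inc di _ t] inc_dif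
      by (simp add: tensor_cplx_simps)
    show "t = \<zero>\<^bsub>obj (tensor_cplx R Y N) n\<^esub>"
      if "tensor_fun R (obj W n) N (inc n) t = \<zero>\<^bsub>obj (tensor_cplx R W N) n\<^esub>"
      using ri[OF t] lin_maps_zero[OF tW tY ret', of n] that by (simp add: tensor_cplx_simps)
    note pi = lin_maps_comp[OF inc prj, of n]
    show "tensor_fun R (obj V n) N (prj n) (tensor_fun R (obj W n) N (inc n) t) = \<zero>\<^bsub>obj (tensor_cplx R V N) n\<^esub>"
      using tensor_fun_comp[OF N mY mW mV inc prj pi _ t] tensor_fun_zero[OF N mY mV pi _ t] prj_inc
      by (simp add: tensor_cplx_simps)
  }
  { assume "t \<in> carrier (obj (tensor_cplx R W N) n)"
    then have t: "t \<in> carrier (tensor R (obj W n) N)" by (simp add: tensor_cplx_simps)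
    note dp = lin_maps_comp[OF prj chain_complexD(2)[OF cV], of n]
    show "dif (tensor_cplx R V N) n (tensor_fun R (obj V n) N (prj n) t) =
        tensor_fun R (obj V (n - 1)) N (prj (n - 1)) (dif (tensor_cplx R W N) n t)"
      using tensor_fun_comp[OF N mW mV mV prj chain_complexD(2)[OF cV] dp _ t]
        tensor_fun_comp[OF N mW mW mV chain_complexD(2)[OF cW] prj dp _ t] prj_dif
      by (simp add: tensor_cplx_simps)
    show "\<exists>s\<in>carrier (obj (tensor_cplx R Y N) n). tensor_fun R (obj W n) N (inc n) s = t"
      if "tensor_fun R (obj V n) N (prj n) t = \<zero>\<^bsub>obj (tensor_cplx R V N) n\<^esub>"
    proof (rule bexI)
      interpret W: module R "tensor R (obj W n) N" by (rule tW)
      show "tensor_fun R (obj Y n) N (ret n) t \<in> carrier (obj (tensor_cplx R Y N) n)"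
        using lin_mapsD(1)[OF ret' t] by (simp add: tensor_cplx_simps)
      show "tensor_fun R (obj W n) N (inc n) (tensor_fun R (obj Y n) N (ret n) t) = t"
        using dec[OF t] that lin_maps_zero[OF tV tW sec', of n] lin_mapsD(1)[OF inc' lin_mapsD(1)[OF ret' t]]
        by (simp add: tensor_cplx_simps)
    qed
  }
  { assume "t \<in> carrier (obj (tensor_cplx R V N) n)"
    then have t: "t \<in> carrier (tensor R (obj V n) N)" by (simp add: tensor_cplx_simps)
    show "\<exists>u\<in>carrier (obj (tensor_cplx R W N) n). tensor_fun R (obj V n) N (prj n) u = t"
      using ps[OF t] lin_mapsD(1)[OF sec' t] by (auto simp: tensor_cplx_simps)
  }
qed

text \<open>Contravariance puts V on the left. A map on W that vanishes on the image of
  \<open>inc\<close> factors through \<open>prj\<close> with factor h sec, and a map on Y extends to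
  W by composition with \<open>ret\<close>.\<close>

lemma hom_ses:
  assumes N: "module R N"
  shows "complex_ses R (hom_cplx R V N) (hom_cplx R W N) (hom_cplx R Y N)
    (\<lambda>n h. \<lambda>w\<in>carrier (obj W (- n)). h (prj (- n) w)) (\<lambda>n h. \<lambda>y\<in>carrier (obj Y (- n)). h (inc (- n) y))"
proof
  interpret N: module R N by (rule N)
  interpret V: module R "obj V n" for n by (rule mV)
  interpret Y: module R "obj Y n" for n by (rule mY)
  interpret W: module R "obj W n" for n by (rule mW)
  fix n :: int
  have neg: "- (n - 1) = 1 - n" "- n = 1 - n - 1" by simp_all
  have d: "dif V (1 - n) \<in> lin_maps R (obj V (1 - n)) (obj V (- n))"
    "dif Y (1 - n) \<in> lin_maps R (obj Y (1 - n)) (obj Y (- n))"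
    "dif W (1 - n) \<in> lin_maps R (obj W (1 - n)) (obj W (- n))"
    using chain_complexD(2)[OF cV, of "1 - n"] chain_complexD(2)[OF cY, of "1 - n"] chain_complexD(2)[OF cW, of "1 - n"]
    by simp_all
  show "chain_complex R (hom_cplx R Y N)" "chain_complex R (hom_cplx R W N)" "chain_complex R (hom_cplx R V N)"
    by (simp_all add: chain_complex_hom[OF _ N] cV cY cW)
  show "(\<lambda>h. \<lambda>w\<in>carrier (obj W (- n)). h (prj (- n) w)) \<in> lin_maps R (obj (hom_cplx R V N) n) (obj (hom_cplx R W N) n)"
    "(\<lambda>h. \<lambda>y\<in>carrier (obj Y (- n)). h (inc (- n) y)) \<in> lin_maps R (obj (hom_cplx R W N) n) (obj (hom_cplx R Y N) n)"
    unfolding hom_cplx_simps by (rule hom_module_pullback[OF N mW prj] hom_module_pullback[OF N mY inc])+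
  fix h
  { assume "h \<in> carrier (obj (hom_cplx R V N) n)"
    then have h: "h \<in> lin_maps R (obj V (- n)) N" "h \<in> extensional (carrier (obj V (- n)))"
      by (simp_all add: hom_cplx_simps hom_module_simps)
    show "dif (hom_cplx R W N) n (\<lambda>w\<in>carrier (obj W (- n)). h (prj (- n) w)) =
        (\<lambda>w\<in>carrier (obj W (- (n - 1))). dif (hom_cplx R V N) n h (prj (- (n - 1)) w))"
      using lin_mapsD(1)[OF d(3)] lin_mapsD(1)[OF prj] prj_dif[of _ "1 - n"]
      by (auto simp: hom_cplx_simps neg(1) fun_eq_iff)
    show "h = \<zero>\<^bsub>obj (hom_cplx R V N) n\<^esub>"
      if z: "(\<lambda>w\<in>carrier (obj W (- n)). h (prj (- n) w)) = \<zero>\<^bsub>obj (hom_cplx R W N) n\<^esub>"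
    proof -
      have "h x = \<zero>\<^bsub>N\<^esub>" if x: "x \<in> carrier (obj V (- n))" for x
        using fun_cong[OF z, of "sec (- n) x"] prj_sec[OF x] lin_mapsD(1)[OF sec x]
        by (simp add: hom_cplx_simps hom_module_simps)
      then show ?thesis using h(2) by (auto simp: hom_cplx_simps hom_module_simps fun_eq_iff extensional_def)
    qed
    show "(\<lambda>y\<in>carrier (obj Y (- n)). (\<lambda>w\<in>carrier (obj W (- n)). h (prj (- n) w)) (inc (- n) y)) =
        \<zero>\<^bsub>obj (hom_cplx R Y N) n\<^esub>"
      using lin_mapsD(1)[OF inc] prj_inc lin_maps_zero[OF mV N h(1)]
      by (auto simp: hom_cplx_simps hom_module_simps fun_eq_iff)
  }
  { assume "h \<in> carrier (obj (hom_cplx R W N) n)"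
    then have h: "h \<in> lin_maps R (obj W (- n)) N" "h \<in> extensional (carrier (obj W (- n)))"
      by (simp_all add: hom_cplx_simps hom_module_simps)
    show "dif (hom_cplx R Y N) n (\<lambda>y\<in>carrier (obj Y (- n)). h (inc (- n) y)) =
        (\<lambda>y\<in>carrier (obj Y (- (n - 1))). dif (hom_cplx R W N) n h (inc (- (n - 1)) y))"
      using lin_mapsD(1)[OF d(2)] lin_mapsD(1)[OF inc] inc_dif[of _ "1 - n"]
      by (auto simp: hom_cplx_simps neg(1) fun_eq_iff)
    show "\<exists>k\<in>carrier (obj (hom_cplx R V N) n). (\<lambda>w\<in>carrier (obj W (- n)). k (prj (- n) w)) = h"
      if z: "(\<lambda>y\<in>carrier (obj Y (- n)). h (inc (- n) y)) = \<zero>\<^bsub>obj (hom_cplx R Y N) n\<^esub>"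
    proof (rule bexI)
      show "(\<lambda>x\<in>carrier (obj V (- n)). h (sec (- n) x)) \<in> carrier (obj (hom_cplx R V N) n)"
        using lin_mapsD(1)[OF hom_module_pullback[OF N mV sec], of h] h by (simp add: hom_cplx_simps hom_module_simps)
      have hi: "h (inc (- n) y) = \<zero>\<^bsub>N\<^esub>" if y: "y \<in> carrier (obj Y (- n))" for y
        using fun_cong[OF z, of y] y by (simp add: hom_cplx_simps hom_module_simps)
      have "h (sec (- n) (prj (- n) w)) = h w" if w: "w \<in> carrier (obj W (- n))" for w
      proof -
        note rw = lin_mapsD(1)[OF ret w] and sw = lin_mapsD(1)[OF sec lin_mapsD(1)[OF prj w]]
        have "h w = h (inc (- n) (ret (- n) w)) \<oplus>\<^bsub>N\<^esub> h (sec (- n) (prj (- n) w))"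
          using lin_mapsD(2)[OF h(1) lin_mapsD(1)[OF inc rw] sw] decomp[OF w] by simp
        then show ?thesis using hi[OF rw] lin_mapsD(1)[OF h(1) sw] by simp
      qed
      then show "(\<lambda>w\<in>carrier (obj W (- n)). (\<lambda>x\<in>carrier (obj V (- n)). h (sec (- n) x)) (prj (- n) w)) = h"
        using h(2) lin_mapsD(1)[OF prj] by (auto simp: fun_eq_iff extensional_def)
    qed
  }
  { assume "h \<in> carrier (obj (hom_cplx R Y N) n)"
    then have h: "h \<in> lin_maps R (obj Y (- n)) N" "h \<in> extensional (carrier (obj Y (- n)))"
      by (simp_all add: hom_cplx_simps hom_module_simps)
    show "\<exists>k\<in>carrier (obj (hom_cplx R W N) n). (\<lambda>y\<in>carrier (obj Y (- n)). k (inc (- n) y)) = h"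
    proof (rule bexI)
      show "(\<lambda>w\<in>carrier (obj W (- n)). h (ret (- n) w)) \<in> carrier (obj (hom_cplx R W N) n)"
        using lin_mapsD(1)[OF hom_module_pullback[OF N mW ret], of h] h by (simp add: hom_cplx_simps hom_module_simps)
      show "(\<lambda>y\<in>carrier (obj Y (- n)). (\<lambda>w\<in>carrier (obj W (- n)). h (ret (- n) w)) (inc (- n) y)) = h"
        using h(2) lin_mapsD(1)[OF inc] ret_inc by (auto simp: fun_eq_iff extensional_def)
    qed
  }
qed

end

section \<open>Killing homology\<close>

lemma direct_power_simps:
  "carrier (direct_power A n) = {..<n} \<rightarrow>\<^sub>E carrier A"
  "\<zero>\<^bsub>direct_power A n\<^esub> = (\<lambda>j\<in>{..<n}. \<zero>\<^bsub>A\<^esub>)"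
  "x \<oplus>\<^bsub>direct_power A n\<^esub> y = (\<lambda>j\<in>{..<n}. x j \<oplus>\<^bsub>A\<^esub> y j)"
  "r \<odot>\<^bsub>direct_power A n\<^esub> x = (\<lambda>j\<in>{..<n}. r \<odot>\<^bsub>A\<^esub> x j)"
  by (simp_all add: direct_power_def)

lemma module_direct_power:
  assumes "module R A" shows "module R (direct_power A n)"
proof -
  interpret A: module R A by fact
  show ?thesis
  proof (rule moduleI)
    show "cring R" by (rule module_cring[OF assms])
    show "abelian_group (direct_power A n)"
    proof (rule abelian_groupI)
      fix x assume x: "x \<in> carrier (direct_power A n)"
      then have xj: "x j \<in> carrier A" if "j < n" for j using that by (auto simp: direct_power_simps)
      show "\<exists>y\<in>carrier (direct_power A n). y \<oplus>\<^bsub>direct_power A n\<^esub> x = \<zero>\<^bsub>direct_power A n\<^esub>"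
      proof (rule bexI)
        show "(\<lambda>j\<in>{..<n}. \<ominus>\<^bsub>A\<^esub> x j) \<oplus>\<^bsub>direct_power A n\<^esub> x = \<zero>\<^bsub>direct_power A n\<^esub>"
          unfolding direct_power_simps by (rule restrict_ext) (simp add: A.M.l_neg xj)
        show "(\<lambda>j\<in>{..<n}. \<ominus>\<^bsub>A\<^esub> x j) \<in> carrier (direct_power A n)"
          unfolding direct_power_simps restrict_PiE_iff using xj by simp
      qed
    qed (auto simp: direct_power_simps fun_eq_iff PiE_iff extensional_def A.M.a_ac)
  qed (auto simp: direct_power_simps fun_eq_iff PiE_iff extensional_def A.smult_l_distr A.smult_r_distr A.smult_assoc1)
qed

text \<open>The isomorphism of H_q(C) with M^k, presented as an epimorphism \<theta> on the cycles
  whose kernel is the boundaries. In this form the presentation for a cone is obtained by composing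
  with \<open>p2\<close> and, where needed, dropping a coordinate, without handling cosets.\<close>

definition homology_power :: "'r ring \<Rightarrow> ('r, 'm) module \<Rightarrow> ('r, 'x) cplx \<Rightarrow> int \<Rightarrow> nat \<Rightarrow> bool" where
  "homology_power R M C q k \<longleftrightarrow>
     (\<exists>\<theta>\<in>lin_maps R ((obj C q)\<lparr>carrier := cycles C q\<rparr>) (direct_power M k).
        \<theta> ` cycles C q = carrier (direct_power M k) \<and>
        (\<forall>z\<in>cycles C q. \<theta> z = \<zero>\<^bsub>direct_power M k\<^esub> \<longleftrightarrow> z \<in> boundaries C q))"

lemma homology_power_0:
  assumes C: "chain_complex R C" shows "homology_power R M C q 0 \<longleftrightarrow> exact_at C q"
proof
  let ?Z = "(obj C q)\<lparr>carrier := cycles C q\<rparr>"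
  have zero: "\<theta> z = \<zero>\<^bsub>direct_power M 0\<^esub>"
    if "\<theta> \<in> lin_maps R ?Z (direct_power M 0)" "z \<in> cycles C q" for \<theta> z
    using lin_mapsD(1)[OF that(1), of z] that(2) by (simp add: direct_power_simps restrict_def)
  show "exact_at C q" if "homology_power R M C q 0"
    using that zero unfolding homology_power_def exact_at_def by blast
  interpret Z: module R ?Z by (rule module_cycles[OF C])
  \<comment> \<open>\<open>{..<0} \<rightarrow>\<^sub>E carrier M\<close> has exactly one element,
    the function that is \<open>undefined\<close> everywhere.\<close>
  have "(\<lambda>_ _. undefined) \<in> lin_maps R ?Z (direct_power M 0)"
    by (rule lin_mapsI) (simp_all add: direct_power_simps restrict_def)
  moreover have "(\<lambda>_ _. undefined) ` cycles C q = carrier (direct_power M 0)"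
    using Z.M.zero_closed by (auto simp: direct_power_simps)
  ultimately show "homology_power R M C q 0" if "exact_at C q"
    using that zero unfolding homology_power_def exact_at_def by blast
qed

lemma homology_power_iso:
  assumes C: "chain_complex R C" and iso: "module_iso R (homology C q) (direct_power M k)" and M: "module R M"
  shows "homology_power R M C q k"
proof -
  let ?Z = "(obj C q)\<lparr>carrier := cycles C q\<rparr>" and ?B = "boundaries C q" and ?H = "homology C q"
  note Z = module_cycles[OF C, of q] and B = submodule_boundaries_cycles[OF C, of q]
  note r = quot_module_rules[OF Z B, folded homology_def]
  interpret Z: module R ?Z by (rule Z)
  interpret B: abelian_subgroup ?B ?Z by (rule Z.submodule_abelian_subgroup[OF B])
  obtain f where f: "f \<in> lin_maps R ?H (direct_power M k)" "bij_betw f (carrier ?H) (carrier (direct_power M k))"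
    using iso by (auto simp: module_iso_def)
  define \<theta> where "\<theta> z = f (?B +>\<^bsub>?Z\<^esub> z)" for z
  have zero: "\<zero>\<^bsub>?H\<^esub> = ?B +>\<^bsub>?Z\<^esub> \<zero>\<^bsub>?Z\<^esub>"
    by (simp only: homology_def quot_module_simps Z.M.a_coset_add_zero[OF B.a_subset])
  have fz: "f \<zero>\<^bsub>?H\<^esub> = \<zero>\<^bsub>direct_power M k\<^esub>"
    by (rule lin_maps_zero[OF module_homology[OF C] module_direct_power[OF M] f(1)])
  have "\<theta> \<in> lin_maps R ?Z (direct_power M k)"
    unfolding \<theta>_def
  proof (rule lin_mapsI)
    fix x assume x: "x \<in> carrier ?Z"
    show "f (?B +>\<^bsub>?Z\<^esub> x) \<in> carrier (direct_power M k)" using lin_mapsD(1)[OF f(1) r(3)[OF x]] .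
    show "f (?B +>\<^bsub>?Z\<^esub> (s \<odot>\<^bsub>?Z\<^esub> x)) = s \<odot>\<^bsub>direct_power M k\<^esub> f (?B +>\<^bsub>?Z\<^esub> x)" if "s \<in> carrier R" for s
      using lin_mapsD(3)[OF f(1) that r(3)[OF x]] r(2)[OF that x] by simp
    show "f (?B +>\<^bsub>?Z\<^esub> (x \<oplus>\<^bsub>?Z\<^esub> y)) = f (?B +>\<^bsub>?Z\<^esub> x) \<oplus>\<^bsub>direct_power M k\<^esub> f (?B +>\<^bsub>?Z\<^esub> y)"
      if "y \<in> carrier ?Z" for y
      using lin_mapsD(2)[OF f(1) r(3)[OF x] r(3)[OF that]] r(1)[OF x that] by simp
  qed
  moreover have "\<theta> ` carrier ?Z = carrier (direct_power M k)"
  proof -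
    have "carrier ?H = (\<lambda>z. ?B +>\<^bsub>?Z\<^esub> z) ` carrier ?Z" using r(3,4) by auto
    then show ?thesis using f(2) by (auto simp: bij_betw_def \<theta>_def image_image)
  qed
  moreover have "\<theta> z = \<zero>\<^bsub>direct_power M k\<^esub> \<longleftrightarrow> z \<in> ?B" if z: "z \<in> carrier ?Z" for z
  proof -
    have "\<theta> z = \<zero>\<^bsub>direct_power M k\<^esub> \<longleftrightarrow> ?B +>\<^bsub>?Z\<^esub> z = ?B +>\<^bsub>?Z\<^esub> \<zero>\<^bsub>?Z\<^esub>"
      unfolding \<theta>_def fz[symmetric] zero
      using f(2) r(3)[OF z] r(3)[OF Z.M.zero_closed] by (auto simp: bij_betw_def inj_on_def)
    also have "\<dots> \<longleftrightarrow> z \<in> ?B"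
      using r(5)[OF z Z.M.zero_closed] module_add_minus_cancel[OF Z z Z.M.zero_closed]
        Z.M.l_zero[OF module_minus_closed[OF Z z Z.M.zero_closed]] by metis
    finally show ?thesis .
  qed
  ultimately show ?thesis unfolding homology_power_def by auto
qed

text \<open>The differential gets no sign; the cone compensates by requiring \<open>f\<close> to
  anticommute. Thus shifting commutes with tensoring by literal equality, and with
  \<open>hom_cplx\<close> up to reversing the direction of the shift.\<close>

definition shift_cplx :: "int \<Rightarrow> ('r, 'x) cplx \<Rightarrow> ('r, 'x) cplx" where
  "shift_cplx c C = \<lparr>obj = (\<lambda>n. obj C (n - c)), dif = (\<lambda>n. dif C (n - c))\<rparr>"

lemma shift_cplx_simps:
  "obj (shift_cplx c C) n = obj C (n - c)" "dif (shift_cplx c C) n = dif C (n - c)"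
  by (simp_all add: shift_cplx_def)

lemma shift_index: "n - 1 - c = n - c - (1 :: int)" "n + 1 - c = n - c + (1 :: int)" by simp_all

lemma chain_complex_shift: "chain_complex R C \<Longrightarrow> chain_complex R (shift_cplx c C)"
  unfolding chain_complex_def shift_cplx_simps by (metis shift_index(1))

lemma exact_at_shift: "exact_at (shift_cplx c C) n \<longleftrightarrow> exact_at C (n - c)"
  unfolding exact_at_def cycles_def boundaries_def shift_cplx_simps shift_index ..

lemma tensor_shift: "tensor_cplx R (shift_cplx c C) N = shift_cplx c (tensor_cplx R C N)"
  by (simp add: tensor_cplx_def shift_cplx_def shift_index)

lemma hom_shift: "hom_cplx R (shift_cplx c C) N = shift_cplx (- c) (hom_cplx R C N)"
proof -
  have "- n - c = - (n + c)" "1 - n - c = 1 - (n + c)" for n :: int by simp_all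
  then show ?thesis by (simp only: hom_cplx_def shift_cplx_def cplx.simps minus_minus diff_minus_eq_add)
qed

text \<open>A comparison map from the resolution F of M to Y that raises degrees by t. In degree 0
  it lifts \<psi> after the augmentation through \<theta>, so the kernel of the augmentation goes to
  boundaries; above t, exactness of Y turns cycles into boundaries. Either way the next lift
  exists.\<close>

lemma attaching_map:
  assumes M: "module R M" and Y: "chain_complex R Y" and ex: "\<And>q. q > t \<Longrightarrow> exact_at Y q"
    and D: "module R D" and \<theta>: "\<theta> \<in> lin_maps R ((obj Y t)\<lparr>carrier := cycles Y t\<rparr>) D"
    and \<theta>_surj: "\<theta> ` cycles Y t = carrier D"
    and \<theta>_ker: "\<And>z. z \<in> cycles Y t \<Longrightarrow> \<theta> z = \<zero>\<^bsub>D\<^esub> \<longleftrightarrow> z \<in> boundaries Y t"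
    and \<psi>: "\<psi> \<in> lin_maps R M D"
  obtains g where "\<And>n. g n \<in> lin_maps R (obj (shift_cplx (t + 1) (free_res R M)) n) (obj Y (n - 1))"
    and "\<And>n x. x \<in> carrier (obj (shift_cplx (t + 1) (free_res R M)) n) \<Longrightarrow>
      g (n - 1) (dif (shift_cplx (t + 1) (free_res R M)) n x) \<oplus>\<^bsub>obj Y (n - 1 - 1)\<^esub> dif Y (n - 1) (g n x) = \<zero>\<^bsub>obj Y (n - 1 - 1)\<^esub>"
    and "\<And>x. x \<in> carrier (obj (free_res R M) 0) \<Longrightarrow> g (t + 1) x \<in> cycles Y t"
    and "\<And>x. x \<in> carrier (obj (free_res R M) 0) \<Longrightarrow> \<theta> (g (t + 1) x) = \<psi> (res_aug R M x)"
proof -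
  let ?F = "free_res R M"
  note F = free_res_is_resolution[OF M]
  note cF = chain_complexD[OF F(1)] and cY = chain_complexD[OF Y]
  interpret Y: module R "obj Y n" for n by (rule cY)
  \<comment> \<open>Preservation of boundaries is what makes \<open>?g\<close> below liftable; the
    minus sign in \<open>Q\<close> is the one required for the unsigned cone.\<close>
  define P where "P m h \<longleftrightarrow> h \<in> lin_maps R (obj ?F (int m)) (obj Y (t + int m)) \<and>
    (\<forall>x\<in>boundaries ?F (int m). h x \<in> boundaries Y (t + int m)) \<and>
    (m = 0 \<longrightarrow> (\<forall>x\<in>carrier (obj ?F 0). h x \<in> cycles Y t \<and> \<theta> (h x) = \<psi> (res_aug R M x)))" for m h
  define Q where "Q m h h' \<longleftrightarrow> (\<forall>x\<in>carrier (obj ?F (int m + 1)).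
    dif Y (t + int m + 1) (h' x) = \<ominus>\<^bsub>obj Y (t + int m)\<^esub> h (dif ?F (int m + 1) x))" for m h h'
  have "\<exists>s. \<forall>m. P m (s m) \<and> Q m (s m) (s (Suc m))"
  proof (rule dependent_nat_choice)
    let ?Z = "(obj Y t)\<lparr>carrier := cycles Y t\<rparr>"
    obtain h where h: "h \<in> lin_maps R (obj ?F 0) ?Z"
      "\<And>x. x \<in> carrier (obj ?F 0) \<Longrightarrow> \<theta> (h x) = \<psi> (res_aug R M x)"
      using projective_lifting[OF F(2) module_cycles[OF Y] D \<theta> _ lin_maps_comp[OF F(5) \<psi>]] \<theta>_surj by auto
    have hc: "h x \<in> cycles Y t" if "x \<in> carrier (obj ?F 0)" for x using lin_mapsD(1)[OF h(1) that] by simp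
    have "h \<in> lin_maps R (obj ?F 0) (obj Y t)"
      using lin_mapsD[OF h(1)] by (intro lin_mapsI) (auto simp: mem_cycles_iff)
    moreover have "h x \<in> boundaries Y t" if "x \<in> boundaries ?F 0" for x
      using that F(7) h(2)[of x] \<theta>_ker[OF hc, of x] lin_maps_zero[OF M D \<psi>] by (simp add: a_kernel_alt)
    ultimately have "P 0 h" using h hc by (simp add: P_def)
    then show "\<exists>h. P 0 h" by blast
    fix h m assume "P m h"
    then have h: "h \<in> lin_maps R (obj ?F (int m)) (obj Y (t + int m))"
      and hb: "\<And>x. x \<in> boundaries ?F (int m) \<Longrightarrow> h x \<in> boundaries Y (t + int m)" by (auto simp: P_def)
    let ?g = "\<lambda>x. \<ominus>\<^bsub>obj Y (t + int m)\<^esub> h (dif ?F (int m + 1) x)"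
    have g: "?g \<in> lin_maps R (obj ?F (int m + 1)) (obj Y (t + int m))"
      by (rule lin_maps_uminus[OF cY(1) lin_maps_comp[OF cF(3) h]])
    have "?g x \<in> boundaries Y (t + int m)" if "x \<in> carrier (obj ?F (int m + 1))" for x
    proof -
      have "h (dif ?F (int m + 1) x) \<in> boundaries Y (t + int m)" using that by (intro hb) (auto simp: boundaries_def)
      then show ?thesis using Y.submoduleE(3)[OF submodule_boundaries[OF Y]] by blast
    qed
    then obtain h' where h': "h' \<in> lin_maps R (obj ?F (int m + 1)) (obj Y (t + int m + 1))"
      "\<And>x. x \<in> carrier (obj ?F (int m + 1)) \<Longrightarrow> dif Y (t + int m + 1) (h' x) = ?g x"
      using lift_boundaries[OF Y F(2) g] by blast
    have e: "int (Suc m) = int m + 1" "t + (int m + 1) = t + int m + 1" by simp_all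
    have "P (Suc m) h'"
      unfolding P_def e
    proof (intro conjI ballI)
      fix x assume "x \<in> boundaries ?F (int m + 1)"
      then have x: "x \<in> carrier (obj ?F (int m + 1))" "dif ?F (int m + 1) x = \<zero>\<^bsub>obj ?F (int m)\<^esub>"
        using boundaries_subset_cycles[OF F(1), of "int m + 1"] by (auto simp: mem_cycles_iff)
      have "dif Y (t + int m + 1) (h' x) = \<zero>\<^bsub>obj Y (t + int m)\<^esub>"
        using h'(2)[OF x(1)] x(2) lin_maps_zero[OF cF(1) cY(1) h] Y.M.add.inv_one by simp
      then have "h' x \<in> cycles Y (t + int m + 1)" using lin_mapsD(1)[OF h'(1) x(1)] by (simp add: mem_cycles_iff)
      then show "h' x \<in> boundaries Y (t + int m + 1)" using ex[of "t + int m + 1"] by (auto simp: exact_at_def)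
    qed (use h' in simp_all)
    moreover have "Q m h h'" using h'(2) by (simp add: Q_def)
    ultimately show "\<exists>h'. P (Suc m) h' \<and> Q m h h'" by blast
  qed
  then obtain s where s: "\<And>m. P m (s m)" "\<And>m. Q m (s m) (s (Suc m))" by blast
  \<comment> \<open>F_m sits in degree m + t + 1 of the shifted complex, which is zero up to degree
    t.\<close>
  define g where "g n = (if n \<le> t then (\<lambda>_. \<zero>\<^bsub>obj Y (n - 1)\<^esub>) else s (nat (n - t - 1)))" for n
  let ?V = "shift_cplx (t + 1) ?F"
  have gl: "g n \<in> lin_maps R (obj ?V n) (obj Y (n - 1))" for n
  proof (cases "n \<le> t")
    case True then show ?thesis by (simp add: g_def lin_maps_const_zero cY(1))
  next
    case False
    then have "int (nat (n - t - 1)) = n - (t + 1)" "t + (n - (t + 1)) = n - 1" by simp_all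
    then show ?thesis using s(1)[of "nat (n - t - 1)"] False unfolding P_def shift_cplx_simps g_def
      by (simp add: diff_diff_eq)
  qed
  have s0: "g (t + 1) = s 0" by (simp add: g_def)
  have g0: "g (t + 1) x \<in> cycles Y t" "\<theta> (g (t + 1) x) = \<psi> (res_aug R M x)" if "x \<in> carrier (obj ?F 0)" for x
    using s(1)[of 0] that by (auto simp: P_def s0)
  have anti: "g (n - 1) (dif ?V n x) \<oplus>\<^bsub>obj Y (n - 1 - 1)\<^esub> dif Y (n - 1) (g n x) = \<zero>\<^bsub>obj Y (n - 1 - 1)\<^esub>"
    if x: "x \<in> carrier (obj ?V n)" for n x
  proof -
    consider "n \<le> t" | "n = t + 1" | "n > t + 1" by linarith
    then show ?thesis
    proof cases
      case 1
      then show ?thesis using lin_maps_zero[OF cY(1) cY(1) cY(2)] by (simp add: g_def)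
    next
      \<comment> \<open>The lowest degree that can be nonzero: the first summand is zero by the
        default value of \<open>g\<close>, the second because \<open>g (t + 1)\<close> takes values
        in cycles.\<close>
      case 2
      then show ?thesis using x g0(1)[of x] by (simp add: g_def[of t] shift_cplx_simps mem_cycles_iff)
    next
      case 3
      define m where "m = nat (n - t - 2)"
      have m: "n = t + int m + 1 + 1" using 3 by (simp add: m_def)
      have n: "n - (t + 1) = int m + 1" using m by simp
      have x': "x \<in> carrier (obj ?F (int m + 1))" and d: "dif ?V n = dif ?F (int m + 1)"
        using x unfolding shift_cplx_simps n by simp_all
      have gm: "g n = s (Suc m)" "g (n - 1) = s m" by (simp_all add: g_def m nat_add_distrib)
      have c: "s m (dif ?F (int m + 1) x) \<in> carrier (obj Y (t + int m))"
        using s(1)[of m] lin_mapsD(1)[OF _ lin_mapsD(1)[OF cF(3) x']] by (auto simp: P_def)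
      have i: "n - 1 - 1 = t + int m" "n - 1 = t + int m + 1" using m by simp_all
      show ?thesis
        unfolding i(1) d gm using s(2)[of m] x' Y.M.r_neg[OF c] by (simp add: Q_def i(2))
    qed
  qed
  show ?thesis by (rule that[OF gl anti g0])
qed

section \<open>Homology of a cone below, at and above the attaching degree\<close>

context mapping_cone begin

lemma dif_V_zero: "dif V n \<zero>\<^bsub>obj V n\<^esub> = \<zero>\<^bsub>obj V (n - 1)\<^esub>"
  by (rule lin_maps_zero[OF chain_complexD(1)[OF cV] chain_complexD(1)[OF cV] chain_complexD(2)[OF cV]])

lemma f_zero: "f n \<zero>\<^bsub>obj V n\<^esub> = \<zero>\<^bsub>obj Y (n - 1)\<^esub>"
  by (rule lin_maps_zero[OF chain_complexD(1)[OF cV] chain_complexD(1)[OF cY] f])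

lemma cycles_cone_zero:
  assumes "zero_module (obj V q)"
  shows "cycles cone q = e \<zero>\<^bsub>obj V q\<^esub> ` cycles Y q"
proof -
  have "u \<in> cycles cone q \<longleftrightarrow> u \<in> e \<zero>\<^bsub>obj V q\<^esub> ` cycles Y q" for u
  proof (cases "u \<in> carrier (obj cone q)")
    case True
    then obtain y where u: "u = e \<zero>\<^bsub>obj V q\<^esub> y" and y: "y \<in> carrier (obj Y q)"
      using assms by (auto simp: cone_simps sum_module_simps zero_module_def)
    show ?thesis
      using y lin_mapsD(1)[OF chain_complexD(2)[OF cY] y] 
      by (simp add: u mem_cycles_cone_iff image_iff) (auto simp: mem_cycles_iff dif_V_zero f_zero)
  next
    case False
    then show ?thesis by (auto simp: mem_cycles_iff cone_simps sum_module_simps)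
  qed
  then show ?thesis by blast
qed

text \<open>With V_q = 0 the cycles of the cone are those of Y, and with V_{q+1} = 0 no new
  boundaries arrive.\<close>

lemma homology_power_cone:
  assumes z: "zero_module (obj V q)" "zero_module (obj V (q + 1))" and h: "homology_power R M Y q k"
  shows "homology_power R M cone q k"
proof -
  obtain \<theta> where \<theta>: "\<theta> \<in> lin_maps R ((obj Y q)\<lparr>carrier := cycles Y q\<rparr>) (direct_power M k)"
    "\<theta> ` cycles Y q = carrier (direct_power M k)"
    "\<And>z. z \<in> cycles Y q \<Longrightarrow> \<theta> z = \<zero>\<^bsub>direct_power M k\<^esub> \<longleftrightarrow> z \<in> boundaries Y q"
    using h by (auto simp: homology_power_def)
  have b: "e \<zero>\<^bsub>obj V q\<^esub> y \<in> boundaries cone q \<longleftrightarrow> y \<in> boundaries Y q" for y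
    using z(2) f_zero[of "q + 1"] dif_V_zero[of "q + 1"] lin_mapsD(1)[OF chain_complexD(3)[OF cY]]
    unfolding mem_boundaries_cone_iff by (auto simp: zero_module_def mem_boundaries_iff)
  show ?thesis
    unfolding homology_power_def cycles_cone_zero[OF z(1)]
  proof (rule bexI[of _ "\<lambda>u. \<theta> (p2 u)"], intro conjI ballI)
    show "(\<lambda>u. \<theta> (p2 u)) ` e \<zero>\<^bsub>obj V q\<^esub> ` cycles Y q = carrier (direct_power M k)"
      using \<theta>(2) by (simp add: image_image)
    show "\<theta> (p2 u) = \<zero>\<^bsub>direct_power M k\<^esub> \<longleftrightarrow> u \<in> boundaries cone q" if "u \<in> e \<zero>\<^bsub>obj V q\<^esub> ` cycles Y q" for u
      using that \<theta>(3) b by auto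
    show "(\<lambda>u. \<theta> (p2 u)) \<in> lin_maps R ((obj cone q)\<lparr>carrier := e \<zero>\<^bsub>obj V q\<^esub> ` cycles Y q\<rparr>) (direct_power M k)"
      using lin_mapsD[OF \<theta>(1)] by (intro lin_mapsI) (auto simp: cone_simps sum_module_simps)
  qed
qed

end

text \<open>
  The cone of an attaching map kills the last copy of \<open>M\<close> in the top homology module: the classes
  hit by \<open>f\<close> are those with zero coordinates except the last one.
\<close>

locale attached_cone = mapping_cone e p1 p2 R "shift_cplx (t + 1) (free_res R M)" Y f
  for e :: "(('r, 'm) gen \<Rightarrow> 'r) \<Rightarrow> 'y \<Rightarrow> 'u" and p1 p2 R t and M :: "('r, 'm) module" and Y f +
  fixes \<theta> :: "'y \<Rightarrow> nat \<Rightarrow> 'm" and k :: nat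
  assumes M: "module R M" and above: "\<And>q. q > t \<Longrightarrow> exact_at Y q"
    and \<theta>: "\<theta> \<in> lin_maps R ((obj Y t)\<lparr>carrier := cycles Y t\<rparr>) (direct_power M (Suc k))"
    and \<theta>_surj: "\<theta> ` cycles Y t = carrier (direct_power M (Suc k))"
    and \<theta>_ker: "\<And>z. z \<in> cycles Y t \<Longrightarrow> \<theta> z = \<zero>\<^bsub>direct_power M (Suc k)\<^esub> \<longleftrightarrow> z \<in> boundaries Y t"
    and f_cycle: "\<And>x. x \<in> carrier (obj (free_res R M) 0) \<Longrightarrow> f (t + 1) x \<in> cycles Y t"
    and \<theta>_f: "\<And>x. x \<in> carrier (obj (free_res R M) 0) \<Longrightarrow>
      \<theta> (f (t + 1) x) = (\<lambda>j\<in>{..<Suc k}. if j = k then res_aug R M x else \<zero>\<^bsub>M\<^esub>)"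
begin

lemmas F = free_res_is_resolution[OF M]
sublocale M: module R M by (rule M)
sublocale D: module R "direct_power M n" for n by (rule module_direct_power[OF M])

abbreviation "V \<equiv> shift_cplx (t + 1) (free_res R M)"

lemma V_zero: "n \<le> t \<Longrightarrow> zero_module (obj V n)"
  using F(3)[of "n - (t + 1)"] by (simp add: shift_cplx_simps)

text \<open>Since V_t = 0, the cone has the same cycles as Y in degree t and only gains boundaries.
  They fill the whole last coordinate because the augmentation is surjective, so forgetting that
  coordinate presents the new homology.\<close>

lemma homology_top: "homology_power R M cone t k"
proof -
  note z = V_zero[of t, simplified]
  define \<theta>' where "\<theta>' u = (\<lambda>j\<in>{..<k}. \<theta> (p2 u) j)" for u
  let ?Z = "(obj Y t)\<lparr>carrier := cycles Y t\<rparr>"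
  have Zadd: "x \<oplus>\<^bsub>obj Y t\<^esub> y \<in> cycles Y t" if "x \<in> cycles Y t" "y \<in> cycles Y t" for x y
    using that Y.submoduleE(5)[OF submodule_cycles[OF cY]] by blast
  have \<theta>_add: "\<theta> (x \<oplus>\<^bsub>obj Y t\<^esub> y) = \<theta> x \<oplus>\<^bsub>direct_power M (Suc k)\<^esub> \<theta> y" if "x \<in> cycles Y t" "y \<in> cycles Y t" for x y
    using lin_mapsD(2)[OF \<theta>] that by simp
  have \<theta>_car: "\<theta> x \<in> carrier (direct_power M (Suc k))" if "x \<in> cycles Y t" for x
    using lin_mapsD(1)[OF \<theta>] that by simp
  have \<theta>_M: "\<theta> x j \<in> carrier M" if "x \<in> cycles Y t" "j < Suc k" for x j
    using \<theta>_car[OF that(1)] that(2) by (auto simp: direct_power_simps)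
  have bd: "dif Y (t + 1) y \<in> boundaries Y t" if "y \<in> carrier (obj Y (t + 1))" for y
    using that by (auto simp: boundaries_def)
  have bc: "x \<in> cycles Y t" if "x \<in> boundaries Y t" for x
    using that boundaries_subset_cycles[OF cY] by blast
  have V1: "obj V (t + 1) = obj (free_res R M) 0" by (simp add: shift_cplx_simps)
  have dV: "dif V (t + 1) x = \<zero>\<^bsub>obj V t\<^esub>" if "x \<in> carrier (obj V (t + 1))" for x
    using lin_mapsD(1)[OF chain_complexD(3)[OF cV] that] z by (simp add: zero_module_def)
  have aug: "res_aug R M x \<in> carrier M" if "x \<in> carrier (obj (free_res R M) 0)" for x
    using lin_mapsD(1)[OF F(5) that] .
  have b: "e \<zero>\<^bsub>obj V t\<^esub> y \<in> boundaries cone t \<longleftrightarrow> (\<lambda>j\<in>{..<k}. \<theta> y j) = (\<lambda>j\<in>{..<k}. \<zero>\<^bsub>M\<^esub>)"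
    if y: "y \<in> cycles Y t" for y
  proof
    assume "e \<zero>\<^bsub>obj V t\<^esub> y \<in> boundaries cone t"
    then obtain x y' where x: "x \<in> carrier (obj (free_res R M) 0)" and y': "y' \<in> carrier (obj Y (t + 1))"
      and eq: "y = f (t + 1) x \<oplus>\<^bsub>obj Y t\<^esub> dif Y (t + 1) y'"
      unfolding mem_boundaries_cone_iff V1 by blast
    have "\<theta> y = \<theta> (f (t + 1) x)"
      using \<theta>_add[OF f_cycle[OF x] bc[OF bd[OF y']]] \<theta>_ker[OF bc[OF bd[OF y']]] bd[OF y']
        \<theta>_car[OF f_cycle[OF x]] eq by simp
    then show "(\<lambda>j\<in>{..<k}. \<theta> y j) = (\<lambda>j\<in>{..<k}. \<zero>\<^bsub>M\<^esub>)" using \<theta>_f[OF x] by (auto simp: fun_eq_iff)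
  next
    assume eq: "(\<lambda>j\<in>{..<k}. \<theta> y j) = (\<lambda>j\<in>{..<k}. \<zero>\<^bsub>M\<^esub>)"
    \<comment> \<open>With this \<open>x\<close> the cycles \<open>y\<close> and
      \<open>f (t + 1) x\<close> have the same value under \<theta>, so they differ by a boundary of
      Y.\<close>
    obtain x where x: "x \<in> carrier (obj (free_res R M) 0)" "res_aug R M x = \<theta> y k"
      using F(6) \<theta>_M[OF y, of k] by (metis imageE lessI)
    have "\<theta> y j = \<zero>\<^bsub>M\<^esub>" if "j < k" for j using fun_cong[OF eq, of j] that by simp
    then have \<theta>_eq: "\<theta> y = \<theta> (f (t + 1) x)"
      using \<theta>_car[OF y] x(2) by (auto simp: \<theta>_f[OF x(1)] direct_power_simps fun_eq_iff PiE_iff extensional_def less_Suc_eq)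
    let ?fx = "f (t + 1) x"
    have yc: "y \<in> carrier (obj Y t)" and fc: "?fx \<in> carrier (obj Y t)"
      using y f_cycle[OF x(1)] by (auto simp: mem_cycles_iff)
    have "y \<ominus>\<^bsub>obj Y t\<^esub> ?fx \<in> cycles Y t"
      using lin_maps_minus[OF chain_complexD(1)[OF cY] chain_complexD(1)[OF cY] chain_complexD(2)[OF cY] yc fc]
        y f_cycle[OF x(1)] module_minus_closed[OF chain_complexD(1)[OF cY] yc fc]
        module_minus_eq_zero_iff[OF chain_complexD(1)[OF cY] Y.M.zero_closed Y.M.zero_closed]
      by (simp add: mem_cycles_iff)
    note w = this
    have split: "y = ?fx \<oplus>\<^bsub>obj Y t\<^esub> (y \<ominus>\<^bsub>obj Y t\<^esub> ?fx)"
      by (rule module_add_minus_cancel[OF chain_complexD(1)[OF cY] yc fc, symmetric])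
    have "\<theta> ?fx = \<theta> ?fx \<oplus>\<^bsub>direct_power M (Suc k)\<^esub> \<theta> (y \<ominus>\<^bsub>obj Y t\<^esub> ?fx)"
      using \<theta>_add[OF f_cycle[OF x(1)] w] \<theta>_eq split by simp
    then have "\<theta> (y \<ominus>\<^bsub>obj Y t\<^esub> ?fx) = \<zero>\<^bsub>direct_power M (Suc k)\<^esub>"
      using \<theta>_car[OF f_cycle[OF x(1)]] \<theta>_car[OF w] D.M.add.l_cancel_one' by blast
    then have "y \<ominus>\<^bsub>obj Y t\<^esub> ?fx \<in> boundaries Y t" using \<theta>_ker[OF w] by blast
    then obtain y' where "y' \<in> carrier (obj Y (t + 1))" "y \<ominus>\<^bsub>obj Y t\<^esub> ?fx = dif Y (t + 1) y'"
      by (auto simp: mem_boundaries_iff)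
    then show "e \<zero>\<^bsub>obj V t\<^esub> y \<in> boundaries cone t"
      unfolding mem_boundaries_cone_iff using split x(1) dV[of x] V1 by metis
  qed
  show ?thesis
    unfolding homology_power_def cycles_cone_zero[OF z]
  proof (rule bexI[of _ \<theta>'], intro conjI ballI)
    show "\<theta>' u = \<zero>\<^bsub>direct_power M k\<^esub> \<longleftrightarrow> u \<in> boundaries cone t" if "u \<in> e \<zero>\<^bsub>obj V t\<^esub> ` cycles Y t" for u
      using that b by (auto simp: \<theta>'_def direct_power_simps)
    show "\<theta>' \<in> lin_maps R ((obj cone t)\<lparr>carrier := e \<zero>\<^bsub>obj V t\<^esub> ` cycles Y t\<rparr>) (direct_power M k)"
    proof (rule lin_mapsI, goal_cases)
      case (1 u)
      then show ?case using \<theta>_M by (auto simp: \<theta>'_def direct_power_simps restrict_PiE_iff split: if_splits)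
    next
      case (2 u v)
      then show ?case
        by (auto simp: \<theta>'_def cone_simps sum_module_simps \<theta>_add direct_power_simps fun_eq_iff)
    next
      case (3 r u)
      then show ?case using lin_mapsD(3)[OF \<theta>]
        by (auto simp: \<theta>'_def cone_simps sum_module_simps direct_power_simps fun_eq_iff)
    qed
    show "\<theta>' ` e \<zero>\<^bsub>obj V t\<^esub> ` cycles Y t = carrier (direct_power M k)"
    proof
      show "\<theta>' ` e \<zero>\<^bsub>obj V t\<^esub> ` cycles Y t \<subseteq> carrier (direct_power M k)"
      proof (intro subsetI, elim imageE)
        fix v u y assume v: "v = \<theta>' u" "u = e \<zero>\<^bsub>obj V t\<^esub> y" and y: "y \<in> cycles Y t"
        show "v \<in> carrier (direct_power M k)"
          unfolding v \<theta>'_def direct_power_simps p2_e restrict_PiE_iff using \<theta>_M[OF y] by simp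
      qed
      show "carrier (direct_power M k) \<subseteq> \<theta>' ` e \<zero>\<^bsub>obj V t\<^esub> ` cycles Y t"
      proof
        fix v assume v: "v \<in> carrier (direct_power M k)"
        \<comment> \<open>A preimage of \<open>v\<close> is found by padding with zero in the
          forgotten coordinate.\<close>
        then have "v(k := \<zero>\<^bsub>M\<^esub>) \<in> carrier (direct_power M (Suc k))"
          by (auto simp: direct_power_simps PiE_iff extensional_def less_Suc_eq)
        then obtain y where y: "y \<in> cycles Y t" "\<theta> y = v(k := \<zero>\<^bsub>M\<^esub>)" using \<theta>_surj by (metis imageE)
        have "\<theta>' (e \<zero>\<^bsub>obj V t\<^esub> y) = v"
          using v y(2) by (auto simp: \<theta>'_def direct_power_simps fun_eq_iff PiE_iff extensional_def)
        then show "v \<in> \<theta>' ` e \<zero>\<^bsub>obj V t\<^esub> ` cycles Y t" using y(1) by (metis imageI)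
      qed
    qed
  qed
qed

text \<open>Only q = t + 1 involves the attaching map, as V has its homology there. A cycle (x, y)
  of the cone makes f x the negative of a boundary; the coordinate inclusion of M being injective, x
  then lies in the kernel of the augmentation, which consists of boundaries.\<close>

lemma cycle_boundary_V:
  assumes q: "q > t" and x: "x \<in> cycles V q" and y: "y \<in> carrier (obj Y q)"
    and fx: "f q x \<oplus>\<^bsub>obj Y (q - 1)\<^esub> dif Y q y = \<zero>\<^bsub>obj Y (q - 1)\<^esub>"
  shows "x \<in> boundaries V q"
proof (cases "q = t + 1")
  case False
  then have "exact_at V q"
    unfolding exact_at_shift using q F(4)[of "q - (t + 1)"] by (simp add: exact_at_def)
  then show ?thesis using x by (auto simp: exact_at_def)
next
  case True
  have x0: "x \<in> carrier (obj (free_res R M) 0)" using x True by (simp add: mem_cycles_iff shift_cplx_simps)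
  have dy: "dif Y q y \<in> boundaries Y t" using y True by (auto simp: boundaries_def)
  then have dyc: "dif Y q y \<in> cycles Y t" using boundaries_subset_cycles[OF cY] by blast
  have fc: "f q x \<in> cycles Y t" using f_cycle[OF x0] True by simp
  have "\<theta> (f q x \<oplus>\<^bsub>obj Y t\<^esub> dif Y q y) = \<theta> (f q x) \<oplus>\<^bsub>direct_power M (Suc k)\<^esub> \<theta> (dif Y q y)"
    using lin_mapsD(2)[OF \<theta>] fc dyc by simp
  moreover have "\<theta> \<zero>\<^bsub>obj Y t\<^esub> = \<zero>\<^bsub>direct_power M (Suc k)\<^esub>"
    using lin_maps_zero[OF module_cycles[OF cY] D.module_axioms \<theta>] by simp
  moreover have "\<theta> (dif Y q y) = \<zero>\<^bsub>direct_power M (Suc k)\<^esub>" using \<theta>_ker[OF dyc] dy by simp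
  moreover have "\<theta> (f q x) \<in> carrier (direct_power M (Suc k))" using lin_mapsD(1)[OF \<theta>] fc by simp
  ultimately have "\<theta> (f q x) = \<zero>\<^bsub>direct_power M (Suc k)\<^esub>" using fx True by simp
  then have "res_aug R M x = \<zero>\<^bsub>M\<^esub>"
    using fun_cong[OF \<theta>_f[OF x0], of k] unfolding True[symmetric] by (simp add: direct_power_simps)
  then have "x \<in> boundaries (free_res R M) 0" using x0 F(7) by (simp add: a_kernel_alt)
  then show ?thesis
    unfolding boundaries_def shift_cplx_simps shift_index using True by simp
qed

lemma exact_cone_above:
  assumes q: "q > t" shows "exact_at cone q"
  unfolding exact_at_def
proof
  fix u assume u': "u \<in> cycles cone q"
  then obtain x y where u: "u = e x y" by (auto simp: mem_cycles_iff cone_simps sum_module_simps)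
  from u' have x: "x \<in> cycles V q" and y: "y \<in> carrier (obj Y q)"
    and eq: "f q x \<oplus>\<^bsub>obj Y (q - 1)\<^esub> dif Y q y = \<zero>\<^bsub>obj Y (q - 1)\<^esub>"
    by (auto simp: u mem_cycles_cone_iff)
  obtain x' where x': "x' \<in> carrier (obj V (q + 1))" "x = dif V (q + 1) x'"
    using cycle_boundary_V[OF q x y eq] by (auto simp: mem_boundaries_iff)
  \<comment> \<open>Subtracting the boundary of (x', 0), which is (x, f x'), leaves a cycle of Y,
    and Y is exact in this degree.\<close>
  let ?fx = "f (q + 1) x'"
  have fc: "?fx \<in> carrier (obj Y q)" using lin_mapsD(1)[OF f[of "q + 1"] x'(1)] by simp
  note dy = lin_mapsD(1)[OF chain_complexD(2)[OF cY] y] and df = lin_mapsD(1)[OF chain_complexD(2)[OF cY] fc]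
  have fxc: "f q x \<in> carrier (obj Y (q - 1))" using lin_mapsD(1)[OF f] x by (auto simp: mem_cycles_iff)
  have "f q x \<oplus>\<^bsub>obj Y (q - 1)\<^esub> dif Y q ?fx = \<zero>\<^bsub>obj Y (q - 1)\<^esub>"
    using anti[OF x'(1)] x'(2) by simp
  then have "dif Y q y = dif Y q ?fx"
    using eq fxc dy df by (metis Y.M.add.l_cancel)
  then have "y \<ominus>\<^bsub>obj Y q\<^esub> ?fx \<in> cycles Y q"
    using lin_maps_minus[OF chain_complexD(1)[OF cY] chain_complexD(1)[OF cY] chain_complexD(2)[OF cY] y fc]
      module_minus_closed[OF chain_complexD(1)[OF cY] y fc] module_minus_eq_zero_iff[OF chain_complexD(1)[OF cY] df df]
    by (simp add: mem_cycles_iff)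
  then obtain y' where y': "y' \<in> carrier (obj Y (q + 1))" "y \<ominus>\<^bsub>obj Y q\<^esub> ?fx = dif Y (q + 1) y'"
    by (rule exact_atE[OF above[OF q]])
  then have "y = ?fx \<oplus>\<^bsub>obj Y q\<^esub> dif Y (q + 1) y'"
    using module_add_minus_cancel[OF chain_complexD(1)[OF cY] y fc] by simp
  then show "u \<in> boundaries cone q" unfolding u mem_boundaries_cone_iff using x' y' by blast
qed

end

section \<open>Vanishing along the tower of cones\<close>

text \<open>The class of complexes through which the tower runs. The exponents form an arbitrary
  finitely supported function, so that copies of M can be removed one at a time.\<close>

definition homology_powers :: "'r ring \<Rightarrow> ('r, 'm) module \<Rightarrow> (int \<Rightarrow> nat) \<Rightarrow> ('r, 'x) cplx \<Rightarrow> bool" where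
  "homology_powers R M a Y \<longleftrightarrow> chain_complex R Y \<and> bounded_below_cplx Y \<and>
     (\<forall>n. projective R (obj Y n)) \<and> (\<forall>q. homology_power R M Y q (a q)) \<and> finite {q. a q \<noteq> 0}"

text \<open>One rung of the tower. Degrees below t are untouched because the shifted resolution
  vanishes up to degree t; the type \<open>'u\<close> of the new complex is dictated by the
  pairing.\<close>

lemma attach_copy:
  fixes e :: "(('r, 'm) gen \<Rightarrow> 'r) \<Rightarrow> 'y \<Rightarrow> 'u" and M :: "('r, 'm) module" and Y :: "('r, 'y) cplx"
  assumes M: "module R M" and pairing: "pairing e p1 p2" and Y: "homology_powers R M a Y"
    and t: "a t \<noteq> 0" and above: "\<And>q. q > t \<Longrightarrow> a q = 0"
  obtains W :: "('r, 'u) cplx" and inc prj sec ret where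
    "split_ext R (shift_cplx (t + 1) (free_res R M)) Y W inc prj sec ret"
    "homology_powers R M (a(t := a t - 1)) W"
proof -
  have cY: "chain_complex R Y" and bY: "bounded_below_cplx Y" and pY: "\<And>n. projective R (obj Y n)"
    and hY: "\<And>q. homology_power R M Y q (a q)" and fin: "finite {q. a q \<noteq> 0}"
    using Y by (auto simp: homology_powers_def)
  note F = free_res_is_resolution[OF M]
  obtain k where k: "a t = Suc k" using t by (cases "a t") auto
  have ex: "exact_at Y q" if "q > t" for q
    using hY[of q] above[OF that] by (simp add: homology_power_0[OF cY])
  obtain \<theta> where \<theta>: "\<theta> \<in> lin_maps R ((obj Y t)\<lparr>carrier := cycles Y t\<rparr>) (direct_power M (Suc k))"
    "\<theta> ` cycles Y t = carrier (direct_power M (Suc k))"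
    "\<And>z. z \<in> cycles Y t \<Longrightarrow> \<theta> z = \<zero>\<^bsub>direct_power M (Suc k)\<^esub> \<longleftrightarrow> z \<in> boundaries Y t"
    using hY[of t] unfolding k homology_power_def by auto
  interpret M: module R M by (rule M)
  have "(\<lambda>x. \<lambda>j\<in>{..<Suc k}. if j = k then x else \<zero>\<^bsub>M\<^esub>) \<in> lin_maps R M (direct_power M (Suc k))"
    by (rule lin_mapsI) (auto simp: direct_power_simps fun_eq_iff)
  from attaching_map[OF M cY ex module_direct_power[OF M] \<theta> this] obtain g where
    g: "\<And>n. g n \<in> lin_maps R (obj (shift_cplx (t + 1) (free_res R M)) n) (obj Y (n - 1))"
    "\<And>n x. x \<in> carrier (obj (shift_cplx (t + 1) (free_res R M)) n) \<Longrightarrow>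
      g (n - 1) (dif (shift_cplx (t + 1) (free_res R M)) n x) \<oplus>\<^bsub>obj Y (n - 1 - 1)\<^esub> dif Y (n - 1) (g n x) = \<zero>\<^bsub>obj Y (n - 1 - 1)\<^esub>"
    "\<And>x. x \<in> carrier (obj (free_res R M) 0) \<Longrightarrow> g (t + 1) x \<in> cycles Y t"
    "\<And>x. x \<in> carrier (obj (free_res R M) 0) \<Longrightarrow>
      \<theta> (g (t + 1) x) = (\<lambda>j\<in>{..<Suc k}. if j = k then res_aug R M x else \<zero>\<^bsub>M\<^esub>)" by metis
  interpret pairing e p1 p2 by (rule pairing)
  interpret C: attached_cone e p1 p2 R t M Y g \<theta> k
    by unfold_locales (fact chain_complex_shift[OF F(1)] cY g M ex \<theta>)+
  have "bounded_below_cplx (shift_cplx (t + 1) (free_res R M))"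
    unfolding bounded_below_cplx_def using C.V_zero by (intro exI[of _ t]) simp
  then have "bounded_below_cplx C.cone" using bY by (rule C.bounded_below_middle)
  moreover have "projective R (obj C.cone n)" for n
    by (rule C.projective_middle[OF _ pY]) (simp add: shift_cplx_simps F(2))
  moreover have "homology_power R M C.cone q ((a(t := a t - 1)) q)" for q
  proof -
    consider "q < t" | "q = t" | "q > t" by linarith
    then show ?thesis
    proof cases
      case 1
      then show ?thesis using C.homology_power_cone[OF C.V_zero C.V_zero hY] by simp
    next
      case 2
      then show ?thesis using C.homology_top k by simp
    next
      case 3
      then show ?thesis using C.exact_cone_above above by (simp add: homology_power_0[OF C.chain_complex_cone])
    qed
  qed
  moreover have "finite {q. (a(t := a t - 1)) q \<noteq> 0}"
    by (rule finite_subset[OF _ fin]) (auto simp: k)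
  ultimately show ?thesis
    using that[OF C.split_ext_axioms] C.chain_complex_cone by (simp add: homology_powers_def)
qed

text \<open>
  Here \<open>v Y n\<close> and \<open>T n\<close> stand for the vanishing of the \<open>n\<close>-th homology of \<open>Y \<otimes> N\<close> and of \<open>Tor\<^sub>n(M, N)\<close>,
  or of the \<open>n\<close>-th cohomology of \<open>Hom(Y, N)\<close> and of \<open>Ext\<^sup>n(M, N)\<close>; the three rules for split extensions are
  what the long exact sequence says about vanishing.
\<close>

locale vanishing = pairing e p1 p2
  for e :: "(('r, 'm) gen \<Rightarrow> 'r) \<Rightarrow> 'u \<Rightarrow> 'u" and p1 p2 +
  fixes R :: "'r ring" and M :: "('r, 'm) module" and v :: "('r, 'u) cplx \<Rightarrow> int \<Rightarrow> bool" and T :: "int \<Rightarrow> bool"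
  assumes M: "module R M"
    and acyclic: "chain_complex R Y \<Longrightarrow> (\<And>n. projective R (obj Y n)) \<Longrightarrow> bounded_below_cplx Y \<Longrightarrow>
      (\<And>n. exact_at Y n) \<Longrightarrow> v Y n"
    and middle: "split_ext R (shift_cplx c (free_res R M)) Y W inc prj sec ret \<Longrightarrow> T (n - c) \<Longrightarrow> v Y n \<Longrightarrow> v W n"
    and base: "split_ext R (shift_cplx c (free_res R M)) Y W inc prj sec ret \<Longrightarrow> v W n \<Longrightarrow> v Y (n - 1) \<Longrightarrow> T (n - c)"
    and sub: "split_ext R (shift_cplx c (free_res R M)) Y W inc prj sec ret \<Longrightarrow> T (n + 1 - c) \<Longrightarrow> v W n \<Longrightarrow> v Y n"
begin

lemma acyclic':
  assumes "homology_powers R M a Y" "\<And>q. a q = 0" shows "v Y n"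
proof -
  have "exact_at Y q" for q
    using assms homology_power_0[of R Y M q] unfolding homology_powers_def by metis
  then show ?thesis using acyclic[of Y n] assms(1) unfolding homology_powers_def by blast
qed

text \<open>The sum counts all copies of M in the homology; its decrease is the measure for the
  inductions along the tower.\<close>

lemma remove_top:
  fixes Y :: "('r, 'u) cplx"
  assumes Y: "homology_powers R M a Y" and a: "a q \<noteq> 0"
  obtains t W inc prj sec ret where "a t \<noteq> 0" "\<forall>q. a q \<noteq> 0 \<longrightarrow> q \<le> t"
    "split_ext R (shift_cplx (t + 1) (free_res R M)) Y (W :: ('r, 'u) cplx) inc prj sec ret"
    "homology_powers R M (a(t := a t - 1)) W"
    "sum (a(t := a t - 1)) {q. (a(t := a t - 1)) q \<noteq> 0} < sum a {q. a q \<noteq> 0}"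
proof -
  have fin: "finite {q. a q \<noteq> 0}" using Y by (simp add: homology_powers_def)
  define t where "t = Max {q. a q \<noteq> 0}"
  have t: "a t \<noteq> 0" using Max_in[OF fin] a by (auto simp: t_def)
  have top: "q \<le> t" if "a q \<noteq> 0" for q using Max_ge[OF fin] that by (simp add: t_def)
  let ?a = "a(t := a t - 1)"
  have "sum ?a {q. ?a q \<noteq> 0} \<le> sum ?a {q. a q \<noteq> 0}"
    by (rule sum_mono2[OF fin]) (auto split: if_splits)
  also have "\<dots> < sum a {q. a q \<noteq> 0}"
    by (rule sum_strict_mono_ex1[OF fin]) (use t in \<open>auto intro!: bexI[of _ t]\<close>)
  finally have less: "sum ?a {q. ?a q \<noteq> 0} < sum a {q. a q \<noteq> 0}" .
  have above: "a q = 0" if "q > t" for q using top[of q] that by linarith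
  obtain W :: "('r, 'u) cplx" and inc prj sec ret where
    W: "split_ext R (shift_cplx (t + 1) (free_res R M)) Y W inc prj sec ret" "homology_powers R M ?a W"
    using attach_copy[OF M pairing_axioms Y t above] by blast
  show ?thesis using that[OF t _ W less] top by blast
qed

text \<open>The hypotheses concern all spectral sequence entries of total degree n. In the tower,
  the final complex is acyclic, and undoing the rung at t costs exactly T(n - t).\<close>

lemma vanishing_all:
  assumes "homology_powers R M a Y" "\<And>q. a q \<noteq> 0 \<Longrightarrow> T (n - q)"
  shows "v Y n"
  using assms
proof (induction "sum a {q. a q \<noteq> 0}" arbitrary: a Y rule: less_induct)
  case less
  show ?case
  proof (cases "\<exists>q. a q \<noteq> 0")
    case False
    then show ?thesis using acyclic'[OF less.prems(1)] by blast
  next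
    case True
    then obtain q where "a q \<noteq> 0" by blast
    then obtain t W inc prj sec ret where t: "a t \<noteq> 0" "\<forall>q. a q \<noteq> 0 \<longrightarrow> q \<le> t" and
      W: "split_ext R (shift_cplx (t + 1) (free_res R M)) Y (W :: ('r, 'u) cplx) inc prj sec ret"
      "homology_powers R M (a(t := a t - 1)) W" and
      s: "sum (a(t := a t - 1)) {q. (a(t := a t - 1)) q \<noteq> 0} < sum a {q. a q \<noteq> 0}"
      by (rule remove_top[OF less.prems(1)])
    have "v W n"
    proof (rule less.hyps[OF s W(2)])
      show "T (n - q)" if "(a(t := a t - 1)) q \<noteq> 0" for q
        using that less.prems(2)[of q] t(1) by (auto split: if_splits)
    qed
    then show ?thesis using sub[OF W(1), of n] less.prems(2)[OF t(1)] by simp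
  qed
qed

text \<open>In the spectral sequence for Tor no differential enters the bottom row b, and those
  leaving (p, b) end at positions (p + b - 1 - q, q). If these targets vanish, the entry at (p, b)
  survives to the homology in degree p + b, which is zero. In the tower, vanishing in degree p + b
  is carried up until a single copy of M, in degree b, remains.\<close>

lemma bottom_step:
  assumes "homology_powers R M a Y" "a b \<noteq> 0" "v Y (p + b)" "\<And>q. a q \<noteq> 0 \<Longrightarrow> b \<le> q \<and> T (p + b - 1 - q)"
  shows "T p"
  using assms
proof (induction "sum a {q. a q \<noteq> 0}" arbitrary: a Y rule: less_induct)
  case less
  obtain t W inc prj sec ret where t: "a t \<noteq> 0" "\<forall>q. a q \<noteq> 0 \<longrightarrow> q \<le> t" and
    W: "split_ext R (shift_cplx (t + 1) (free_res R M)) Y (W :: ('r, 'u) cplx) inc prj sec ret"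
    "homology_powers R M (a(t := a t - 1)) W" and
    s: "sum (a(t := a t - 1)) {q. (a(t := a t - 1)) q \<noteq> 0} < sum a {q. a q \<noteq> 0}"
    by (rule remove_top[OF less.prems(1,2)])
  show ?case
  proof (cases "t = b \<and> a b = 1")
    \<comment> \<open>The last copy is being removed, so W is acyclic and T(p) is equivalent to
      vanishing for Y in degree p + b.\<close>
    case True
    then have "(a(t := a t - 1)) q = 0" for q
      using t(2) less.prems(4)[of q] by (cases "q = b") auto
    then have "v W (p + b + 1)" using acyclic'[OF W(2)] by blast
    then show ?thesis using base[OF W(1), of "p + b + 1"] less.prems(3) True by simp
  next
    case False
    \<comment> \<open>The shifted resolution contributes in degree p + b - (t + 1), which is the
      case q = t of the hypothesis.\<close>
    have "v W (p + b)"
      using middle[OF W(1), of "p + b"] less.prems(3) less.prems(4)[OF t(1)] by (simp add: algebra_simps)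
    moreover have "(a(t := a t - 1)) b \<noteq> 0" using False less.prems(2) t(1) by auto
    moreover have "b \<le> q \<and> T (p + b - 1 - q)" if "(a(t := a t - 1)) q \<noteq> 0" for q
      using that less.prems(4)[of q] t by (auto split: if_splits)
    ultimately show ?thesis using less.hyps[OF s W(2)] by blast
  qed
qed

text \<open>The mirror image for Tor: no differential leaves the top row t, and those entering (p,
  t) start at positions (p + t + 1 - q, q) with q \<le> t, hence beyond p. One rung is enough, since
  \<open>vanishing_all\<close> disposes of all remaining copies together.\<close>

lemma top_step:
  assumes "homology_powers R M a Y" "a t \<noteq> 0" "\<And>q. a q \<noteq> 0 \<Longrightarrow> q \<le> t" "v Y (p + t)" "\<And>j. j > p \<Longrightarrow> T j"
  shows "T p"
proof -
  obtain t' W inc prj sec ret where t': "a t' \<noteq> 0" "\<forall>q. a q \<noteq> 0 \<longrightarrow> q \<le> t'" and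
    W: "split_ext R (shift_cplx (t' + 1) (free_res R M)) Y (W :: ('r, 'u) cplx) inc prj sec ret"
    "homology_powers R M (a(t' := a t' - 1)) W"
    using remove_top[OF assms(1,2)] by metis
  have "t' = t" using assms(2,3) t' by force
  have "v W (p + t + 1)"
  proof (rule vanishing_all[OF W(2)])
    show "T (p + t + 1 - q)" if "(a(t' := a t' - 1)) q \<noteq> 0" for q
      using that assms(3)[of q] assms(5)[of "p + t + 1 - q"] t'(1) by (auto split: if_splits)
  qed
  then show ?thesis using base[OF W(1), of "p + t + 1"] assms(4) by (simp add: \<open>t' = t\<close>)
qed

end

section \<open>Tor and Ext as instances of the vanishing rules\<close>

lemma vanishing_tensor:
  fixes e :: "(('r, 'm) gen \<Rightarrow> 'r) \<Rightarrow> 'u \<Rightarrow> 'u" and M :: "('r, 'm) module"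
  assumes "pairing e p1 p2" and M: "module R M" and N: "module R N"
  shows "vanishing e p1 p2 R M (\<lambda>Y. exact_at (tensor_cplx R Y N)) (exact_at (tensor_cplx R (free_res R M) N))"
proof -
  interpret pairing e p1 p2 by fact
  interpret module R M by (rule M)
  show ?thesis
  proof
    show "exact_at (tensor_cplx R Y N) n" if "chain_complex R Y" "\<And>n. projective R (obj Y n)" "bounded_below_cplx Y"
      "\<And>n. exact_at Y n" for Y :: "('r, 'u) cplx" and n
      by (rule tensor_cplx_exact[OF N that])
    fix c n and Y W :: "('r, 'u) cplx" and inc prj sec ret
    assume "split_ext R (shift_cplx c (free_res R M)) Y W inc prj sec ret"
    then interpret S: complex_ses R "tensor_cplx R Y N" "tensor_cplx R W N"
      "tensor_cplx R (shift_cplx c (free_res R M)) N"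
      "\<lambda>n. tensor_fun R (obj W n) N (inc n)" "\<lambda>n. tensor_fun R (obj (shift_cplx c (free_res R M)) n) N (prj n)"
      by (rule split_ext.tensor_ses[OF _ N])
    note S = S.exact_middle[of n] S.exact_right[of n] S.exact_left[of n, unfolded tensor_shift exact_at_shift]
    show "exact_at (tensor_cplx R (free_res R M) N) (n - c) \<Longrightarrow> exact_at (tensor_cplx R Y N) n \<Longrightarrow>
        exact_at (tensor_cplx R W N) n"
      and "exact_at (tensor_cplx R W N) n \<Longrightarrow> exact_at (tensor_cplx R Y N) (n - 1) \<Longrightarrow>
        exact_at (tensor_cplx R (free_res R M) N) (n - c)"
      and "exact_at (tensor_cplx R (free_res R M) N) (n + 1 - c) \<Longrightarrow> exact_at (tensor_cplx R W N) n \<Longrightarrow>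
        exact_at (tensor_cplx R Y N) n"
      using S by (simp_all add: tensor_shift exact_at_shift)
  qed
qed

lemma vanishing_hom:
  fixes e :: "(('r, 'm) gen \<Rightarrow> 'r) \<Rightarrow> 'u \<Rightarrow> 'u" and M :: "('r, 'm) module"
  assumes "pairing e p1 p2" and M: "module R M" and N: "module R N"
  shows "vanishing e p1 p2 R M (\<lambda>Y n. exact_at (hom_cplx R Y N) (- n)) (\<lambda>n. exact_at (hom_cplx R (free_res R M) N) (- n))"
proof -
  interpret pairing e p1 p2 by fact
  interpret module R M by (rule M)
  show ?thesis
  proof
    show "exact_at (hom_cplx R Y N) (- n)" if "chain_complex R Y" "\<And>n. projective R (obj Y n)" "bounded_below_cplx Y"
      "\<And>n. exact_at Y n" for Y :: "('r, 'u) cplx" and n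
      by (rule hom_cplx_exact[OF N that])
    fix c n and Y W :: "('r, 'u) cplx" and inc prj sec ret
    assume "split_ext R (shift_cplx c (free_res R M)) Y W inc prj sec ret"
    then interpret S: complex_ses R "hom_cplx R (shift_cplx c (free_res R M)) N" "hom_cplx R W N" "hom_cplx R Y N"
      "\<lambda>n h. \<lambda>w\<in>carrier (obj W (- n)). h (prj (- n) w)" "\<lambda>n h. \<lambda>y\<in>carrier (obj Y (- n)). h (inc (- n) y)"
      by (rule split_ext.hom_ses[OF _ N])
    show "exact_at (hom_cplx R (free_res R M) N) (- (n - c)) \<Longrightarrow> exact_at (hom_cplx R Y N) (- n) \<Longrightarrow>
        exact_at (hom_cplx R W N) (- n)"
      using S.exact_middle[of "- n"] by (simp add: hom_shift exact_at_shift algebra_simps)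
    show "exact_at (hom_cplx R W N) (- n) \<Longrightarrow> exact_at (hom_cplx R Y N) (- (n - 1)) \<Longrightarrow>
        exact_at (hom_cplx R (free_res R M) N) (- (n - c))"
      \<comment> \<open>Compared with the tensor product, left and right segments are exchanged,
        because Hom reverses the extension.\<close>
      using S.exact_left[of "- n"] by (simp add: hom_shift exact_at_shift algebra_simps)
    show "exact_at (hom_cplx R (free_res R M) N) (- (n + 1 - c)) \<Longrightarrow> exact_at (hom_cplx R W N) (- n) \<Longrightarrow>
        exact_at (hom_cplx R Y N) (- n)"
      using S.exact_right[of "- n"] by (simp add: hom_shift exact_at_shift algebra_simps)
  qed
qed

section \<open>Moving P to the type of the tower\<close>

definition zero_cplx :: "'r ring \<Rightarrow> ('r, 's \<Rightarrow> 'r) cplx" where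
  "zero_cplx R = \<lparr>obj = (\<lambda>_. free_module R {}), dif = (\<lambda>_ _ _. \<zero>\<^bsub>R\<^esub>)\<rparr>"

lemma zero_cplx:
  fixes R :: "'r ring"
  defines "Z \<equiv> zero_cplx R :: ('r, 's \<Rightarrow> 'r) cplx"
  assumes "cring R"
  shows "chain_complex R Z" and "projective R (obj Z n)" and "bounded_below_cplx Z" and "zero_module (obj Z n)"
    and "exact_at Z n"
proof -
  interpret cring R by fact
  show z: "zero_module (obj Z n)" for n
    by (auto simp: Z_def zero_cplx_def zero_module_def free_module_simps fun_eq_iff)
  then show "bounded_below_cplx Z" by (simp add: bounded_below_cplx_def)
  show "projective R (obj Z n)" by (simp add: Z_def zero_cplx_def projective_free_module[OF assms(2)])
  show c: "chain_complex R Z"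
    by (auto simp: Z_def zero_cplx_def chain_complex_def module_free_module[OF assms(2)] lin_maps_def free_module_simps)
  show "exact_at Z n" by (rule exact_at_zero[OF c z])
qed

text \<open>The cone of the zero map from the zero complex is a copy of Y over the type
  \<open>'u\<close>. As it is again a split extension, vanishing after tensoring or dualizing passes
  to the copy by the sequences already proved.\<close>

lemma embed_complex:
  fixes e :: "('s \<Rightarrow> 'r) \<Rightarrow> 'y \<Rightarrow> 'u" and Y :: "('r, 'y) cplx"
  assumes M: "module R M" and pairing: "pairing e p1 p2" and Y: "homology_powers R M a Y"
  obtains W :: "('r, 'u) cplx" and inc prj sec ret where
    "split_ext R (zero_cplx R :: ('r, 's \<Rightarrow> 'r) cplx) Y W inc prj sec ret" "homology_powers R M a W"
proof -
  note Z = zero_cplx[OF module_cring[OF M]]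
  have cY: "chain_complex R Y" and bY: "bounded_below_cplx Y" and pY: "\<And>n. projective R (obj Y n)"
    and hY: "\<And>q. homology_power R M Y q (a q)" and fin: "finite {q. a q \<noteq> 0}"
    using Y by (auto simp: homology_powers_def)
  interpret pairing e p1 p2 by (rule pairing)
  interpret C: mapping_cone e p1 p2 R "zero_cplx R" Y "\<lambda>n _. \<zero>\<^bsub>obj Y (n - 1)\<^esub>"
  proof
    fix n
    interpret Y: module R "obj Y k" for k by (rule chain_complexD[OF cY])
    show "\<zero>\<^bsub>obj Y (n - 1 - 1)\<^esub> \<oplus>\<^bsub>obj Y (n - 1 - 1)\<^esub> dif Y (n - 1) \<zero>\<^bsub>obj Y (n - 1)\<^esub> = \<zero>\<^bsub>obj Y (n - 1 - 1)\<^esub>"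
      using lin_maps_zero[OF chain_complexD(1)[OF cY] chain_complexD(1)[OF cY] chain_complexD(2)[OF cY], of "n - 1"]
      by simp
  qed (fact Z cY lin_maps_const_zero[OF chain_complexD(1)[OF cY]])+
  have "homology_powers R M a C.cone"
    unfolding homology_powers_def
    using C.chain_complex_cone C.bounded_below_middle[OF Z(3) bY] C.projective_middle[OF Z(2) pY]
      C.homology_power_cone[OF Z(4) Z(4) hY] fin by blast
  then show ?thesis by (rule that[OF C.split_ext_axioms])
qed

text \<open>The only homology of the resolution is M in degree 0, where every element now lies in
  the kernel of the augmentation.\<close>

lemma free_res_acyclic:
  assumes M: "module R M" and z: "zero_module M"
  shows "exact_at (free_res R M) n"
proof -
  note F = free_res_is_resolution[OF M]
  consider "n < 0" | "n = 0" | "n > 0" by linarith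
  then show ?thesis
  proof cases
    case 1 then show ?thesis by (rule exact_at_zero[OF F(1) F(3)])
  next
    case 2
    then show ?thesis
      using F(7) lin_mapsD(1)[OF F(5)] z by (auto simp: exact_at_def a_kernel_alt mem_cycles_iff zero_module_def)
  next
    case 3 then show ?thesis using F(4) by (simp add: exact_at_def)
  qed
qed

text \<open>If M has a nonzero element x, the constant vector x is nonzero in M^k for k > 0. This
  makes the exponents detect the homology.\<close>

lemma homology_power_exact_iff:
  assumes C: "chain_complex R C" and M: "module R M" "\<not> zero_module M" and h: "homology_power R M C q k"
  shows "exact_at C q \<longleftrightarrow> k = 0"
proof
  assume ex: "exact_at C q"
  interpret M: module R M by (rule M)
  obtain x where x: "x \<in> carrier M" "x \<noteq> \<zero>\<^bsub>M\<^esub>" using M(2) by (auto simp: zero_module_def)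
  have "(\<lambda>j\<in>{..<k}. x) \<in> carrier (direct_power M k)" using x by (simp add: direct_power_simps)
  moreover have "y = \<zero>\<^bsub>direct_power M k\<^esub>" if "y \<in> carrier (direct_power M k)" for y
  proof -
    obtain \<theta> where "\<theta> ` cycles C q = carrier (direct_power M k)"
      "\<And>z. z \<in> cycles C q \<Longrightarrow> \<theta> z = \<zero>\<^bsub>direct_power M k\<^esub> \<longleftrightarrow> z \<in> boundaries C q"
      using h unfolding homology_power_def by blast
    then show ?thesis using that ex by (force simp: exact_at_def)
  qed
  ultimately have eq: "(\<lambda>j\<in>{..<k}. x) = \<zero>\<^bsub>direct_power M k\<^esub>" by blast
  show "k = 0"
  proof (rule ccontr)
    assume "k \<noteq> 0"
    then show False using fun_cong[OF eq, of 0] x(2) by (simp add: direct_power_simps)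
  qed
qed (use h homology_power_0[OF C, of M q] in simp)

lemma quasi_projective_resolution_powers:
  assumes P: "finite_quasi_projective_resolution R M P" and M: "module R M" "\<not> zero_module M"
  obtains a where "homology_powers R M a P" "\<And>q. a q \<noteq> 0 \<longleftrightarrow> \<not> zero_module (homology P q)" "\<exists>q. a q \<noteq> 0"
proof -
  obtain a where cP: "chain_complex R P" and bP: "bounded_below_cplx P" "bounded_above_cplx P"
    and pP: "\<And>n. projective R (obj P n)"
    and iso: "\<And>i. cinf P \<le> ereal (of_int i) \<Longrightarrow> module_iso R (homology P i) (direct_power M (a i))"
    and ne: "\<exists>i. cinf P \<le> ereal (of_int i) \<and> a i \<noteq> 0"
    using P by (auto simp: finite_quasi_projective_resolution_def quasi_projective_resolution_def bounded_cplx_def)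
  \<comment> \<open>The isomorphisms are given only from \<open>cinf P\<close> on. Below it the
    modules of P are zero, so the exponent is reset to 0.\<close>
  define a' where "a' i = (if cinf P \<le> ereal (of_int i) then a i else 0)" for i
  have h: "homology_power R M P q (a' q)" for q
  proof (cases "cinf P \<le> ereal (of_int q)")
    case True
    then show ?thesis using homology_power_iso[OF cP iso M(1)] by (simp add: a'_def)
  next
    case False
    then have "zero_module (obj P q)"
      unfolding cinf_def by (metis (mono_tags, lifting) Inf_lower mem_Collect_eq)
    then show ?thesis using exact_at_zero[OF cP] by (simp add: False a'_def homology_power_0[OF cP])
  qed
  have iff: "a' q \<noteq> 0 \<longleftrightarrow> \<not> zero_module (homology P q)" for q
    using homology_power_exact_iff[OF cP M h, of q] zero_homology_iff[OF cP] by simp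
  obtain k l where kl: "\<And>i. i < k \<Longrightarrow> zero_module (obj P i)" "\<And>i. i > l \<Longrightarrow> zero_module (obj P i)"
    using bP unfolding bounded_below_cplx_def bounded_above_cplx_def by blast
  have "{q. a' q \<noteq> 0} \<subseteq> {k..l}"
    using kl exact_at_zero[OF cP] iff zero_homology_iff[OF cP] by (metis (mono_tags, lifting) atLeastAtMost_iff mem_Collect_eq not_less subsetI)
  then have "finite {q. a' q \<noteq> 0}" by (rule finite_subset) simp
  then have "homology_powers R M a' P" using cP bP pP h by (simp add: homology_powers_def)
  moreover have "\<exists>q. a' q \<noteq> 0" using ne by (auto simp: a'_def)
  ultimately show ?thesis using that iff by blast
qed

section \<open>Rigidity\<close>

text \<open>Strong induction on i. Beyond n + l, the first entry of the supremum keeps the window of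
  earlier degrees at or above n, and the second gives i + b > h.\<close>

lemma vanishing_from_gap:
  fixes T v :: "int \<Rightarrow> bool" and h l :: ereal and b t n :: int
  assumes h: "\<And>i. h < ereal (of_int i) \<Longrightarrow> v i"
    and step: "\<And>p. v (p + b) \<Longrightarrow> (\<And>i. p - 1 - (t - b) \<le> i \<Longrightarrow> i < p \<Longrightarrow> T i) \<Longrightarrow> T p"
    and l: "l = sup (ereal (of_int t) - ereal (of_int b)) (h - ereal (of_int b) - 1)"
    and n: "n \<ge> 1" and bt: "b \<le> t"
    and gap: "\<And>i. n \<le> i \<Longrightarrow> ereal (of_int i) \<le> ereal (of_int n) + l \<Longrightarrow> T i"
    and i: "i \<ge> n"
  shows "T i"
  using i
proof (induction "nat (i - n)" arbitrary: i rule: less_induct)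
  case less
  show ?case
  proof (cases "ereal (of_int i) \<le> ereal (of_int n) + l")
    case True
    then show ?thesis using gap less.prems by blast
  next
    case False
    have l1: "ereal (of_int (t - b)) \<le> l" and l2: "h - ereal (of_int b) - 1 \<le> l" using l by simp_all
    \<comment> \<open>Here l is finite: it is at least t - b, and l = \<infinity> would place i in
      the assumed range.\<close>
    obtain L where L: "l = ereal L" using False l1 by (cases l) auto
    have iL: "of_int i > of_int n + L" using False L by simp
    have "of_int (t - b) \<le> L" using l1 L by simp
    then have gt: "i - 1 - (t - b) \<ge> n" using iL by linarith
    have "h < ereal (of_int (i + b))"
    proof (cases h)
      case (real H)
      then have "H - of_int b - 1 \<le> L" using l2 L by (simp add: one_ereal_def)
      \<comment> \<open>From i > n + L and n \<ge> 1 one gets i > H - b; this is where the -1 in l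
        is absorbed.\<close>
      then show ?thesis using iL n real by simp
    \<comment> \<open>An infinite h is harmless: h = \<infinity> contradicts the finiteness of l,
      and for h = -\<infinity> the claim is trivial.\<close>
    qed (use l2 L in \<open>auto simp: one_ereal_def\<close>)
    then have "v (i + b)" by (rule h)
    then show ?thesis
    proof (rule step)
      fix j assume "i - 1 - (t - b) \<le> j" "j < i"
      then show "T j" using less.hyps[of j] gt by simp
    qed
  qed
qed

text \<open>Descending induction from a degree J beyond which T holds; the lower bound on i keeps
  \<open>v (i + t)\<close> available all the way down.\<close>

lemma vanishing_from_eventual:
  fixes T v :: "int \<Rightarrow> bool" and h :: ereal and t :: int
  assumes h: "\<And>i. h < ereal (of_int i) \<Longrightarrow> v i"
    and step: "\<And>p. v (p + t) \<Longrightarrow> (\<And>i. i > p \<Longrightarrow> T i) \<Longrightarrow> T p"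
    and ev: "eventually T at_top" and i: "ereal (of_int i) > h - ereal (of_int t)"
  shows "T i"
proof -
  obtain J where J: "\<And>j. j \<ge> J \<Longrightarrow> T j" using ev by (auto simp: eventually_at_top_linorder)
  have "\<forall>j\<ge>i. T j"
    if "i \<le> J" "ereal (of_int i) > h - ereal (of_int t)" for i
    using that
  proof (induction i rule: int_le_induct)
    case base
    then show ?case using J by blast
  next
    case (step i)
    have "h < ereal (of_int (i - 1 + t))" using step.prems by (cases h) auto
    then have "v (i - 1 + t)" by (rule h)
    moreover have "h - ereal (of_int t) < ereal (of_int i)"
      using step.prems by (rule order.strict_trans) simp
    then have "\<forall>j\<ge>i. T j" by (rule step.IH)
    ultimately have "T (i - 1)" using assms(2)[of "i - 1"] by simp
    then show ?case using \<open>\<forall>j\<ge>i. T j\<close> by (metis antisym_conv2 zle_diff1_eq not_less)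
  qed
  then show ?thesis using J[of i] i by (cases "i \<le> J") auto
qed

text \<open>\<open>C\<close> supplies hsup and hinf while vanishing is tested on \<open>Y\<close>:
  in the application \<open>C\<close> is P and \<open>Y\<close> its copy over the type of the tower.
  The bound \<open>h\<close> becomes hsup(P \<otimes> N) for Tor and -hinf(Hom(P, N)) for
  Ext.\<close>

lemma (in vanishing) rigidity:
  assumes Y: "homology_powers R M a Y" and a: "\<exists>q. a q \<noteq> 0" and C: "\<And>q. a q \<noteq> 0 \<longleftrightarrow> \<not> zero_module (homology C q)"
    and h: "\<forall>i. h < ereal (of_int i) \<longrightarrow> v Y i"
  shows "l = sup (hsup C - hinf C) (h - hinf C - 1) \<Longrightarrow> n \<ge> 1 \<Longrightarrow>
      (\<And>i. n \<le> i \<Longrightarrow> ereal (of_int i) \<le> ereal (of_int n) + l \<Longrightarrow> T i) \<Longrightarrow> n \<le> i \<Longrightarrow> T i"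
    and "eventually T at_top \<Longrightarrow> ereal (of_int i) > h - hsup C \<Longrightarrow> T i"
proof -
  have fin: "finite {q. a q \<noteq> 0}" using Y by (simp add: homology_powers_def)
  define b t where "b = Min {q. a q \<noteq> 0}" and "t = Max {q. a q \<noteq> 0}"
  have bt: "a b \<noteq> 0" "a t \<noteq> 0" using Min_in[OF fin] Max_in[OF fin] a by (auto simp: b_def t_def)
  have btq: "b \<le> q" "q \<le> t" if "a q \<noteq> 0" for q using fin that by (auto simp: b_def t_def)
  have hsup: "hsup C = ereal (of_int t)"
    unfolding hsup_def by (rule Sup_eqI) (use bt btq C in auto)
  have hinf: "hinf C = ereal (of_int b)"
    unfolding hinf_def by (rule Inf_eqI) (use bt btq C in auto)
  have step: "T p" if "v Y (p + b)" "\<And>i. p - 1 - (t - b) \<le> i \<Longrightarrow> i < p \<Longrightarrow> T i" for p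
  proof (rule bottom_step[OF Y bt(1) that(1)])
    show "b \<le> q \<and> T (p + b - 1 - q)" if "a q \<noteq> 0" for q
      using btq[OF that] \<open>\<And>i. p - 1 - (t - b) \<le> i \<Longrightarrow> i < p \<Longrightarrow> T i\<close>[of "p + b - 1 - q"] by simp
  qed
  show "T i" if "l = sup (hsup C - hinf C) (h - hinf C - 1)" "n \<ge> 1"
      "\<And>i. n \<le> i \<Longrightarrow> ereal (of_int i) \<le> ereal (of_int n) + l \<Longrightarrow> T i" "n \<le> i"
    using vanishing_from_gap[of h "v Y" b t T l n i, OF h[rule_format] step that(1)[unfolded hsup hinf] that(2) btq(1)[OF bt(2)] that(3,4)]
    by blast
  show "T i" if "eventually T at_top" "ereal (of_int i) > h - hsup C"
    using vanishing_from_eventual[of h "v Y" t T i, OF h[rule_format] top_step[OF Y bt(2) btq(2)] that[unfolded hsup]] by blast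
qed

section \<open>Translation to Tor and Ext, and the four statements\<close>

lemma Tor_zero_iff:
  assumes "module R M" "module R N"
  shows "zero_module (Tor R i M N) \<longleftrightarrow> exact_at (tensor_cplx R (free_res R M) N) i"
  unfolding Tor_def by (rule zero_homology_iff[OF chain_complex_tensor[OF free_res_is_resolution(1)]]) fact+

lemma Ext_zero_iff:
  assumes "module R M" "module R N"
  shows "zero_module (Ext R i M N) \<longleftrightarrow> exact_at (hom_cplx R (free_res R M) N) (- i)"
  unfolding Ext_def by (rule zero_homology_iff[OF chain_complex_hom[OF free_res_is_resolution(1)]]) fact+

lemma zero_homology_above_hsup: "hsup C < ereal (of_int i) \<Longrightarrow> zero_module (homology C i)"
  unfolding hsup_def using Sup_upper[of "ereal (of_int i)" "{ereal (of_int i) |i. \<not> zero_module (homology C i)}"]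
  by (auto simp: not_le[symmetric])

lemma zero_homology_below_hinf: "ereal (of_int i) < hinf C \<Longrightarrow> zero_module (homology C i)"
  unfolding hinf_def using Inf_lower[of "ereal (of_int i)" "{ereal (of_int i) |i. \<not> zero_module (homology C i)}"]
  by (auto simp: not_le[symmetric])

theorem theorem6p2:
  fixes R :: "'r ring"
    and M :: "('r, 'm) module"
    and N :: "('r, 'n) module"
    and P :: "('r, 'p) cplx"
    and l m :: ereal
    and n :: int
  assumes "cring R" and "noetherian_ring R"
    and "module R M" and "module R N"
    and "finite_quasi_projective_resolution R M P"
    and "l = sup (hsup P - hinf P) (hsup (tensor_cplx R P N) - hinf P - 1)"
    and "m = sup (hsup P - hinf P) (- hinf (hom_cplx R P N) - hinf P - 1)"
    and "n \<ge> 1"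
  shows "((\<forall>i :: int. n \<le> i \<and> ereal (of_int i) \<le> ereal (of_int n) + l \<longrightarrow>
              zero_module (Tor R i M N)) \<longrightarrow>
            (\<forall>i :: int. i \<ge> n \<longrightarrow> zero_module (Tor R i M N))) \<and>
         ((\<forall>i :: int. n \<le> i \<and> ereal (of_int i) \<le> ereal (of_int n) + m \<longrightarrow>
              zero_module (Ext R i M N)) \<longrightarrow>
            (\<forall>i :: int. i \<ge> n \<longrightarrow> zero_module (Ext R i M N))) \<and>
         ((\<forall>\<^sub>F i :: int in at_top. zero_module (Tor R i M N)) \<longrightarrow>
            (\<forall>i :: int. ereal (of_int i) > hsup (tensor_cplx R P N) - hsup P \<longrightarrow>
              zero_module (Tor R i M N))) \<and>
         ((\<forall>\<^sub>F i :: int in at_top. zero_module (Ext R i M N)) \<longrightarrow>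
            (\<forall>i :: int. ereal (of_int i) > - hinf (hom_cplx R P N) - hsup P \<longrightarrow>
              zero_module (Ext R i M N)))"
proof (cases "zero_module M")
  \<comment> \<open>For M = 0 the exponents say nothing about the homology of P. Here the free
    resolution is itself an acyclic complex of projectives, so Tor and Ext vanish in every
    degree.\<close>
  case True
  note F = free_res_is_resolution[OF \<open>module R M\<close>]
  have bF: "bounded_below_cplx (free_res R M)" using F(3) by (auto simp: bounded_below_cplx_def)
  show ?thesis
    using tensor_cplx_exact[OF \<open>module R N\<close> F(1,2) bF free_res_acyclic[OF \<open>module R M\<close> True]]
      hom_cplx_exact[OF \<open>module R N\<close> F(1,2) bF free_res_acyclic[OF \<open>module R M\<close> True]]
    by (simp add: Tor_zero_iff[OF assms(3,4)] Ext_zero_iff[OF assms(3,4)])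
next
  case False
  obtain a where P: "homology_powers R M a P" and C: "\<And>q. a q \<noteq> 0 \<longleftrightarrow> \<not> zero_module (homology P q)"
    and a: "\<exists>q. a q \<noteq> 0"
    using quasi_projective_resolution_powers[OF assms(5,3) False] by metis
  have cP: "chain_complex R P" using P by (simp add: homology_powers_def)
  \<comment> \<open>All cones live on sequences: attaching a cell conses its coordinate onto the sequence.\<close>
  define e where "e x u = case_nat (Inr x) u" for x :: "('r, 'm) gen \<Rightarrow> 'r" and u :: "nat \<Rightarrow> 'p + (('r, 'm) gen \<Rightarrow> 'r)"
  define p1 where "p1 u = projr (u 0)" for u :: "nat \<Rightarrow> 'p + (('r, 'm) gen \<Rightarrow> 'r)"
  define p2 where "p2 u = (\<lambda>n. u (Suc n))" for u :: "nat \<Rightarrow> 'p + (('r, 'm) gen \<Rightarrow> 'r)"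
  \<comment> \<open>An element \<open>y\<close> of P becomes the constant sequence
    \<open>Inl y\<close> behind one entry for the zero complex; \<open>p2'\<close> reads it back at
    index 1.\<close>
  define e' where "e' x y = e x (\<lambda>_. Inl y)" for x :: "('r, 'm) gen \<Rightarrow> 'r" and y :: 'p
  define p2' where "p2' u = projl (u 1)" for u :: "nat \<Rightarrow> 'p + (('r, 'm) gen \<Rightarrow> 'r)"
  have pair: "pairing e p1 p2" by unfold_locales (simp_all add: e_def p1_def p2_def)
  have pair': "pairing e' p1 p2'" by unfold_locales (simp_all add: e_def e'_def p1_def p2'_def)
  obtain Y :: "('r, nat \<Rightarrow> 'p + (('r, 'm) gen \<Rightarrow> 'r)) cplx" and inc prj sec ret where
    S: "split_ext R (zero_cplx R :: ('r, ('r, 'm) gen \<Rightarrow> 'r) cplx) P Y inc prj sec ret" and Y: "homology_powers R M a Y"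
    using embed_complex[OF assms(3) pair' P] by blast
  note Z = zero_cplx[OF assms(1)]
  interpret T: vanishing e p1 p2 R M "\<lambda>Y. exact_at (tensor_cplx R Y N)" "exact_at (tensor_cplx R (free_res R M) N)"
    by (rule vanishing_tensor[OF pair assms(3,4)])
  interpret E: vanishing e p1 p2 R M "\<lambda>Y n. exact_at (hom_cplx R Y N) (- n)"
    "\<lambda>n. exact_at (hom_cplx R (free_res R M) N) (- n)"
    by (rule vanishing_hom[OF pair assms(3,4)])
  \<comment> \<open>\<open>Y\<close> is an extension of the zero complex by P, so
    \<open>exact_middle\<close> transfers vanishing from P \<otimes> N.\<close>
  have hT: "\<forall>i. hsup (tensor_cplx R P N) < ereal (of_int i) \<longrightarrow> exact_at (tensor_cplx R Y N) i"
    using complex_ses.exact_middle[OF split_ext.tensor_ses[OF S assms(4)] _ tensor_cplx_exact[OF assms(4) Z(1-3,5)]]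
      zero_homology_above_hsup zero_homology_iff[OF chain_complex_tensor[OF cP assms(4)]] by blast
  have hE: "\<forall>i. - hinf (hom_cplx R P N) < ereal (of_int i) \<longrightarrow> exact_at (hom_cplx R Y N) (- i)"
  proof (intro allI impI)
    fix i :: int assume that: "- hinf (hom_cplx R P N) < ereal (of_int i)"
    \<comment> \<open>H^i(Hom(P, N)) sits in homological degree -i, which turns the bound into one
      below hinf.\<close>
    have "ereal (of_int (- i)) < hinf (hom_cplx R P N)"
      using that by (simp add: ereal_uminus_less_reorder flip: uminus_ereal.simps(1))
    then show "exact_at (hom_cplx R Y N) (- i)"
      using complex_ses.exact_middle[OF split_ext.hom_ses[OF S assms(4)] hom_cplx_exact[OF assms(4) Z(1-3,5)]]
        zero_homology_below_hinf zero_homology_iff[OF chain_complex_hom[OF cP assms(4)]] by blast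
  qed
  note T = T.rigidity[OF Y a C] and E = E.rigidity[OF Y a C]
  show ?thesis
    unfolding Tor_zero_iff[OF assms(3,4)] Ext_zero_iff[OF assms(3,4)]
    using T(1)[OF hT assms(6,8)] E(1)[OF hE assms(7,8)] T(2)[OF hT] E(2)[OF hE] by blast
qed

end
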